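(* Let $(M,\mathcal B,m)$ be a measure space endowed with a metric $d$, let $f:M\to M$ be a measurable map with $f_*m\ll m$, and let $\Delta_0\subset M$ with $0<m(\Delta_0)<\infty$. Let $f^R:\Delta_0\to\Delta_0$ be an induced map for $f$, with return time function $R$ and partition $\mathcal P_0$, which is a weak Gibbs Markov (WGM) map with respect to $\mathcal P_0$, is aperiodic, is expanding, has a coprime block, and satisfies $R\in L^1(m)$. Let $\mu$ be the unique ergodic $f$-invariant probability measure such that $\mu\ll m$ and $\mu(\Delta_0)>0$. Let $\eta>0$. Then: (1) If $m\{R>n\}\le Cn^{-a}$ (for all $n\ge1$) for some $C>0$ and $a>1$, then for all $\epsilon>0$ and $\varphi\in\mathcal H_\eta$ there is some $C'=C'(\epsilon,\varphi)>0$ such that for all $n\ge1$ $$LD_\mu(\varphi,\epsilon,n)\le C'n^{-a+1}.$$ (2) If $m\{R>n\}\le Ce^{-cn^a}$ (for all $n\ge1$) for some $C,c>0$ and $0<a\le1$, then for all $\epsilon>0$ and $\varphi\in\mathcal H_\eta$ there are $C'=C'(\epsilon,\varphi)>0$ and $c'=c'(c,\varphi,\epsilon,\eta)>0$ such that for all $n\ge1$ $$LD_\mu(\varphi,\epsilon,n)\le C'e^{-c'n^{\frac a{a+2}}}.$$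
   Context: **WGM map.** Let $(\Delta_0,\mathcal A,m)$ be a measure space with $0<m(\Delta_0)<\infty$, $F:\Delta_0\to\Delta_0$ measurable, and $\mathcal P_0$ a finite or countable ($m$ mod 0) partition of $\Delta_0$ into invertibility domains of $F$ ($F$ is a bijection from each $\omega\in\mathcal P_0$ onto $F(\omega)$ with measurable inverse). Put $\mathcal P_0^n=\bigvee_{i=0}^{n-1}F^{-i}(\mathcal P_0)$. $F$ is a weak Gibbs Markov (WGM) map with respect to $\mathcal P_0$ if: (W1) Markov: $F$ maps each $\omega\in\mathcal P_0$ bijectively to an ($m$ mod 0) union of elements of $\mathcal P_0$; (W2) Separability: the sequence $(\mathcal P_0^n)_n$ generates $\mathcal A$ ($m$ mod 0) and $\bigvee_{i=0}^\infty F^{-i}(\mathcal P_0)$ is the partition into single points; (W3) Nonsingular: there is a strictly positive measurable function $J_F$ on $\Delta_0$ with $m(F(A))=\int_AJ_F\,dm$ for each measurable $A\subset\omega\in\mathcal P_0$; (W4) Gibbs: there are $C_F>0$ and $0<\beta<1$ such that for all $\omega\in\mathcal P_0$ and $x,y\in\omega$, $\log\frac{J_F(x)}{J_F(y)}\le C_F\beta^{s(F(x),F(y))}$, where $s(x,y)=\min\{n\ge0: F^n(x)\text{ and }F^n(y)\text{ lie in distinct elements of }\mathcal P_0\}$; (W5) Long branches: there is $\delta_0>0$ with $m(F(\omega))\ge\delta_0$ for all $\omega\in\mathcal P_0$. **Induced map.** $F:\Delta_0\to\Delta_0$ is an induced map for $f$, denoted $f^R$, if there are a countable ($m$ mod 0)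 partition $\mathcal P_0$ of $\Delta_0$ and a measurable $R:\Delta_0\to\mathbb N$, constant on elements of $\mathcal P_0$, with $F|_\omega=f^{R(\omega)}|_\omega$ for $\omega\in\mathcal P_0$. The restriction of $m$ to $\Delta_0$ is also denoted $m$. - *Aperiodic*: for all $\omega_1,\omega_2\in\mathcal P_0$ there is $k_0\in\mathbb N$ such that $m(\omega_1\cap(f^R)^{-n}(\omega_2))>0$ for all $n\ge k_0$. - *Coprime block*: there exist $N\ge2$ and $\omega_1,\dots,\omega_N\in\mathcal P_0$ with $\gcd\{R(\omega_i)\}_i=1$ and $f^R(\omega_i)\supseteq\omega_1\cup\cdots\cup\omega_N$ ($m$ mod 0) for all $i=1,\dots,N$. - *Expanding*: there are $C>0$, $0<\beta<1$ such that for all $\omega\in\mathcal P_0$ and $x,y\in\omega$: (i) $d(f^R(x),f^R(y))\le C\beta^{s(x,y)}$; (ii) $d(f^j(x),f^j(y))\le C\,d(f^R(x),f^R(y))$ for all $0\le j\le R$. **Observables and large deviations.** $\mathcal H_\eta$ is the set of $\varphi:M\to\mathbb R$ that are $\eta$-Hölder: $\sup_{x\ne y}\frac{|\varphi(x)-\varphi(y)|}{d(x,y)^\eta}<\infty$; its elements are understood to lie in $L^\infty(M,m)$. For $\epsilon>0$, $$LD_\mu(\varphi,\epsilon,n)=\mu\left(\left|\frac1n\sum_{i=0}^{n-1}\varphi\circ f^i-\int\varphi\,d\mu\right|>\epsilon\right).$$ *)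

theory Defs
  imports "HOL-Probability.Probability"
begin

text \<open>The notions concerning the map \<open>F : \<Delta>\<^sub>0 \<rightarrow> \<Delta>\<^sub>0\<close> are stated for a measure space \<open>N\<close>; they are
  used with \<open>N = restrict_space m \<Delta>\<^sub>0\<close>.\<close>

definition partition_mod0 :: "'a measure \<Rightarrow> 'a set set \<Rightarrow> bool" where
  "partition_mod0 N P \<longleftrightarrow>
     countable P \<and> P \<subseteq> sets N \<and> disjoint P \<and> space N - \<Union>P \<in> null_sets N"

definition invertibility_domain :: "'a measure \<Rightarrow> ('a \<Rightarrow> 'a) \<Rightarrow> 'a set \<Rightarrow> bool" where
  "invertibility_domain N F \<omega> \<longleftrightarrow>
     \<omega> \<in> sets N \<and> inj_on F \<omega> \<and> F ` \<omega> \<in> sets N \<and>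
     inv_into \<omega> F \<in> restrict_space N (F ` \<omega>) \<rightarrow>\<^sub>M restrict_space N \<omega>"

text \<open>The join of the \<open>F\<^sup>-\<^sup>i(P)\<close> over \<open>i \<in> I\<close>; \<open>I = {..<n}\<close> gives \<open>P\<^sup>n\<close>, and \<open>I = UNIV\<close> the join of all
  preimages.\<close>

definition iter_join :: "'a measure \<Rightarrow> ('a \<Rightarrow> 'a) \<Rightarrow> 'a set set \<Rightarrow> nat set \<Rightarrow> 'a set set" where
  "iter_join N F P I =
     {A. A \<noteq> {} \<and> (\<exists>w. (\<forall>i\<in>I. w i \<in> P) \<and> A = {x \<in> space N. \<forall>i\<in>I. (F ^^ i) x \<in> w i})}"

text \<open>Since \<open>P\<close> covers the space only mod 0, "in distinct elements" is read as "not in a common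
  element"; the two agree wherever both points lie in \<open>\<Union>P\<close>. Otherwise a pair of points whose orbits
  leave \<open>\<Union>P\<close> simultaneously (say, through the endpoints of the branches of an interval map) would
  never be separated. The infimum of the empty set is \<open>\<infinity>\<close>.\<close>

definition separation_time :: "('a \<Rightarrow> 'a) \<Rightarrow> 'a set set \<Rightarrow> 'a \<Rightarrow> 'a \<Rightarrow> enat" where
  "separation_time F P x y =
     (INF n \<in> {n. \<not> (\<exists>\<omega>\<in>P. (F ^^ n) x \<in> \<omega> \<and> (F ^^ n) y \<in> \<omega>)}. enat n)"

text \<open>\<open>\<beta>\<^sup>s\<close> with \<open>\<beta>\<^sup>\<infinity> = 0\<close>, for \<open>0 < \<beta> < 1\<close>.\<close>

definition epow :: "real \<Rightarrow> enat \<Rightarrow> real" where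
  "epow \<beta> s = (case s of enat n \<Rightarrow> \<beta> ^ n | \<infinity> \<Rightarrow> 0)"

definition markov :: "'a measure \<Rightarrow> ('a \<Rightarrow> 'a) \<Rightarrow> 'a set set \<Rightarrow> bool" where
  "markov N F P \<longleftrightarrow>
     (\<forall>\<omega>\<in>P. inj_on F \<omega> \<and> (\<exists>Q\<subseteq>P. sym_diff (F ` \<omega>) (\<Union>Q) \<in> null_sets N))"

definition separability :: "'a measure \<Rightarrow> ('a \<Rightarrow> 'a) \<Rightarrow> 'a set set \<Rightarrow> bool" where
  "separability N F P \<longleftrightarrow>
     (\<forall>A\<in>sets N. \<exists>B\<in>sigma_sets (space N) (\<Union>n. iter_join N F P {..<n}).
        sym_diff A B \<in> null_sets N) \<and>
     (\<forall>A\<in>iter_join N F P UNIV. is_singleton A)"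

definition jacobian :: "'a measure \<Rightarrow> ('a \<Rightarrow> 'a) \<Rightarrow> 'a set set \<Rightarrow> ('a \<Rightarrow> real) \<Rightarrow> bool" where
  "jacobian N F P J \<longleftrightarrow>
     J \<in> borel_measurable N \<and> (\<forall>x\<in>space N. 0 < J x) \<and>
     (\<forall>\<omega>\<in>P. \<forall>A\<in>sets N. A \<subseteq> \<omega> \<longrightarrow> emeasure N (F ` A) = (\<integral>\<^sup>+x\<in>A. ennreal (J x) \<partial>N))"

definition gibbs :: "('a \<Rightarrow> 'a) \<Rightarrow> 'a set set \<Rightarrow> ('a \<Rightarrow> real) \<Rightarrow> bool" where
  "gibbs F P J \<longleftrightarrow>
     (\<exists>C>0. \<exists>\<beta>. 0 < \<beta> \<and> \<beta> < 1 \<and>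
        (\<forall>\<omega>\<in>P. \<forall>x\<in>\<omega>. \<forall>y\<in>\<omega>. ln (J x / J y) \<le> C * epow \<beta> (separation_time F P (F x) (F y))))"

definition long_branches :: "'a measure \<Rightarrow> ('a \<Rightarrow> 'a) \<Rightarrow> 'a set set \<Rightarrow> bool" where
  "long_branches N F P \<longleftrightarrow> (\<exists>\<delta>>0. \<forall>\<omega>\<in>P. measure N (F ` \<omega>) \<ge> \<delta>)"

definition weak_gibbs_markov :: "'a measure \<Rightarrow> ('a \<Rightarrow> 'a) \<Rightarrow> 'a set set \<Rightarrow> bool" where
  "weak_gibbs_markov N F P \<longleftrightarrow>
     0 < emeasure N (space N) \<and> emeasure N (space N) < \<infinity> \<and> F \<in> N \<rightarrow>\<^sub>M N \<and>
     partition_mod0 N P \<and> (\<forall>\<omega>\<in>P. invertibility_domain N F \<omega>) \<and>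
     markov N F P \<and> separability N F P \<and>
     (\<exists>J. jacobian N F P J \<and> gibbs F P J) \<and> long_branches N F P"

text \<open>\<open>F\<close> plays the role of \<open>f\<^sup>R\<close>. It is prescribed only on \<open>\<Union>P\<close>, that is, mod 0.\<close>

definition induced_map ::
  "'a measure \<Rightarrow> ('a \<Rightarrow> 'a) \<Rightarrow> ('a \<Rightarrow> 'a) \<Rightarrow> ('a \<Rightarrow> nat) \<Rightarrow> 'a set set \<Rightarrow> bool" where
  "induced_map N f F R P \<longleftrightarrow>
     F \<in> N \<rightarrow>\<^sub>M N \<and> partition_mod0 N P \<and>
     R \<in> N \<rightarrow>\<^sub>M count_space UNIV \<and> (\<forall>x\<in>space N. 1 \<le> R x) \<and>
     (\<forall>\<omega>\<in>P. R constant_on \<omega> \<and> (\<forall>x\<in>\<omega>. F x = (f ^^ R x) x))"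

definition aperiodic :: "'a measure \<Rightarrow> ('a \<Rightarrow> 'a) \<Rightarrow> 'a set set \<Rightarrow> bool" where
  "aperiodic N F P \<longleftrightarrow>
     (\<forall>\<omega>1\<in>P. \<forall>\<omega>2\<in>P. \<exists>k0. \<forall>n\<ge>k0. emeasure N (\<omega>1 \<inter> (F ^^ n) -` \<omega>2) > 0)"

text \<open>\<open>Q = {\<omega>\<^sub>1, \<dots>, \<omega>\<^sub>N}\<close>; \<open>the_elem (R ` \<omega>)\<close> is the constant value \<open>R(\<omega>)\<close>.\<close>

definition coprime_block ::
  "'a measure \<Rightarrow> ('a \<Rightarrow> 'a) \<Rightarrow> ('a \<Rightarrow> nat) \<Rightarrow> 'a set set \<Rightarrow> bool" where
  "coprime_block N F R P \<longleftrightarrow>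
     (\<exists>Q\<subseteq>P. finite Q \<and> card Q \<ge> 2 \<and> Gcd ((\<lambda>\<omega>. the_elem (R ` \<omega>)) ` Q) = 1 \<and>
        (\<forall>\<omega>\<in>Q. \<Union>Q - F ` \<omega> \<in> null_sets N))"

definition expanding ::
  "('a \<Rightarrow> 'a \<Rightarrow> real) \<Rightarrow> ('a \<Rightarrow> 'a) \<Rightarrow> ('a \<Rightarrow> 'a) \<Rightarrow> ('a \<Rightarrow> nat) \<Rightarrow> 'a set set \<Rightarrow> bool" where
  "expanding d f F R P \<longleftrightarrow>
     (\<exists>C>0. \<exists>\<beta>. 0 < \<beta> \<and> \<beta> < 1 \<and>
        (\<forall>\<omega>\<in>P. \<forall>x\<in>\<omega>. \<forall>y\<in>\<omega>.
           d (F x) (F y) \<le> C * epow \<beta> (separation_time F P x y) \<and>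
           (\<forall>j\<le>R x. d ((f ^^ j) x) ((f ^^ j) y) \<le> C * d (F x) (F y))))"

definition ergodic_invariant_prob :: "'a measure \<Rightarrow> ('a \<Rightarrow> 'a) \<Rightarrow> 'a measure \<Rightarrow> bool" where
  "ergodic_invariant_prob m f \<mu> \<longleftrightarrow>
     sets \<mu> = sets m \<and> prob_space \<mu> \<and> distr \<mu> \<mu> f = \<mu> \<and>
     (\<forall>A\<in>sets \<mu>. f -` A \<inter> space \<mu> = A \<longrightarrow> measure \<mu> A = 0 \<or> measure \<mu> A = 1)"

text \<open>No compatibility between the metric and the \<open>\<sigma>\<close>-algebra is assumed, so measurability is part of
  the membership in \<open>L\<^sup>\<infinity>\<close>.\<close>

definition holder_Linf :: "'a measure \<Rightarrow> ('a \<Rightarrow> 'a \<Rightarrow> real) \<Rightarrow> real \<Rightarrow> ('a \<Rightarrow> real) set" where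
  "holder_Linf m d \<eta> =
     {\<phi>. bdd_above {\<bar>\<phi> x - \<phi> y\<bar> / d x y powr \<eta> | x y. x \<in> space m \<and> y \<in> space m \<and> x \<noteq> y} \<and>
         \<phi> \<in> borel_measurable m \<and> (\<exists>B. AE x in m. \<bar>\<phi> x\<bar> \<le> B)}"

definition LD :: "('a \<Rightarrow> 'a) \<Rightarrow> 'a measure \<Rightarrow> ('a \<Rightarrow> real) \<Rightarrow> real \<Rightarrow> nat \<Rightarrow> real" where
  "LD f \<mu> \<phi> \<epsilon> n =
     measure \<mu> {x \<in> space \<mu>.
       \<bar>1 / real n * (\<Sum>i<n. \<phi> ((f ^^ i) x)) - integral\<^sup>L \<mu> \<phi>\<bar> > \<epsilon>}"

end

theory Submission
  imports Defs "HOL-Real_Asymp.Real_Asymp"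
begin

text \<open>
  Write \<open>N\<close> for \<open>m\<close> restricted to \<open>\<Delta>\<^sub>0\<close>. The whole argument runs with respect to \<open>N\<close> itself and rests
  on one consequence of the Gibbs and long branches conditions (\<open>quasi_independence\<close>): given the first
  \<open>n\<close> symbols of a point \<open>x\<close>, the position \<open>F\<^sup>n x\<close> has a density at most \<open>K\<close> with respect to \<open>N\<close>. So
  the past controls the future only up to a bounded factor, and expectations of products along an
  orbit can be estimated one factor at a time, by conditioning on the past.

  Three facts connect this with \<open>\<mu>\<close>.

  \<^item> \<open>F\<close> is ergodic for \<open>N\<close> (\<open>ergodic_F\<close>): an invariant set of positive measure nearly fills some
    cylinder, hence by distortion nearly fills an image of measure at least \<open>\<delta>\<close>, hence fills one of
    finitely many partition elements; aperiodicity spreads it everywhere. Together with the ergodic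
    theorem for \<open>\<mu>\<close>, Birkhoff averages under \<open>f\<close> converge to their \<open>\<mu>\<close>-mean at \<open>N\<close>-almost every point
    (\<open>birkhoff_N\<close>).

  \<^item> \<open>\<mu>(A) \<le> K \<Sum>\<^sub>j N{R > j, f\<^sup>j x \<in> A}\<close> (\<open>domination\<close>): decomposing an orbit of length \<open>i\<close> at its last
    return before time \<open>i\<close>, quasi-independence bounds the law of \<open>f\<^sup>i\<close> under \<open>N\<close> by the right-hand side
    uniformly in \<open>i\<close>, and the time averages of these laws converge to \<open>\<mu>\<close>.

  \<^item> For a bounded observable \<open>\<phi>\<close> of \<open>\<mu>\<close>-mean \<open>0\<close>, the sum of \<open>\<phi>\<close> over the first \<open>k\<close> returns has
    \<open>N\<close>-integral \<open>o(k)\<close> in absolute value (\<open>return_sum_mean_small\<close>). Hoelder continuity and expansion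
    bound it by a function \<open>U\<close> that is constant on \<open>k\<close>-cylinders and still has integral \<open>o(k)\<close>
    (\<open>envelope_mean_small\<close>), while \<open>U\<close> is at most a multiple of the sum of \<open>k\<close> return times.

  Fix \<open>k\<close> with \<open>K \<integral>U\<close> small compared with \<open>\<epsilon> k\<close> and cut the orbit under \<open>F\<close> into blocks of \<open>k\<close>
  returns. The sum of the nonnegative variables \<open>U\<close> over \<open>n/k\<close> blocks, truncated at a level \<open>L\<close>, has an
  exponential moment that factorises over the blocks (\<open>product_bound\<close>), so cancellation is used only
  inside the blocks: a deviation of size \<open>\<epsilon> n\<close> forces either a block above \<open>L\<close> or an event of
  probability \<open>exp (- \<lambda> \<gamma> n / 4)\<close> with \<open>\<gamma> = \<epsilon> / 3\<close> (\<open>large_sum_bound\<close>, \<open>deviation_bound\<close>). This is the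
  argument of Fuk and Nagaev for sums of independent variables with heavy tails.

  What remains is the choice of \<open>L\<close> and \<open>\<lambda>\<close>. For polynomial tails \<open>L\<close> is a small multiple of \<open>n\<close> and
  \<open>\<lambda>\<close> a large multiple of \<open>(ln n) / n\<close>; both \<open>n N{R > L}\<close> and the exponential
  term are then of order \<open>n\<^bsup>1-a\<^esup>\<close>. For
  stretched exponential tails \<open>L = 1 / \<lambda> = n\<^bsup>1/(a+2)\<^esup>\<close>, and \<open>n N{R > L}\<close> has the asserted order.
\<close>

section \<open>Cylinders and bounded distortion\<close>

text \<open>A weak Gibbs Markov map whose Jacobian and whose constants in the Gibbs and long branches conditions
  have been chosen, so that the constants derived from them are fixed as well.\<close>

locale gibbs_markov = finite_measure N for N :: "'a measure" +
  fixes F :: "'a \<Rightarrow> 'a" and P :: "'a set set" and J :: "'a \<Rightarrow> real" and C \<beta> \<delta> :: real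
  assumes F_measurable [measurable]: "F \<in> N \<rightarrow>\<^sub>M N"
    and partition: "partition_mod0 N P"
    and markov: "markov N F P"
    and jacobian: "jacobian N F P J"
    and image_sets: "\<omega> \<in> P \<Longrightarrow> F ` \<omega> \<in> sets N"
    and C_pos: "0 < C" and beta_pos: "0 < \<beta>" and beta_less_1: "\<beta> < 1"
    and gibbs: "\<lbrakk>\<omega> \<in> P; x \<in> \<omega>; y \<in> \<omega>\<rbrakk> \<Longrightarrow>
          ln (J x / J y) \<le> C * epow \<beta> (separation_time F P (F x) (F y))"
    and delta_pos: "0 < \<delta>" and long_branches: "\<omega> \<in> P \<Longrightarrow> \<delta> \<le> measure N (F ` \<omega>)"
    and space_pos: "0 < measure N (space N)"
begin

lemma countable_P: "countable P" and P_sets: "P \<subseteq> sets N" and disjoint_P: "disjoint P"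
  and null_P: "space N - \<Union>P \<in> null_sets N"
  using partition by (auto simp: partition_mod0_def)

lemma P_setsD [measurable_dest, simp]: "\<omega> \<in> P \<Longrightarrow> \<omega> \<in> sets N"
  using P_sets by auto

lemma P_sub_space: "\<omega> \<in> P \<Longrightarrow> \<omega> \<subseteq> space N"
  by (simp add: sets.sets_into_space)

lemma P_unique: "\<lbrakk>\<omega> \<in> P; \<omega>' \<in> P; x \<in> \<omega>; x \<in> \<omega>'\<rbrakk> \<Longrightarrow> \<omega> = \<omega>'"
  using disjoint_P by (auto simp: disjoint_def)

lemma J_measurable [measurable]: "J \<in> borel_measurable N"
  and J_pos: "x \<in> space N \<Longrightarrow> 0 < J x"
  using jacobian by (auto simp: jacobian_def)

lemma funpow_measurable [measurable]: "F ^^ n \<in> N \<rightarrow>\<^sub>M N"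
  by (rule measurable_compose_n) measurable

lemma funpow_space: "x \<in> space N \<Longrightarrow> (F ^^ n) x \<in> space N"
  using funpow_measurable[of n] by (rule measurable_space)

lemma Union_P_sets [measurable]: "\<Union>P \<in> sets N"
  using countable_P P_sets by (intro sets.countable_Union)

text \<open>The Jacobian condition is a statement about sets; read as an equality of two measures on the image it
  gives the substitution rule for functions.\<close>

lemma change_of_variables:
  assumes [measurable]: "g \<in> borel_measurable N" and w: "\<omega> \<in> P"
  shows "(\<integral>\<^sup>+x. indicator \<omega> x * g (F x) * ennreal (J x) \<partial>N) = (\<integral>\<^sup>+x. indicator (F ` \<omega>) x * g x \<partial>N)"
proof -
  have [measurable]: "\<omega> \<in> sets N" "F ` \<omega> \<in> sets N"
    using w image_sets by auto
  have "distr (density N (\<lambda>x. ennreal (J x) * indicator \<omega> x)) N F = density N (indicator (F ` \<omega>))"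
  proof (rule measure_eqI)
    fix B assume "B \<in> sets (distr (density N (\<lambda>x. ennreal (J x) * indicator \<omega> x)) N F)"
    then have [measurable]: "B \<in> sets N" by simp
    define A where "A = \<omega> \<inter> (F -` B \<inter> space N)"
    have [measurable]: "A \<in> sets N" by (simp add: A_def)
    have "emeasure (distr (density N (\<lambda>x. ennreal (J x) * indicator \<omega> x)) N F) B
        = (\<integral>\<^sup>+x. (ennreal (J x) * indicator \<omega> x) * indicator (F -` B \<inter> space N) x \<partial>N)"
      by (simp add: emeasure_distr emeasure_density)
    also have "\<dots> = (\<integral>\<^sup>+x\<in>A. ennreal (J x) \<partial>N)"
      by (intro nn_integral_cong) (auto simp: A_def indicator_def)
    also have "\<dots> = emeasure N (F ` A)"
      using jacobian w unfolding jacobian_def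
      by (metis A_def \<open>A \<in> sets N\<close> inf_le1)
    also have "F ` A = F ` \<omega> \<inter> B"
      using P_sub_space[OF w] by (auto simp: A_def)
    also have "emeasure N (F ` \<omega> \<inter> B) = emeasure (density N (indicator (F ` \<omega>))) B"
      by (subst emeasure_density) (auto simp flip: indicator_inter_arith)
    finally show "emeasure (distr (density N (\<lambda>x. ennreal (J x) * indicator \<omega> x)) N F) B
        = emeasure (density N (indicator (F ` \<omega>))) B" .
  qed simp
  then have "(\<integral>\<^sup>+x. g x \<partial>(distr (density N (\<lambda>x. ennreal (J x) * indicator \<omega> x)) N F))
      = (\<integral>\<^sup>+x. g x \<partial>(density N (indicator (F ` \<omega>))))" by simp
  then show ?thesis
    by (simp add: nn_integral_distr nn_integral_density mult_ac)
qed

lemma nonsingular: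
  assumes Z: "Z \<in> null_sets N"
  shows "AE x in N. F x \<notin> Z"
proof -
  have [measurable]: "Z \<in> sets N" using Z by auto
  have "AE x in N. x \<in> \<omega> \<longrightarrow> F x \<notin> Z" if w: "\<omega> \<in> P" for \<omega>
  proof -
    note P_setsD[OF w, measurable]
    have "(\<integral>\<^sup>+x. indicator \<omega> x * indicator Z (F x) * ennreal (J x) \<partial>N)
      = (\<integral>\<^sup>+x. indicator (F ` \<omega>) x * indicator Z x \<partial>N)"
      using w by (intro change_of_variables) auto
    also have "\<dots> \<le> (\<integral>\<^sup>+x. indicator Z x \<partial>N)"
      by (intro nn_integral_mono) (auto simp: indicator_def)
    also have "\<dots> = 0" using Z by (auto simp: null_sets_def)
    finally have "AE x in N. indicator \<omega> x * indicator Z (F x) * ennreal (J x) = 0"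
      by (subst nn_integral_0_iff_AE[symmetric]) auto
    then show ?thesis
      by eventually_elim (use J_pos P_sub_space[OF w] in \<open>fastforce simp: indicator_def split: if_splits\<close>)
  qed
  then have "AE x in N. \<forall>\<omega>\<in>P. x \<in> \<omega> \<longrightarrow> F x \<notin> Z"
    by (subst AE_ball_countable[OF countable_P]) blast
  moreover have "AE x in N. x \<in> \<Union>P"
    using AE_not_in[OF null_P] AE_space[of N] by eventually_elim auto
  ultimately show ?thesis by eventually_elim auto
qed

lemma AE_compose_F:
  assumes "AE x in N. Q x"
  shows "AE x in N. Q (F x)"
proof -
  from assms obtain Z where "Z \<in> null_sets N" "{x\<in>space N. \<not> Q x} \<subseteq> Z"
    by (auto simp: eventually_ae_filter)
  with nonsingular[of Z] show ?thesis
    using AE_space[of N] measurable_space[OF F_measurable]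
    by (force elim: eventually_mono)
qed

lemma AE_compose_funpow:
  assumes "AE x in N. Q x"
  shows "AE x in N. Q ((F ^^ n) x)"
proof (induction n)
  case 0 then show ?case using assms by simp
next
  case (Suc n)
  show ?case using AE_compose_F[OF Suc] by (simp add: funpow_swap1)
qed

text \<open>The points whose whole orbit has an itinerary in \<open>P\<close>; the partition covers the space only up to null
  sets.\<close>

definition good :: "'a \<Rightarrow> bool" where
  "good x \<longleftrightarrow> (\<forall>i. (F ^^ i) x \<in> \<Union>P)"

lemma AE_good: "AE x in N. good x"
proof -
  have "AE x in N. x \<in> \<Union>P"
    using AE_not_in[OF null_P] AE_space[of N] by eventually_elim auto
  then show ?thesis
    unfolding good_def by (intro AE_all_countable[THEN iffD2] allI AE_compose_funpow)
qed

lemma good_funpow: "good x \<Longrightarrow> good ((F ^^ n) x)"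
  unfolding good_def by (metis comp_apply funpow_add)

definition cyl :: "'a set list \<Rightarrow> 'a set" where
  "cyl ws = {x\<in>space N. \<forall>i<length ws. (F ^^ i) x \<in> ws ! i}"

definition words :: "nat \<Rightarrow> 'a set list set" where
  "words n = {ws\<in>lists P. length ws = n}"

lemma countable_words: "countable (words n)"
  unfolding words_def using countable_lists[OF countable_P] by (rule countable_subset[rotated]) auto

lemma words_length: "ws \<in> words n \<Longrightarrow> length ws = n"
  and words_nth: "ws \<in> words n \<Longrightarrow> i < n \<Longrightarrow> ws ! i \<in> P"
  by (auto simp: words_def in_lists_conv_set)

lemma words_0: "words 0 = {[]}"
  by (auto simp: words_def)

lemma words_SucE:
  assumes "ws \<in> words (Suc n)" obtains \<omega> us where "ws = \<omega> # us" "\<omega> \<in> P" "us \<in> words n"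
  using assms by (cases ws) (auto simp: words_def)

lemma cyl_sets [measurable]: "ws \<in> words n \<Longrightarrow> cyl ws \<in> sets N"
proof -
  assume ws: "ws \<in> words n"
  have "{x\<in>space N. (F ^^ i) x \<in> ws ! i} \<in> sets N" if "i < n" for i
    using words_nth[OF ws that] by measurable
  then have "{x\<in>space N. \<forall>i\<in>{..<n}. (F ^^ i) x \<in> ws ! i} \<in> sets N"
    by (intro sets.sets_Collect_finite_All finite_lessThan) blast
  moreover have "{x\<in>space N. \<forall>i\<in>{..<n}. (F ^^ i) x \<in> ws ! i} = cyl ws"
    unfolding cyl_def words_length[OF ws] by blast
  ultimately show ?thesis by metis
qed

lemma cyl_Nil [simp]: "cyl [] = space N"
  by (simp add: cyl_def)

lemma cyl_Cons:
  assumes "\<omega> \<in> P" shows "cyl (\<omega> # us) = {x\<in>\<omega>. F x \<in> cyl us}"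
proof -
  have *: "(\<forall>i<Suc n. Q i) \<longleftrightarrow> Q 0 \<and> (\<forall>i<n. Q (Suc i))" for Q :: "nat \<Rightarrow> bool" and n
    using less_Suc_eq_0_disj by auto
  show ?thesis
    using P_sub_space[OF assms] measurable_space[OF F_measurable]
    by (auto simp: cyl_def * funpow_swap1)
qed

lemma cyl_sub_space: "cyl ws \<subseteq> space N"
  by (auto simp: cyl_def)

lemma cyl_unique:
  assumes "ws \<in> words n" "vs \<in> words n" "x \<in> cyl ws" "x \<in> cyl vs"
  shows "ws = vs"
proof (rule nth_equalityI)
  show l: "length ws = length vs" using assms by (simp add: words_length)
  fix i assume i: "i < length ws"
  have n: "length ws = n" using assms(1) by (rule words_length)
  have "(F ^^ i) x \<in> ws ! i" "(F ^^ i) x \<in> vs ! i"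
    using assms(3,4) i l by (auto simp: cyl_def)
  then show "ws ! i = vs ! i"
    using words_nth[OF assms(1), of i] words_nth[OF assms(2), of i] i n by (intro P_unique) auto
qed

lemma good_in_cyl:
  assumes "good x" "x \<in> space N" obtains ws where "ws \<in> words n" "x \<in> cyl ws"
proof -
  have "\<forall>i. \<exists>w\<in>P. (F ^^ i) x \<in> w" using assms by (auto simp: good_def)
  then obtain w where w: "\<And>i. w i \<in> P" "\<And>i. (F ^^ i) x \<in> w i" by metis
  have "map w [0..<n] \<in> words n" using w by (auto simp: words_def)
  moreover have "x \<in> cyl (map w [0..<n])" using w assms by (auto simp: cyl_def)
  ultimately show ?thesis using that by blast
qed

lemma AE_in_cyl: "AE x in N. x \<in> \<Union>(cyl ` words n)"
  using AE_good AE_space[of N] by eventually_elim (auto elim: good_in_cyl[of _ n])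

definition Jn :: "nat \<Rightarrow> 'a \<Rightarrow> real" where
  "Jn n x = (\<Prod>i<n. J ((F ^^ i) x))"

lemma Jn_measurable [measurable]: "Jn n \<in> borel_measurable N"
  unfolding Jn_def by measurable

lemma Jn_Suc: "Jn (Suc n) x = J x * Jn n (F x)"
  unfolding Jn_def by (subst prod.lessThan_Suc_shift) (simp add: funpow_swap1)

lemma Jn_pos: "x \<in> space N \<Longrightarrow> 0 < Jn n x"
  unfolding Jn_def by (intro prod_pos) (auto intro: J_pos funpow_space)

text \<open>The image \<open>F ` \<omega>\<close> is a union of elements of \<open>P\<close> up to a null set, and the elements are disjoint: if
  it meets \<open>\<omega>'\<close> in a set of positive measure, it contains \<open>\<omega>'\<close>.\<close>

lemma markov_image:
  assumes w: "\<omega> \<in> P" "\<omega>' \<in> P" and pos: "F ` \<omega> \<inter> \<omega>' \<notin> null_sets N"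
  shows "AE x in N. x \<in> \<omega>' \<longrightarrow> x \<in> F ` \<omega>"
proof -
  note P_setsD[OF w(1), measurable] P_setsD[OF w(2), measurable] image_sets[OF w(1), measurable]
  from markov w obtain Q where Q: "Q \<subseteq> P" "sym_diff (F ` \<omega>) (\<Union>Q) \<in> null_sets N"
    by (auto simp: markov_def)
  have "\<omega>' \<in> Q"
  proof (rule ccontr)
    assume n: "\<omega>' \<notin> Q"
    have disj: "\<omega>' \<inter> \<Union>Q = {}"
    proof (rule Int_emptyI)
      fix x assume "x \<in> \<omega>'" "x \<in> \<Union>Q"
      then obtain q where q: "q \<in> Q" "x \<in> q" by auto
      have "q = \<omega>'" using Q(1) q w(2) \<open>x \<in> \<omega>'\<close> by (intro P_unique[of q \<omega>' x]) auto
      then show False using q n by simp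
    qed
    have "AE x in N. x \<notin> F ` \<omega> \<inter> \<omega>'"
      using AE_not_in[OF Q(2)] by eventually_elim (use disj in auto)
    then show False using pos by (subst (asm) AE_iff_null_sets[symmetric]) auto
  qed
  show ?thesis
    using AE_not_in[OF Q(2)] by eventually_elim (use \<open>\<omega>' \<in> Q\<close> in auto)
qed

lemma markov_step:
  assumes w: "\<omega> \<in> P" "\<omega>' \<in> P" and pos: "0 < emeasure N (\<omega> \<inter> {x\<in>space N. F x \<in> \<omega>'})"
  shows "AE x in N. x \<in> \<omega>' \<longrightarrow> x \<in> F ` \<omega>"
proof (rule markov_image[OF w])
  note P_setsD[OF w(1), measurable] P_setsD[OF w(2), measurable]
  show "F ` \<omega> \<inter> \<omega>' \<notin> null_sets N"
  proof
    assume "F ` \<omega> \<inter> \<omega>' \<in> null_sets N"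
    then have "AE x in N. F x \<notin> F ` \<omega> \<inter> \<omega>'" by (rule nonsingular)
    then have "AE x in N. x \<notin> \<omega> \<inter> {x\<in>space N. F x \<in> \<omega>'}" by eventually_elim auto
    then have "\<omega> \<inter> {x\<in>space N. F x \<in> \<omega>'} \<in> null_sets N"
      by (subst AE_iff_null_sets) auto
    with pos show False by (simp add: null_sets_def)
  qed
qed

text \<open>Up to a null set, a cylinder of positive measure is mapped onto the image of its last symbol: each transition
  \<open>\<omega>\<omega>'\<close> occurring in the word has positive measure, so the Markov property makes the image of \<open>\<omega>\<close>
  contain all of \<open>\<omega>'\<close> and nothing is lost when the first symbol is removed.\<close>

lemma change_of_variables_cyl:
  assumes "g \<in> borel_measurable N" "ws \<in> words (Suc n)" "0 < emeasure N (cyl ws)"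
  shows "(\<integral>\<^sup>+x. indicator (cyl ws) x * g ((F ^^ Suc n) x) * ennreal (Jn (Suc n) x) \<partial>N)
       = (\<integral>\<^sup>+x. indicator (F ` last ws) x * g x \<partial>N)"
  using assms
proof (induction n arbitrary: ws)
  case 0
  then obtain \<omega> where w: "ws = [\<omega>]" "\<omega> \<in> P" by (auto elim!: words_SucE simp: words_0)
  have "cyl ws = \<omega>" using P_sub_space[OF w(2)] by (auto simp: w cyl_def)
  with 0 w change_of_variables[of g \<omega>] show ?case by (simp add: Jn_def)
next
  case (Suc n)
  note Suc.prems(1)[measurable]
  from Suc.prems(2) obtain \<omega> us where w: "ws = \<omega> # us" "\<omega> \<in> P" "us \<in> words (Suc n)"
    by (elim words_SucE[of ws]) auto
  then obtain \<omega>' vs where w': "us = \<omega>' # vs" "\<omega>' \<in> P" "vs \<in> words n"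
    by (elim words_SucE[of us]) auto
  note P_setsD[OF w(2), measurable] P_setsD[OF w'(2), measurable] image_sets[OF w(2), measurable]
    cyl_sets[OF w(3), measurable] cyl_sets[OF Suc.prems(2), measurable]
  have cylws: "cyl ws = {x\<in>\<omega>. F x \<in> cyl us}" by (simp add: w cyl_Cons)
  have usub: "cyl us \<subseteq> \<omega>'" by (auto simp: w' cyl_Cons)
  have "emeasure N (cyl ws) \<le> emeasure N (\<omega> \<inter> {x\<in>space N. F x \<in> \<omega>'})"
    using cylws usub cyl_sub_space by (intro emeasure_mono) auto
  with Suc.prems(3) have step: "AE x in N. x \<in> \<omega>' \<longrightarrow> x \<in> F ` \<omega>"
    by (intro markov_step[OF w(2) w'(2)]) auto
  have us_pos: "0 < emeasure N (cyl us)"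
  proof (rule ccontr)
    assume "\<not> ?thesis"
    then have "cyl us \<in> null_sets N" using cyl_sets[OF w(3)] by (auto simp: null_sets_def)
    then have "AE x in N. x \<notin> cyl ws" using nonsingular cylws by (force elim: eventually_mono)
    then have "emeasure N (cyl ws) = 0"
      using emeasure_eq_0_AE[of "\<lambda>x. x \<in> cyl ws" N] cyl_sub_space[of ws]
      by (simp add: Collect_mem_eq Collect_conj_eq Int_absorb1)
    with Suc.prems(3) show False by simp
  qed
  have "(\<integral>\<^sup>+x. indicator (cyl ws) x * g ((F ^^ Suc (Suc n)) x) * ennreal (Jn (Suc (Suc n)) x) \<partial>N)
     = (\<integral>\<^sup>+x. indicator \<omega> x * (indicator (cyl us) (F x) * g ((F ^^ Suc n) (F x)) * ennreal (Jn (Suc n) (F x))) * ennreal (J x) \<partial>N)"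
  proof (intro nn_integral_cong)
    fix x assume x: "x \<in> space N"
    have "ennreal (Jn (Suc (Suc n)) x) = ennreal (Jn (Suc n) (F x)) * ennreal (J x)"
      using x by (subst Jn_Suc) (simp add: ennreal_mult' J_pos less_imp_le mult.commute)
    then show "indicator (cyl ws) x * g ((F ^^ Suc (Suc n)) x) * ennreal (Jn (Suc (Suc n)) x) =
      indicator \<omega> x * (indicator (cyl us) (F x) * g ((F ^^ Suc n) (F x)) * ennreal (Jn (Suc n) (F x))) * ennreal (J x)"
      unfolding cylws by (auto simp: indicator_def mult_ac funpow_swap1 split: if_splits)
  qed
  also have "\<dots> = (\<integral>\<^sup>+x. indicator (F ` \<omega>) x * (indicator (cyl us) x * g ((F ^^ Suc n) x) * ennreal (Jn (Suc n) x)) \<partial>N)"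
    using w(2) by (intro change_of_variables) measurable
  also have "\<dots> = (\<integral>\<^sup>+x. indicator (cyl us) x * g ((F ^^ Suc n) x) * ennreal (Jn (Suc n) x) \<partial>N)"
    using step usub by (intro nn_integral_cong_AE) (auto elim!: eventually_mono simp: indicator_def)
  also have "\<dots> = (\<integral>\<^sup>+x. indicator (F ` last us) x * g x \<partial>N)"
    by (rule Suc.IH[OF Suc.prems(1) w(3) us_pos])
  finally show ?case using w w' by simp
qed

lemma separation_time_ge:
  assumes "\<forall>i<n. \<exists>\<omega>\<in>P. (F ^^ i) x \<in> \<omega> \<and> (F ^^ i) y \<in> \<omega>"
  shows "enat n \<le> separation_time F P x y"
  unfolding separation_time_def
proof (rule INF_greatest)
  fix k assume "k \<in> {n. \<not> (\<exists>\<omega>\<in>P. (F ^^ n) x \<in> \<omega> \<and> (F ^^ n) y \<in> \<omega>)}"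
  then have "\<not> k < n" using assms by auto
  then show "enat n \<le> enat k" by simp
qed

lemma epow_le: "0 < b \<Longrightarrow> b < 1 \<Longrightarrow> enat n \<le> s \<Longrightarrow> epow b s \<le> b ^ n"
  by (cases s) (auto simp: epow_def intro: power_decreasing)

lemma distortion_step:
  assumes ws: "ws \<in> words n" "x \<in> cyl ws" "y \<in> cyl ws" and i: "i < n"
  shows "J ((F ^^ i) x) \<le> exp (C * \<beta> ^ (n - Suc i)) * J ((F ^^ i) y)"
proof -
  let ?x = "(F ^^ i) x" and ?y = "(F ^^ i) y"
  have n: "length ws = n" using ws(1) by (rule words_length)
  have common: "\<forall>j<n - Suc i. \<exists>\<omega>\<in>P. (F ^^ j) (F ?x) \<in> \<omega> \<and> (F ^^ j) (F ?y) \<in> \<omega>"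
  proof (intro allI impI)
    fix j assume j: "j < n - Suc i"
    have *: "(F ^^ j) (F ((F ^^ i) z)) = (F ^^ (Suc i + j)) z" for z
      by (metis add.commute comp_apply funpow.simps(2) funpow_add)
    show "\<exists>\<omega>\<in>P. (F ^^ j) (F ?x) \<in> \<omega> \<and> (F ^^ j) (F ?y) \<in> \<omega>"
      using ws(2,3) j n words_nth[OF ws(1), of "Suc i + j"] unfolding * cyl_def
      by (intro bexI[of _ "ws ! (Suc i + j)"]) (auto simp del: funpow.simps)
  qed
  have pos: "0 < J ?x" "0 < J ?y"
    using ws cyl_sub_space by (auto intro!: J_pos funpow_space)
  have "ln (J ?x / J ?y) \<le> C * epow \<beta> (separation_time F P (F ?x) (F ?y))"
    using ws i n words_nth[OF ws(1) i] by (intro gibbs[of "ws ! i"]) (auto simp: cyl_def)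
  also have "\<dots> \<le> C * \<beta> ^ (n - Suc i)"
    using C_pos beta_pos beta_less_1
    by (intro mult_left_mono epow_le separation_time_ge[OF common]) auto
  finally have "J ?x / J ?y \<le> exp (C * \<beta> ^ (n - Suc i))"
    using pos by (metis divide_pos_pos exp_le_cancel_iff exp_ln)
  then show ?thesis using pos by (simp add: divide_le_eq)
qed

definition Kd :: real where "Kd = exp (C / (1 - \<beta>))"

lemma Kd_pos: "0 < Kd" by (simp add: Kd_def)

text \<open>In a cylinder of length \<open>n\<close> the separation time at step \<open>i\<close> is at least \<open>n - i - 1\<close> after one
  application of \<open>F\<close>, so the exponents from the Gibbs condition form a geometric series, whatever \<open>n\<close>
  is.\<close>

lemma distortion:
  assumes ws: "ws \<in> words n" "x \<in> cyl ws" "y \<in> cyl ws"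
  shows "Jn n x \<le> Kd * Jn n y"
proof -
  have xy: "x \<in> space N" "y \<in> space N" using ws cyl_sub_space by auto
  have "Jn n x \<le> (\<Prod>i<n. exp (C * \<beta> ^ (n - Suc i)) * J ((F ^^ i) y))"
    unfolding Jn_def using xy
    by (intro prod_mono conjI distortion_step[OF ws] less_imp_le[OF J_pos] funpow_space) auto
  also have "\<dots> = exp (\<Sum>i<n. C * \<beta> ^ (n - Suc i)) * Jn n y"
    by (simp add: prod.distrib Jn_def exp_sum)
  also have "(\<Sum>i<n. C * \<beta> ^ (n - Suc i)) = (\<Sum>i<n. C * \<beta> ^ i)"
    by (rule sum.nat_diff_reindex)
  also have "\<dots> \<le> C / (1 - \<beta>)"
  proof -
    have "(\<Sum>i<n. C * \<beta> ^ i) = C * ((1 - \<beta> ^ n) / (1 - \<beta>))"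
      using beta_less_1 by (simp add: sum_distrib_left[symmetric] sum_gp_strict)
    also have "\<dots> \<le> C * (1 / (1 - \<beta>))"
      using C_pos beta_pos beta_less_1 by (intro mult_left_mono divide_right_mono) auto
    finally show ?thesis by simp
  qed
  finally show ?thesis
    using Jn_pos[OF xy(2), of n] by (simp add: Kd_def)
qed

text \<open>The first summand serves cylinders of positive length, the second the empty word.\<close>

definition K :: real where
  "K = Kd / \<delta> + 1 / measure N (space N)"

lemma K_pos: "0 < K"
  using delta_pos space_pos Kd_pos by (simp add: K_def add_pos_pos)

text \<open>The measure of the image of the cylinder is the integral of the Jacobian and at least \<open>\<delta>\<close>. By
  bounded distortion the Jacobian is therefore at least \<open>\<delta> / (Kd N(cyl ws))\<close> at every point of the
  cylinder, and changing variables bounds the density of the image law.\<close>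

lemma quasi_independence_cyl:
  assumes [measurable]: "g \<in> borel_measurable N" and ws: "ws \<in> words n"
  shows "(\<integral>\<^sup>+x. indicator (cyl ws) x * g ((F ^^ n) x) \<partial>N)
    \<le> ennreal K * emeasure N (cyl ws) * (\<integral>\<^sup>+x. g x \<partial>N)"
proof (cases "emeasure N (cyl ws) = 0")
  case True
  then have "AE x in N. x \<notin> cyl ws"
    using cyl_sets[OF ws] by (intro AE_not_in) auto
  then have "(\<integral>\<^sup>+x. indicator (cyl ws) x * g ((F ^^ n) x) \<partial>N) = (\<integral>\<^sup>+x. 0 \<partial>N)"
    by (intro nn_integral_cong_AE) (auto elim: eventually_mono)
  then show ?thesis by simp
next
  case False
  note cyl_sets[OF ws, measurable]
  show ?thesis
  proof (cases n)
    case 0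
    then have ws0: "ws = []" using ws by (simp add: words_0)
    have "1 \<le> K * measure N (space N)"
      using space_pos delta_pos Kd_pos by (simp add: K_def distrib_right)
    then have "1 \<le> ennreal K * emeasure N (space N)"
      using K_pos by (simp add: emeasure_eq_measure ennreal_mult[symmetric])
    then have "1 * (\<integral>\<^sup>+x. g x \<partial>N) \<le> ennreal K * emeasure N (space N) * (\<integral>\<^sup>+x. g x \<partial>N)"
      by (intro mult_right_mono) auto
    moreover have "(\<integral>\<^sup>+x. indicator (cyl ws) x * g ((F ^^ n) x) \<partial>N) = (\<integral>\<^sup>+x. g x \<partial>N)"
      using 0 by (intro nn_integral_cong) (simp add: ws0)
    ultimately show ?thesis by (simp add: ws0)
  next
    case (Suc k)
    have lst: "last ws \<in> P"
      using ws Suc last_in_set[of ws] by (fastforce simp: words_def)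
    note image_sets[OF lst, measurable]
    define c where "c = measure N (cyl ws) * Kd / \<delta>"
    have key: "1 \<le> Jn n x * c" if x: "x \<in> cyl ws" for x
    proof -
      have J0: "0 < Jn n x" using x cyl_sub_space by (auto intro: Jn_pos)
      have "ennreal \<delta> \<le> emeasure N (F ` last ws)"
        using long_branches[OF lst] by (simp add: emeasure_eq_measure)
      also have "\<dots> = (\<integral>\<^sup>+x. indicator (cyl ws) x * ennreal (Jn n x) \<partial>N)"
        using change_of_variables_cyl[of "\<lambda>_. 1" ws k] ws False Suc by (simp add: zero_less_iff_neq_zero)
      also have "\<dots> \<le> (\<integral>\<^sup>+y. ennreal (Kd * Jn n x) * indicator (cyl ws) y \<partial>N)"
        using distortion[OF ws _ x] by (intro nn_integral_mono) (auto simp: indicator_def intro: ennreal_leI)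
      also have "\<dots> = ennreal (Kd * Jn n x * measure N (cyl ws))"
        using J0 Kd_pos by (simp add: nn_integral_cmult_indicator emeasure_eq_measure ennreal_mult)
      finally have "\<delta> \<le> Kd * Jn n x * measure N (cyl ws)"
        using J0 Kd_pos by (subst (asm) ennreal_le_iff) auto
      then show ?thesis using delta_pos by (simp add: c_def field_simps)
    qed
    have c0: "0 \<le> c" using delta_pos Kd_pos by (simp add: c_def)
    have "(\<integral>\<^sup>+x. indicator (cyl ws) x * g ((F ^^ n) x) \<partial>N)
       \<le> (\<integral>\<^sup>+x. ennreal c * (indicator (cyl ws) x * g ((F ^^ n) x) * ennreal (Jn n x)) \<partial>N)"
    proof (intro nn_integral_mono)
      fix x assume x: "x \<in> space N"
      show "indicator (cyl ws) x * g ((F ^^ n) x) \<le> ennreal c * (indicator (cyl ws) x * g ((F ^^ n) x) * ennreal (Jn n x))"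
      proof (cases "x \<in> cyl ws")
        case True
        have "1 \<le> ennreal c * ennreal (Jn n x)"
          using key[OF True] c0 Jn_pos[OF x, of n] by (simp add: ennreal_mult[symmetric] mult.commute)
        then have "1 * g ((F ^^ n) x) \<le> (ennreal c * ennreal (Jn n x)) * g ((F ^^ n) x)"
          by (intro mult_right_mono) auto
        then show ?thesis using True by (simp add: mult_ac)
      qed simp
    qed
    also have "\<dots> = ennreal c * (\<integral>\<^sup>+x. indicator (F ` last ws) x * g x \<partial>N)"
      using change_of_variables_cyl[of g ws k] ws False Suc
      by (simp add: nn_integral_cmult zero_less_iff_neq_zero)
    also have "\<dots> \<le> ennreal c * (\<integral>\<^sup>+x. g x \<partial>N)"
      by (intro mult_left_mono nn_integral_mono) (auto simp: indicator_def)
    also have "\<dots> \<le> ennreal K * emeasure N (cyl ws) * (\<integral>\<^sup>+x. g x \<partial>N)"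
    proof (intro mult_right_mono)
      have "c \<le> K * measure N (cyl ws)"
        using space_pos by (simp add: c_def K_def algebra_simps)
      then show "ennreal c \<le> ennreal K * emeasure N (cyl ws)"
        using K_pos by (simp add: emeasure_eq_measure ennreal_mult[symmetric] ennreal_leI)
    qed simp
    finally show ?thesis .
  qed
qed

lemma disjoint_cyl: "disjoint_family_on cyl (words n)"
  unfolding disjoint_family_on_def using cyl_unique by blast

lemma nn_integral_cyl_decomp:
  assumes [measurable]: "h \<in> borel_measurable N"
  shows "(\<integral>\<^sup>+x. h x \<partial>N) = (\<integral>\<^sup>+ws. (\<integral>\<^sup>+x. indicator (cyl ws) x * h x \<partial>N) \<partial>count_space (words n))"
proof -
  have U: "\<Union>(cyl ` words n) \<in> sets N"
    using countable_words by (intro sets.countable_UN') (auto intro: cyl_sets)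
  have "(\<integral>\<^sup>+x. h x \<partial>N) = (\<integral>\<^sup>+x. h x * indicator (\<Union>(cyl ` words n)) x \<partial>N)"
    using AE_in_cyl[of n] by (intro nn_integral_cong_AE) (auto elim!: eventually_mono simp: indicator_def)
  also have "\<dots> = emeasure (density N h) (\<Union>(cyl ` words n))"
    using U by (simp add: emeasure_density)
  also have "\<dots> = (\<integral>\<^sup>+ws. emeasure (density N h) (cyl ws) \<partial>count_space (words n))"
    by (intro emeasure_UN_countable countable_words disjoint_cyl) (auto intro: cyl_sets)
  also have "\<dots> = (\<integral>\<^sup>+ws. (\<integral>\<^sup>+x. indicator (cyl ws) x * h x \<partial>N) \<partial>count_space (words n))"
    by (intro nn_integral_cong) (auto simp: emeasure_density cyl_sets mult.commute)
  finally show ?thesis .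
qed

text \<open>Nothing is required outside the union of the cylinders, which is a null set.\<close>

definition cylfun :: "nat \<Rightarrow> ('a \<Rightarrow> 'b) \<Rightarrow> bool" where
  "cylfun n W \<longleftrightarrow> (\<forall>ws\<in>words n. \<forall>x\<in>cyl ws. \<forall>y\<in>cyl ws. W x = W y)"

text \<open>The estimate on which everything rests: a function of the first \<open>n\<close> symbols is independent of the
  position at time \<open>n\<close> up to the factor \<open>K\<close>. It follows from the case of a single cylinder by summation
  over all words.\<close>

lemma quasi_independence:
  fixes W g :: "'a \<Rightarrow> ennreal"
  assumes [measurable]: "g \<in> borel_measurable N" "W \<in> borel_measurable N" and W: "cylfun n W"
  shows "(\<integral>\<^sup>+x. W x * g ((F ^^ n) x) \<partial>N) \<le> ennreal K * (\<integral>\<^sup>+x. W x \<partial>N) * (\<integral>\<^sup>+x. g x \<partial>N)"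
proof -
  have "(\<integral>\<^sup>+x. W x * g ((F ^^ n) x) \<partial>N)
     = (\<integral>\<^sup>+ws. (\<integral>\<^sup>+x. indicator (cyl ws) x * (W x * g ((F ^^ n) x)) \<partial>N) \<partial>count_space (words n))"
    by (intro nn_integral_cyl_decomp) measurable
  also have "\<dots> \<le> (\<integral>\<^sup>+ws. (ennreal K * (\<integral>\<^sup>+x. g x \<partial>N)) * (\<integral>\<^sup>+x. indicator (cyl ws) x * W x \<partial>N) \<partial>count_space (words n))"
  proof (intro nn_integral_mono)
    fix ws assume "ws \<in> space (count_space (words n))"
    then have ws: "ws \<in> words n" by simp
    note cyl_sets[OF ws, measurable]
    show "(\<integral>\<^sup>+x. indicator (cyl ws) x * (W x * g ((F ^^ n) x)) \<partial>N)
        \<le> (ennreal K * (\<integral>\<^sup>+x. g x \<partial>N)) * (\<integral>\<^sup>+x. indicator (cyl ws) x * W x \<partial>N)"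
    proof (cases "cyl ws = {}")
      case False
      then obtain z where z: "z \<in> cyl ws" by auto
      have Wz: "W x = W z" if "x \<in> cyl ws" for x using W ws z that unfolding cylfun_def by blast
      have "(\<integral>\<^sup>+x. indicator (cyl ws) x * (W x * g ((F ^^ n) x)) \<partial>N)
          = (\<integral>\<^sup>+x. W z * (indicator (cyl ws) x * g ((F ^^ n) x)) \<partial>N)"
        by (intro nn_integral_cong) (auto simp: indicator_def Wz split: if_splits)
      also have "\<dots> = W z * (\<integral>\<^sup>+x. indicator (cyl ws) x * g ((F ^^ n) x) \<partial>N)"
        by (intro nn_integral_cmult) measurable
      also have "\<dots> \<le> W z * (ennreal K * emeasure N (cyl ws) * (\<integral>\<^sup>+x. g x \<partial>N))"
        by (intro mult_left_mono quasi_independence_cyl ws) auto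
      also have "\<dots> = (ennreal K * (\<integral>\<^sup>+x. g x \<partial>N)) * (\<integral>\<^sup>+x. W z * indicator (cyl ws) x \<partial>N)"
        by (simp add: nn_integral_cmult_indicator mult_ac)
      also have "(\<integral>\<^sup>+x. W z * indicator (cyl ws) x \<partial>N) = (\<integral>\<^sup>+x. indicator (cyl ws) x * W x \<partial>N)"
        by (intro nn_integral_cong) (auto simp: indicator_def Wz split: if_splits)
      finally show ?thesis .
    qed simp
  qed
  also have "\<dots> = (ennreal K * (\<integral>\<^sup>+x. g x \<partial>N)) * (\<integral>\<^sup>+x. W x \<partial>N)"
    unfolding nn_integral_cyl_decomp[OF assms(2), of n] by (rule nn_integral_cmult) simp
  finally show ?thesis by (simp only: mult_ac)
qed

end

section \<open>Ergodicity of the induced map\<close>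

context gibbs_markov begin

lemma cyl_take:
  assumes ws: "ws \<in> words n'" "x \<in> cyl ws" and le: "n \<le> n'"
  shows "take n ws \<in> words n \<and> x \<in> cyl (take n ws)"
proof -
  have l: "length ws = n'" using ws(1) by (rule words_length)
  have "set ws \<subseteq> P" using ws(1) by (auto simp: words_def)
  then have "set (take n ws) \<subseteq> P" using set_take_subset[of n ws] by blast
  then have "take n ws \<in> words n" using l le by (auto simp: words_def)
  moreover have "x \<in> cyl (take n ws)"
    using ws(2) l le unfolding cyl_def by auto
  ultimately show ?thesis by simp
qed

lemma cylfun_mono:
  assumes W: "cylfun n W" and le: "n \<le> n'" shows "cylfun n' W"
  unfolding cylfun_def
proof (intro ballI)
  fix ws x y assume a: "ws \<in> words n'" "x \<in> cyl ws" "y \<in> cyl ws"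
  then show "W x = W y"
    using cyl_take[OF a(1,2) le] cyl_take[OF a(1,3) le] W unfolding cylfun_def by blast
qed

text \<open>The measurable sets that finitely many symbols determine up to small measure form a
  \<open>\<sigma>\<close>-algebra containing the cylinders, so separability makes every measurable set approximable.\<close>

definition approximable :: "'a set \<Rightarrow> bool" where
  "approximable A \<longleftrightarrow> A \<in> sets N \<and>
     (\<forall>e>0. \<exists>n B. B \<in> sets N \<and> cylfun n (\<lambda>x. x \<in> B) \<and> measure N (sym_diff A B) < e)"

lemma approximableD:
  assumes "approximable A" "0 < e"
  obtains n B where "B \<in> sets N" "cylfun n (\<lambda>x. x \<in> B)" "measure N (sym_diff A B) < e"
  using assms unfolding approximable_def by blast

lemma approximable_iter_join:
  assumes "A \<in> iter_join N F P {..<n}" shows "approximable A"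
proof -
  from assms obtain w where w: "\<And>i. i < n \<Longrightarrow> w i \<in> P" and A: "A = {x\<in>space N. \<forall>i\<in>{..<n}. (F ^^ i) x \<in> w i}"
    unfolding iter_join_def by blast
  have "{x\<in>space N. (F ^^ i) x \<in> w i} \<in> sets N" if "i < n" for i
    using w[OF that] by measurable
  then have AN: "A \<in> sets N"
    unfolding A by (intro sets.sets_Collect_finite_All finite_lessThan) blast
  have imp: "y \<in> A" if a: "ws \<in> words n" "x \<in> cyl ws" "y \<in> cyl ws" and x: "x \<in> A" for ws x y
  proof -
    have l: "length ws = n" using a(1) by (rule words_length)
    have "(F ^^ i) y \<in> w i" if i: "i < n" for i
    proof -
      have "w i = ws ! i"
        using x a(2) i l unfolding A cyl_def
        by (intro P_unique[OF w[OF i] words_nth[OF a(1) i], of "(F ^^ i) x"]) auto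
      then show ?thesis using a(3) i l by (auto simp: cyl_def)
    qed
    then show ?thesis using a(3) cyl_sub_space unfolding A by blast
  qed
  have "cylfun n (\<lambda>x. x \<in> A)"
    unfolding cylfun_def using imp by blast
  then show ?thesis
    unfolding approximable_def using AN by (auto intro!: exI[of _ n] exI[of _ A])
qed

lemma approximable_compl:
  assumes "approximable A" shows "approximable (space N - A)"
  unfolding approximable_def
proof (intro conjI allI impI)
  have A: "A \<in> sets N" using assms by (simp add: approximable_def)
  then show "space N - A \<in> sets N" by auto
  fix e :: real assume "0 < e"
  from approximableD[OF assms this] obtain n B where
    B: "B \<in> sets N" "cylfun n (\<lambda>x. x \<in> B)" "measure N (sym_diff A B) < e" by blast
  have "sym_diff (space N - A) (space N - B) = sym_diff A B"
    using A B sets.sets_into_space by blast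
  moreover have "cylfun n (\<lambda>x. x \<in> space N - B)"
    using B(2) cyl_sub_space unfolding cylfun_def by blast
  ultimately show "\<exists>n B. B \<in> sets N \<and> cylfun n (\<lambda>x. x \<in> B) \<and> measure N (sym_diff (space N - A) B) < e"
    using B by (intro exI[of _ n] exI[of _ "space N - B"]) auto
qed

lemma approximable_UN:
  fixes A :: "nat \<Rightarrow> 'a set"
  assumes ap: "\<And>i. approximable (A i)" shows "approximable (\<Union>i. A i)"
  unfolding approximable_def
proof (intro conjI allI impI)
  have A[measurable]: "A i \<in> sets N" for i using ap by (simp add: approximable_def)
  then show "(\<Union>i. A i) \<in> sets N" by auto
  fix e :: real assume e: "0 < e"
  have "\<forall>i. \<exists>n B. B \<in> sets N \<and> cylfun n (\<lambda>x. x \<in> B) \<and> measure N (sym_diff (A i) B) < e / 2 * (1/2) ^ Suc i"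
  proof
    fix i
    have "0 < e / 2 * (1/2) ^ Suc i" using e by simp
    then show "\<exists>n B. B \<in> sets N \<and> cylfun n (\<lambda>x. x \<in> B) \<and> measure N (sym_diff (A i) B) < e / 2 * (1/2) ^ Suc i"
      using ap[of i] unfolding approximable_def by blast
  qed
  then obtain n B where B[measurable]: "\<And>i. B i \<in> sets N" and cB: "\<And>i. cylfun (n i) (\<lambda>x. x \<in> B i)"
    and mB: "\<And>i. measure N (sym_diff (A i) (B i)) < e / 2 * (1/2) ^ Suc i"
    by metis
  have "(\<lambda>m. measure N (\<Union>i<m. A i)) \<longlonglongrightarrow> measure N (\<Union>m. \<Union>i<m. A i)"
    by (intro finite_Lim_measure_incseq) (auto simp: incseq_def intro: order_less_le_trans)
  moreover have "(\<Union>m. \<Union>i<m. A i) = (\<Union>i. A i)" by auto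
  ultimately have "(\<lambda>m. measure N (\<Union>i<m. A i)) \<longlonglongrightarrow> measure N (\<Union>i. A i)" by simp
  then have "\<forall>\<^sub>F m in sequentially. measure N (\<Union>i. A i) - e / 2 < measure N (\<Union>i<m. A i)"
    using e by (intro order_tendstoD) auto
  then obtain m where m: "measure N (\<Union>i. A i) - e / 2 < measure N (\<Union>i<m. A i)"
    by (auto simp: eventually_sequentially)
  \<comment> \<open>Cutting the union off at \<open>m\<close> costs \<open>e / 2\<close>; the errors of the finitely many approximations sum up to
    less than the other half.\<close>
  define BB where "BB = (\<Union>i<m. B i)"
  have [measurable]: "BB \<in> sets N" unfolding BB_def by auto
  define n' where "n' = (\<Sum>i<m. n i)"
  have le: "n i \<le> n'" if "i < m" for i
    unfolding n'_def using that by (intro member_le_sum) auto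
  have cyl: "cylfun n' (\<lambda>x. x \<in> BB)"
    unfolding cylfun_def
  proof (intro ballI)
    fix ws x y assume a: "ws \<in> words n'" "x \<in> cyl ws" "y \<in> cyl ws"
    have "x \<in> B i \<longleftrightarrow> y \<in> B i" if "i < m" for i
      using cylfun_mono[OF cB le[OF that]] a unfolding cylfun_def by blast
    then show "(x \<in> BB) = (y \<in> BB)" unfolding BB_def by blast
  qed
  have "measure N (sym_diff (\<Union>i. A i) BB) \<le> measure N (((\<Union>i. A i) - (\<Union>i<m. A i)) \<union> (\<Union>i<m. sym_diff (A i) (B i)))"
    by (intro finite_measure_mono) (auto simp: BB_def)
  also have "\<dots> \<le> measure N ((\<Union>i. A i) - (\<Union>i<m. A i)) + measure N (\<Union>i<m. sym_diff (A i) (B i))"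
    by (intro measure_Un_le) auto
  also have "measure N ((\<Union>i. A i) - (\<Union>i<m. A i)) = measure N (\<Union>i. A i) - measure N (\<Union>i<m. A i)"
    by (intro finite_measure_Diff) auto
  also have "measure N (\<Union>i<m. sym_diff (A i) (B i)) \<le> (\<Sum>i<m. measure N (sym_diff (A i) (B i)))"
    by (intro finite_measure_subadditive_finite) auto
  also have "\<dots> \<le> (\<Sum>i<m. e / 2 * (1/2) ^ Suc i)"
    by (intro sum_mono less_imp_le mB)
  also have "\<dots> = e / 2 * (1 - (1/2) ^ m)"
    by (induction m) (auto simp: algebra_simps)
  also have "\<dots> \<le> e / 2" using e by (simp add: algebra_simps)
  finally have "measure N (sym_diff (\<Union>i. A i) BB) < e" using m by linarith
  then show "\<exists>n B. B \<in> sets N \<and> cylfun n (\<lambda>x. x \<in> B) \<and> measure N (sym_diff (\<Union>i. A i) B) < e"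
    using cyl by (intro exI[of _ n'] exI[of _ BB]) auto
qed

lemma approximable_sets:
  assumes sep: "separability N F P" and A: "A \<in> sets N" shows "approximable A"
proof -
  from sep A obtain B where B: "B \<in> sigma_sets (space N) (\<Union>n. iter_join N F P {..<n})"
    and AB: "sym_diff A B \<in> null_sets N" by (auto simp: separability_def)
  have "approximable B"
    using B
  proof (induction rule: sigma_sets.induct)
    case (Basic a) then show ?case using approximable_iter_join by blast
  next
    case Empty
    show ?case unfolding approximable_def cylfun_def by (auto intro!: exI[of _ "{}"])
  next
    case (Compl a) show ?case by (rule approximable_compl) fact
  next
    case (Union a) then show ?case by (intro approximable_UN)
  qed
  then have Bs[measurable]: "B \<in> sets N" by (simp add: approximable_def)
  show ?thesis
    unfolding approximable_def
  proof (intro conjI allI impI)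
    fix e :: real assume "0 < e"
    from approximableD[OF \<open>approximable B\<close> this] obtain n D where
      D[measurable]: "D \<in> sets N" and D': "cylfun n (\<lambda>x. x \<in> D)" "measure N (sym_diff B D) < e" by blast
    note A[measurable]
    have "measure N (sym_diff A D) \<le> measure N (sym_diff A B \<union> sym_diff B D)"
      by (intro finite_measure_mono) auto
    also have "\<dots> \<le> measure N (sym_diff A B) + measure N (sym_diff B D)"
      by (intro measure_Un_le) auto
    also have "measure N (sym_diff A B) = 0"
      using AB by (simp add: measure_eq_emeasure_eq_ennreal null_setsD1 measure_def)
    finally show "\<exists>n B. B \<in> sets N \<and> cylfun n (\<lambda>x. x \<in> B) \<and> measure N (sym_diff A B) < e"
      using D D' by (intro exI[of _ n] exI[of _ D]) auto
  qed fact
qed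

text \<open>A substitute for Lebesgue density points: if every cylinder had a share larger than \<open>e\<close> outside \<open>G\<close>,
  so would every set depending on finitely many symbols, and \<open>G\<close> could not be approximated by such
  sets.\<close>

lemma density_cylinder:
  assumes sep: "separability N F P" and G[measurable]: "G \<in> sets N" and pos: "0 < measure N G" and e: "0 < e"
  obtains n ws where "ws \<in> words (Suc n)" "0 < measure N (cyl ws)"
    "measure N (cyl ws - G) \<le> e * measure N (cyl ws)"
proof -
  \<comment> \<open>This value turns the two inequalities \<open>e N(B) \<le> N(B - G) < e'\<close> and \<open>N(B) \<ge> N(G) - e'\<close> into a
    contradiction.\<close>
  define e' where "e' = e * measure N G / (1 + e)"
  have "0 < e'" using e pos by (simp add: e'_def)
  from approximableD[OF approximable_sets[OF sep G] this] obtain n0 B where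
    B[measurable]: "B \<in> sets N" and cB0: "cylfun n0 (\<lambda>x. x \<in> B)" and mB: "measure N (sym_diff G B) < e'" by blast
  have cB: "cylfun (Suc n0) (\<lambda>x. x \<in> B)" using cB0 by (rule cylfun_mono) simp
  show thesis
  proof (rule ccontr)
    assume "\<not> thesis"
    then have no: "\<not> (ws \<in> words (Suc n0) \<and> 0 < measure N (cyl ws) \<and> measure N (cyl ws - G) \<le> e * measure N (cyl ws))" for ws
      using that[of ws n0] by blast
    have bad: "e * measure N (cyl ws) \<le> measure N (cyl ws - G)" if ws: "ws \<in> words (Suc n0)" for ws
    proof (cases "0 < measure N (cyl ws)")
      case True then show ?thesis using no[of ws] ws by linarith
    next
      case False then show ?thesis by (simp add: zero_less_measure_iff)
    qed
    have "ennreal e * (\<integral>\<^sup>+x. indicator B x \<partial>N) = (\<integral>\<^sup>+ws. ennreal e * (\<integral>\<^sup>+x. indicator (cyl ws) x * indicator B x \<partial>N) \<partial>count_space (words (Suc n0)))"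
      by (subst nn_integral_cyl_decomp[of _ "Suc n0"]) (auto simp: nn_integral_cmult)
    also have "\<dots> \<le> (\<integral>\<^sup>+ws. (\<integral>\<^sup>+x. indicator (cyl ws) x * indicator (B - G) x \<partial>N) \<partial>count_space (words (Suc n0)))"
    proof (intro nn_integral_mono)
      fix ws assume "ws \<in> space (count_space (words (Suc n0)))"
      then have ws: "ws \<in> words (Suc n0)" by simp
      note cyl_sets[OF ws, measurable]
      show "ennreal e * (\<integral>\<^sup>+x. indicator (cyl ws) x * indicator B x \<partial>N) \<le> (\<integral>\<^sup>+x. indicator (cyl ws) x * indicator (B - G) x \<partial>N)"
      proof (cases "cyl ws \<inter> B = {}")
        case True
        then have "(\<integral>\<^sup>+x. indicator (cyl ws) x * indicator B x \<partial>N) = (\<integral>\<^sup>+x. 0 \<partial>N)"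
          by (intro nn_integral_cong) (auto simp: indicator_def)
        then show ?thesis by simp
      next
        case False
        then have sub: "cyl ws \<subseteq> B" using cB ws unfolding cylfun_def by blast
        have "(\<integral>\<^sup>+x. indicator (cyl ws) x * indicator B x \<partial>N) = (\<integral>\<^sup>+x. indicator (cyl ws) x \<partial>N)"
          using sub by (intro nn_integral_cong) (auto simp: indicator_def)
        moreover have "(\<integral>\<^sup>+x. indicator (cyl ws) x * indicator (B - G) x \<partial>N) = (\<integral>\<^sup>+x. indicator (cyl ws - G) x \<partial>N)"
          using sub by (intro nn_integral_cong) (auto simp: indicator_def)
        ultimately show ?thesis
          using bad[OF ws] e by (simp add: emeasure_eq_measure ennreal_mult[symmetric] ennreal_leI)
      qed
    qed
    also have "\<dots> = (\<integral>\<^sup>+x. indicator (B - G) x \<partial>N)"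
      by (rule nn_integral_cyl_decomp[symmetric]) measurable
    finally have "ennreal (e * measure N B) \<le> ennreal (measure N (B - G))"
      using e by (simp add: emeasure_eq_measure ennreal_mult)
    then have 1: "e * measure N B \<le> measure N (B - G)" by (simp add: ennreal_le_iff)
    have 2: "measure N (B - G) \<le> measure N (sym_diff G B)"
      by (intro finite_measure_mono) auto
    have "measure N G \<le> measure N (B \<union> sym_diff G B)"
      by (intro finite_measure_mono) auto
    also have "\<dots> \<le> measure N B + measure N (sym_diff G B)"
      by (intro measure_Un_le) auto
    finally have "e * (measure N G - e') < e * measure N B + 0" using mB e by simp
    then have "e * (measure N G - e') < e'" using 1 2 mB by linarith
    then show False using e by (simp add: e'_def field_simps)
  qed
qed

text \<open>Bounded distortion transports a cylinder filled by \<open>G\<close> up to a small proportion to an image that is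
  filled by \<open>G\<close> up to a small measure: as \<open>G\<close> is forward invariant, the points of the image outside
  \<open>G\<close> come from points of the cylinder outside \<open>G\<close>.\<close>

lemma image_almost_inside:
  assumes sep: "separability N F P" and G[measurable]: "G \<in> sets N" and pos: "0 < measure N G" and e: "0 < e"
    and inv: "AE x in N. x \<in> G \<longrightarrow> F x \<in> G"
  obtains \<omega> where "\<omega> \<in> P" "measure N (F ` \<omega> - G) \<le> e"
proof -
  define c where "c = Kd * measure N (space N)"
  have c: "0 < c" using Kd_pos space_pos by (simp add: c_def)
  have ec: "0 < e / c" using e c by simp
  from density_cylinder[OF sep G pos ec] obtain n ws where
    ws: "ws \<in> words (Suc n)" and mpos: "0 < measure N (cyl ws)" and
    dens: "measure N (cyl ws - G) \<le> e / c * measure N (cyl ws)" by blast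
  note cyl_sets[OF ws, measurable]
  have emp: "0 < emeasure N (cyl ws)" using mpos by (simp add: emeasure_eq_measure)
  have lst: "last ws \<in> P"
    using ws last_in_set[of ws] by (fastforce simp: words_def)
  note image_sets[OF lst, measurable]
  have inv': "AE x in N. x \<in> G \<longrightarrow> (F ^^ k) x \<in> G" for k
  proof (induction k)
    case (Suc k)
    show ?case using Suc AE_compose_funpow[OF inv, of k] by eventually_elim auto
  qed simp
  have bnd: "Jn (Suc n) x * measure N (cyl ws) \<le> c" if x: "x \<in> cyl ws" for x
  proof -
    have xs: "x \<in> space N" using x cyl_sub_space by auto
    have "ennreal (Jn (Suc n) x / Kd * measure N (cyl ws)) = (\<integral>\<^sup>+y. ennreal (Jn (Suc n) x / Kd) * indicator (cyl ws) y \<partial>N)"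
      using Jn_pos[OF xs, of "Suc n"] Kd_pos by (simp add: nn_integral_cmult_indicator emeasure_eq_measure flip: ennreal_mult)
    also have "\<dots> \<le> (\<integral>\<^sup>+y. indicator (cyl ws) y * ennreal (Jn (Suc n) y) \<partial>N)"
      using distortion[OF ws x] Kd_pos
      by (intro nn_integral_mono) (auto simp: indicator_def divide_le_eq mult.commute intro!: ennreal_leI)
    also have "\<dots> = emeasure N (F ` last ws)"
      using change_of_variables_cyl[of "\<lambda>_. 1" ws n] ws emp by simp
    also have "\<dots> \<le> ennreal (measure N (space N))"
      by (simp add: emeasure_eq_measure ennreal_leI finite_measure_mono sets.sets_into_space)
    finally have "Jn (Suc n) x / Kd * measure N (cyl ws) \<le> measure N (space N)"
      by (simp add: ennreal_le_iff)
    then show ?thesis using Kd_pos by (simp add: c_def field_simps)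
  qed
  have "emeasure N (F ` last ws - G) = (\<integral>\<^sup>+x. indicator (F ` last ws - G) x \<partial>N)"
    by simp
  also have "\<dots> = (\<integral>\<^sup>+x. indicator (F ` last ws) x * indicator (space N - G) x \<partial>N)"
    by (intro nn_integral_cong) (auto simp: indicator_def)
  also have "\<dots> = (\<integral>\<^sup>+x. indicator (cyl ws) x * indicator (space N - G) ((F ^^ Suc n) x) * ennreal (Jn (Suc n) x) \<partial>N)"
    by (intro change_of_variables_cyl[symmetric] ws emp) measurable
  also have "\<dots> \<le> (\<integral>\<^sup>+x. ennreal (c / measure N (cyl ws)) * indicator (cyl ws - G) x \<partial>N)"
  proof (intro nn_integral_mono_AE, use inv'[of "Suc n"] in eventually_elim)
    fix x assume x: "x \<in> G \<longrightarrow> (F ^^ Suc n) x \<in> G"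
    show "indicator (cyl ws) x * indicator (space N - G) ((F ^^ Suc n) x) * ennreal (Jn (Suc n) x) \<le> ennreal (c / measure N (cyl ws)) * indicator (cyl ws - G) x"
    proof (cases "x \<in> cyl ws - G")
      case True
      then show ?thesis using bnd[of x] mpos by (auto simp: indicator_def field_simps intro!: ennreal_leI)
    next
      case False
      then show ?thesis using x by (auto simp: indicator_def)
    qed
  qed
  also have "\<dots> = ennreal (c / measure N (cyl ws) * measure N (cyl ws - G))"
    using c by (simp add: nn_integral_cmult_indicator emeasure_eq_measure flip: ennreal_mult)
  also have "\<dots> \<le> ennreal e"
    using dens c mpos by (intro ennreal_leI) (simp add: field_simps)
  finally have "measure N (F ` last ws - G) \<le> e"
    using e by (simp add: emeasure_eq_measure)
  then show thesis using lst that by blast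
qed

lemma finite_subpartition:
  assumes e: "0 < e"
  obtains Q where "finite Q" "Q \<subseteq> P" "measure N (space N - \<Union>Q) < e"
proof -
  have ne: "P \<noteq> {}" using null_P space_pos by (auto simp: measure_def null_sets_def)
  define A where "A = from_nat_into P"
  have AP: "A i \<in> P" for i unfolding A_def using ne by (rule from_nat_into)
  have [measurable]: "A i \<in> sets N" for i using AP by auto
  have r: "(\<Union>i. A i) = \<Union>P"
    using range_from_nat_into[OF ne countable_P] by (simp add: A_def)
  have "(\<lambda>m. measure N (\<Union>i<m. A i)) \<longlonglongrightarrow> measure N (\<Union>m. \<Union>i<m. A i)"
    by (intro finite_Lim_measure_incseq) (auto simp: incseq_def intro: order_less_le_trans)
  moreover have "(\<Union>m. \<Union>i<m. A i) = \<Union>P" unfolding r[symmetric] by auto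
  moreover have "measure N (\<Union>P) = measure N (space N)"
    using null_P finite_measure_compl[of "\<Union>P"] by (simp add: measure_def null_sets_def)
  ultimately have "(\<lambda>m. measure N (\<Union>i<m. A i)) \<longlonglongrightarrow> measure N (space N)" by simp
  then have "\<forall>\<^sub>F m in sequentially. measure N (space N) - e < measure N (\<Union>i<m. A i)"
    using e by (intro order_tendstoD) auto
  then obtain m where m: "measure N (space N) - e < measure N (\<Union>i<m. A i)"
    by (auto simp: eventually_sequentially)
  then have "measure N (space N - \<Union>(A ` {..<m})) < e"
    by (subst finite_measure_compl) auto
  then show thesis using that[of "A ` {..<m}"] AP by auto
qed

text \<open>All images have measure at least \<open>\<delta>\<close>, so each contains one of finitely many fixed elements of \<open>P\<close>.
  Among finitely many candidates, one must lie in \<open>G\<close> completely if for every \<open>e\<close> some candidate does so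
  up to measure \<open>e\<close>.\<close>

lemma full_element:
  assumes sep: "separability N F P" and G[measurable]: "G \<in> sets N" and pos: "0 < measure N G"
    and inv: "AE x in N. x \<in> G \<longrightarrow> F x \<in> G"
  obtains \<omega> where "\<omega> \<in> P" "0 < measure N \<omega>" "measure N (\<omega> - G) = 0"
proof -
  note result = that
  obtain Q where Q: "finite Q" "Q \<subseteq> P" "measure N (space N - \<Union>Q) < \<delta>"
    using finite_subpartition[OF delta_pos] by blast
  have step: "\<exists>\<omega>\<in>Q. 0 < measure N \<omega> \<and> measure N (\<omega> - G) \<le> e" if e: "0 < e" for e :: real
  proof -
    obtain l where l: "l \<in> P" "measure N (F ` l - G) \<le> e"
      using image_almost_inside[OF sep G pos e inv] by blast
    note image_sets[OF l(1), measurable]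
    have "\<exists>\<omega>\<in>Q. F ` l \<inter> \<omega> \<notin> null_sets N"
    proof (rule ccontr)
      assume "\<not> ?thesis"
      then have "(\<Union>\<omega>\<in>Q. F ` l \<inter> \<omega>) \<in> null_sets N"
        using Q(1) by (intro null_sets_UN' countable_finite) auto
      then have "measure N (\<Union>\<omega>\<in>Q. F ` l \<inter> \<omega>) = 0" by (simp add: measure_def null_sets_def)
      moreover have QN: "\<Union>Q \<in> sets N" using Q P_sets by (intro sets.finite_Union) auto
      moreover have "measure N (F ` l) \<le> measure N ((\<Union>\<omega>\<in>Q. F ` l \<inter> \<omega>) \<union> (space N - \<Union>Q))"
        using QN image_sets[OF l(1)] sets.sets_into_space[OF image_sets[OF l(1)]]
        by (intro finite_measure_mono) auto
      moreover have "\<dots> \<le> measure N (\<Union>\<omega>\<in>Q. F ` l \<inter> \<omega>) + measure N (space N - \<Union>Q)"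
        using QN image_sets[OF l(1)] by (intro measure_Un_le) auto
      ultimately show False using Q(3) long_branches[OF l(1)] by linarith
    qed
    then obtain \<omega> where w: "\<omega> \<in> Q" "F ` l \<inter> \<omega> \<notin> null_sets N" by blast
    have wP: "\<omega> \<in> P" using w Q by auto
    note P_setsD[OF wP, measurable]
    have "0 < measure N \<omega>"
    proof (rule ccontr)
      assume "\<not> ?thesis"
      then have "\<omega> \<in> null_sets N"
        by (auto simp: null_sets_def emeasure_eq_measure zero_less_measure_iff)
      then have "F ` l \<inter> \<omega> \<in> null_sets N" by (rule null_set_Int1) measurable
      then show False using w by (simp add: Int_commute)
    qed
    moreover have "measure N (\<omega> - G) \<le> measure N (F ` l - G)"
      using markov_image[OF l(1) wP w(2)]
      by (intro finite_measure_mono_AE) (auto elim: eventually_mono)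
    ultimately show ?thesis using l(2) w(1) by force
  qed
  define Q' where "Q' = {\<omega>\<in>Q. 0 < measure N \<omega>}"
  have fin: "finite Q'" using Q(1) by (simp add: Q'_def)
  have ne: "Q' \<noteq> {}" using step[of 1] by (auto simp: Q'_def)
  show thesis
  proof (rule ccontr)
    assume "\<not> thesis"
    have p: "0 < measure N (\<omega> - G)" if w: "\<omega> \<in> Q'" for \<omega>
    proof (rule ccontr)
      assume "\<not> ?thesis"
      then have "measure N (\<omega> - G) = 0" by (simp add: zero_less_measure_iff)
      with w Q(2) \<open>\<not> thesis\<close> show False using result[of \<omega>] by (auto simp: Q'_def)
    qed
    define e where "e = Min ((\<lambda>\<omega>. measure N (\<omega> - G)) ` Q') / 2"
    have "0 < Min ((\<lambda>\<omega>. measure N (\<omega> - G)) ` Q')" using fin ne p by (subst Min_gr_iff) auto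
    then have e: "0 < e" by (simp add: e_def)
    from step[OF e] obtain \<omega> where w: "\<omega> \<in> Q'" "measure N (\<omega> - G) \<le> e" by (auto simp: Q'_def)
    have "2 * e \<le> measure N (\<omega> - G)" using fin w by (auto simp: e_def intro: Min_le)
    then show False using w e by linarith
  qed
qed

text \<open>The elements of \<open>P\<close> filled by \<open>G\<close> are closed under transitions of positive measure by the Markov
  property; one exists, and aperiodicity connects it with every other element.\<close>

theorem ergodic_F:
  assumes sep: "separability N F P" and aper: "aperiodic N F P"
    and G[measurable]: "G \<in> sets N" and pos: "0 < measure N G"
    and inv: "AE x in N. x \<in> G \<longrightarrow> F x \<in> G"
  shows "AE x in N. x \<in> G"
proof -
  define full where "full \<omega> \<longleftrightarrow> (AE x in N. x \<in> \<omega> \<longrightarrow> x \<in> G)" for \<omega>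
  define S where "S = \<Union>{\<omega>\<in>P. full \<omega>}"
  obtain \<omega>0 where w0: "\<omega>0 \<in> P" "0 < measure N \<omega>0" "measure N (\<omega>0 - G) = 0"
    using full_element[OF sep G pos inv] by blast
  have "\<omega>0 - G \<in> null_sets N"
    using w0 by (auto simp: null_sets_def emeasure_eq_measure)
  from AE_not_in[OF this] have full0: "full \<omega>0"
    unfolding full_def by eventually_elim auto
  have propagate: "full \<omega>'" if w: "\<omega> \<in> P" "\<omega>' \<in> P" "full \<omega>" "0 < emeasure N (\<omega> \<inter> {x\<in>space N. F x \<in> \<omega>'})" for \<omega> \<omega>'
  proof -
    note P_setsD[OF w(1), measurable] image_sets[OF w(1), measurable]
    have "(\<integral>\<^sup>+x. indicator (F ` \<omega>) x * indicator (space N - G) x \<partial>N)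
        = (\<integral>\<^sup>+x. indicator \<omega> x * indicator (space N - G) (F x) * ennreal (J x) \<partial>N)"
      by (intro change_of_variables[symmetric] w) measurable
    also have "\<dots> = (\<integral>\<^sup>+x. 0 \<partial>N)"
      using w(3) inv unfolding full_def
      by (intro nn_integral_cong_AE) (auto elim!: eventually_elim2 simp: indicator_def)
    finally have "AE x in N. indicator (F ` \<omega>) x * indicator (space N - G) x = (0::ennreal)"
      by (subst nn_integral_0_iff_AE[symmetric]) auto
    then show ?thesis
      unfolding full_def using markov_step[OF w(1,2,4)] AE_space
      by eventually_elim (auto simp: indicator_def split: if_splits)
  qed
  have "AE x in N. \<forall>\<omega>\<in>P. \<forall>\<omega>'\<in>P. x \<in> \<omega> \<and> F x \<in> \<omega>' \<longrightarrow> 0 < emeasure N (\<omega> \<inter> {x\<in>space N. F x \<in> \<omega>'})"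
  proof (subst AE_ball_countable[OF countable_P], intro ballI, subst AE_ball_countable[OF countable_P], intro ballI)
    fix \<omega> \<omega>' assume w: "\<omega> \<in> P" "\<omega>' \<in> P"
    note P_setsD[OF w(1), measurable] P_setsD[OF w(2), measurable]
    show "AE x in N. x \<in> \<omega> \<and> F x \<in> \<omega>' \<longrightarrow> 0 < emeasure N (\<omega> \<inter> {x\<in>space N. F x \<in> \<omega>'})"
    proof (cases "emeasure N (\<omega> \<inter> {x\<in>space N. F x \<in> \<omega>'}) = 0")
      case True
      then have "\<omega> \<inter> {x\<in>space N. F x \<in> \<omega>'} \<in> null_sets N" by (auto simp: null_sets_def)
      from AE_not_in[OF this] AE_space[of N] show ?thesis by eventually_elim auto
    qed (auto simp: zero_less_iff_neq_zero)
  qed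
  then have stepS: "AE x in N. x \<in> S \<longrightarrow> F x \<in> S"
    using AE_good
  proof eventually_elim
    fix x assume h: "\<forall>\<omega>\<in>P. \<forall>\<omega>'\<in>P. x \<in> \<omega> \<and> F x \<in> \<omega>' \<longrightarrow> 0 < emeasure N (\<omega> \<inter> {x\<in>space N. F x \<in> \<omega>'})"
      and g: "good x"
    show "x \<in> S \<longrightarrow> F x \<in> S"
    proof
      assume "x \<in> S"
      then obtain \<omega> where w: "\<omega> \<in> P" "full \<omega>" "x \<in> \<omega>" by (auto simp: S_def)
      have "(F ^^ Suc 0) x \<in> \<Union>P" using g unfolding good_def by blast
      then obtain \<omega>' where w': "\<omega>' \<in> P" "F x \<in> \<omega>'" by auto
      have "full \<omega>'" using h w w' by (intro propagate[OF w(1) w'(1) w(2)]) blast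
      then show "F x \<in> S" using w' by (auto simp: S_def)
    qed
  qed
  have stepn: "AE x in N. x \<in> S \<longrightarrow> (F ^^ n) x \<in> S" for n
  proof (induction n)
    case (Suc n)
    show ?case using Suc AE_compose_funpow[OF stepS, of n] by eventually_elim auto
  qed simp
  have "full \<omega>" if w: "\<omega> \<in> P" for \<omega>
  proof -
    obtain n where n: "0 < emeasure N (\<omega>0 \<inter> (F ^^ n) -` \<omega>)"
      using aper w w0(1) unfolding aperiodic_def by blast
    note P_setsD[OF w, measurable] P_setsD[OF w0(1), measurable]
    have eq: "\<omega>0 \<inter> (F ^^ n) -` \<omega> = \<omega>0 \<inter> ((F ^^ n) -` \<omega> \<inter> space N)"
      using P_sub_space[OF w0(1)] by auto
    have "\<not> (AE x in N. x \<notin> \<omega>0 \<inter> (F ^^ n) -` \<omega>)"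
      using n unfolding eq by (subst AE_iff_null_sets[symmetric]) (auto simp: null_sets_def)
    moreover have "AE x in N. x \<notin> \<omega>0 \<inter> (F ^^ n) -` \<omega>"
      if none: "\<not> (\<exists>x. x \<in> \<omega>0 \<and> (F ^^ n) x \<in> \<omega> \<and> (x \<in> S \<longrightarrow> (F ^^ n) x \<in> S))"
      using stepn[of n] by eventually_elim (use none in blast)
    ultimately obtain x where x: "x \<in> \<omega>0" "(F ^^ n) x \<in> \<omega>" "x \<in> S \<longrightarrow> (F ^^ n) x \<in> S"
      by blast
    then have "(F ^^ n) x \<in> S" using full0 w0(1) by (auto simp: S_def)
    then obtain \<omega>' where w': "\<omega>' \<in> P" "full \<omega>'" "(F ^^ n) x \<in> \<omega>'" by (auto simp: S_def)
    then show ?thesis using P_unique[OF w w'(1) x(2) w'(3)] by simp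
  qed
  then have "AE x in N. \<forall>\<omega>\<in>P. x \<in> \<omega> \<longrightarrow> x \<in> G"
    by (subst AE_ball_countable[OF countable_P]) (auto simp: full_def)
  moreover have "AE x in N. x \<in> \<Union>P"
    using AE_not_in[OF null_P] AE_space[of N] by eventually_elim auto
  ultimately show ?thesis by eventually_elim auto
qed

end

section \<open>The ergodic theorem for bounded observables\<close>

definition birkhoff_sum :: "('a \<Rightarrow> 'a) \<Rightarrow> ('a \<Rightarrow> real) \<Rightarrow> nat \<Rightarrow> 'a \<Rightarrow> real" where
  "birkhoff_sum T \<phi> n x = (\<Sum>i<n. \<phi> ((T ^^ i) x))"

lemma birkhoff_sum_0 [simp]: "birkhoff_sum T \<phi> 0 x = 0"
  by (simp add: birkhoff_sum_def)

lemma birkhoff_sum_add: "birkhoff_sum T \<phi> (n + k) x = birkhoff_sum T \<phi> n x + birkhoff_sum T \<phi> k ((T ^^ n) x)"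
proof (induction k)
  case (Suc k)
  have "(T ^^ (n + k)) x = (T ^^ k) ((T ^^ n) x)" by (metis add.commute comp_apply funpow_add)
  with Suc show ?case by (simp add: birkhoff_sum_def)
qed (simp add: birkhoff_sum_def)

lemma birkhoff_sum_Suc: "birkhoff_sum T \<phi> (Suc n) x = \<phi> x + birkhoff_sum T \<phi> n (T x)"
  using birkhoff_sum_add[of T \<phi> 1 n x] by (simp add: birkhoff_sum_def)

lemma birkhoff_sum_diff_const: "birkhoff_sum T (\<lambda>x. \<phi> x - c) n x = birkhoff_sum T \<phi> n x - c * real n"
  by (simp add: birkhoff_sum_def sum_subtractf)

lemma birkhoff_sum_uminus: "birkhoff_sum T (\<lambda>x. - \<phi> x) n x = - birkhoff_sum T \<phi> n x"
  by (simp add: birkhoff_sum_def sum_negf)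

lemma birkhoff_sum_bound:
  assumes "\<And>x. \<bar>\<phi> x\<bar> \<le> B" shows "\<bar>birkhoff_sum T \<phi> n x\<bar> \<le> B * real n"
proof -
  have "\<bar>birkhoff_sum T \<phi> n x\<bar> \<le> (\<Sum>i<n. \<bar>\<phi> ((T ^^ i) x)\<bar>)" unfolding birkhoff_sum_def by (rule sum_abs)
  also have "\<dots> \<le> (\<Sum>i<n. B)" by (intro sum_mono assms)
  finally show ?thesis by (simp add: mult.commute)
qed

lemma birkhoff_sum_measurable [measurable]:
  assumes [measurable]: "T \<in> M \<rightarrow>\<^sub>M M" "\<phi> \<in> borel_measurable M"
  shows "birkhoff_sum T \<phi> n \<in> borel_measurable M"
proof -
  have [measurable]: "T ^^ i \<in> M \<rightarrow>\<^sub>M M" for i by (rule measurable_compose_n) measurable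
  show ?thesis unfolding birkhoff_sum_def by measurable
qed

text \<open>The maximum of the Birkhoff sums of length \<open>0, \<dots>, n\<close>, in the recursive form on which Garsia's proof of
  the maximal ergodic theorem operates.\<close>

primrec bmax :: "('a \<Rightarrow> 'a) \<Rightarrow> ('a \<Rightarrow> real) \<Rightarrow> nat \<Rightarrow> 'a \<Rightarrow> real" where
  "bmax T \<phi> 0 x = 0"
| "bmax T \<phi> (Suc n) x = max 0 (\<phi> x + bmax T \<phi> n (T x))"

lemma bmax_measurable [measurable]:
  assumes [measurable]: "T \<in> M \<rightarrow>\<^sub>M M" "\<phi> \<in> borel_measurable M"
  shows "bmax T \<phi> n \<in> borel_measurable M"
proof (induction n)
  case (Suc n)
  note Suc[measurable]
  have "(\<lambda>x. max 0 (\<phi> x + bmax T \<phi> n (T x))) \<in> borel_measurable M" by measurable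
  then show ?case by (simp add: fun_eq_iff cong: measurable_cong)
qed (simp add: fun_eq_iff cong: measurable_cong)

lemma bmax_nonneg: "0 \<le> bmax T \<phi> n x"
  by (cases n) auto

lemma bmax_mono: "bmax T \<phi> n x \<le> bmax T \<phi> (Suc n) x"
proof (induction n arbitrary: x)
  case (Suc n)
  show ?case using Suc[of "T x"] by simp
qed simp

lemma bmax_bound:
  assumes "\<And>x. \<bar>\<phi> x\<bar> \<le> B" shows "bmax T \<phi> n x \<le> B * real n"
proof (induction n arbitrary: x)
  case (Suc n)
  have "0 \<le> B" using assms[of x] by linarith
  then show ?case using Suc[of "T x"] assms[of x] by (simp add: algebra_simps abs_le_iff)
qed simp

lemma birkhoff_sum_le_bmax: "k \<le> n \<Longrightarrow> birkhoff_sum T \<phi> k x \<le> bmax T \<phi> n x"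
proof (induction k arbitrary: n x)
  case 0 then show ?case by (simp add: bmax_nonneg)
next
  case (Suc k)
  then obtain n' where n': "n = Suc n'" "k \<le> n'" by (cases n) auto
  show ?case using Suc.IH[OF n'(2), of "T x"] by (simp add: birkhoff_sum_Suc n'(1))
qed

lemma integral_compose_invariant:
  assumes "T \<in> M \<rightarrow>\<^sub>M M" "distr M M T = M" "(g :: _ \<Rightarrow> real) \<in> borel_measurable M"
  shows "(\<integral>x. g (T x) \<partial>M) = (\<integral>x. g x \<partial>M)"
  using integral_distr[of T M M g] assms by simp

text \<open>Garsia's argument: where the maximum \<open>M\<^sub>n\<close> is positive, \<open>\<phi> \<ge> M\<^sub>n - M\<^sub>n \<circ> T\<close>, and elsewhere
  \<open>M\<^sub>n - M\<^sub>n \<circ> T \<le> 0\<close>; the integral of \<open>M\<^sub>n - M\<^sub>n \<circ> T\<close> vanishes. As \<open>n\<close> grows the set where \<open>M\<^sub>n\<close> is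
  positive exhausts the space.\<close>

lemma (in prob_space) maximal_ergodic:
  assumes T[measurable]: "T \<in> M \<rightarrow>\<^sub>M M" and inv: "distr M M T = M"
    and phi[measurable]: "\<phi> \<in> borel_measurable M" and B: "\<And>x. \<bar>\<phi> x\<bar> \<le> B"
    and pos: "AE x in M. \<exists>k. 0 < birkhoff_sum T \<phi> k x"
  shows "0 \<le> (\<integral>x. \<phi> x \<partial>M)"
proof -
  define I where "I n x = (indicator {x. 0 < bmax T \<phi> n x} x :: real)" for n x
  have [measurable]: "I n \<in> borel_measurable M" for n
  proof -
    have "(\<lambda>x. if 0 < bmax T \<phi> n x then 1 else 0 :: real) \<in> borel_measurable M" by measurable
    also have "(\<lambda>x. if 0 < bmax T \<phi> n x then 1 else 0 :: real) = I n"
      by (auto simp: I_def indicator_def fun_eq_iff)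
    finally show ?thesis .
  qed
  have int[simp]: "integrable M (bmax T \<phi> n)" for n
    using bmax_bound[of \<phi> B T n] B bmax_nonneg[of T \<phi> n]
    by (intro integrable_const_bound[where B = "B * real n"]) auto
  have intT[simp]: "integrable M (\<lambda>x. bmax T \<phi> n (T x))" for n
    using bmax_bound[of \<phi> B T n] B bmax_nonneg[of T \<phi> n]
    by (intro integrable_const_bound[where B = "B * real n"]) auto
  have intp[simp]: "integrable M (\<lambda>x. I n x * \<phi> x)" for n
    using B order_trans[OF abs_ge_zero B]
    by (intro integrable_const_bound[where B = B]) (auto simp: I_def indicator_def)
  have "0 \<le> (\<integral>x. I n x * \<phi> x \<partial>M)" for n
  proof (cases n)
    case 0 then show ?thesis by (simp add: I_def)
  next
    case (Suc k)
    have "0 = (\<integral>x. bmax T \<phi> n x \<partial>M) - (\<integral>x. bmax T \<phi> n (T x) \<partial>M)"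
      using integral_compose_invariant[OF T inv, of "bmax T \<phi> n"] by simp
    also have "\<dots> = (\<integral>x. bmax T \<phi> n x - bmax T \<phi> n (T x) \<partial>M)" by simp
    also have "\<dots> \<le> (\<integral>x. I n x * \<phi> x \<partial>M)"
    proof (intro integral_mono)
      fix x
      show "bmax T \<phi> n x - bmax T \<phi> n (T x) \<le> I n x * \<phi> x"
      proof (cases "0 < bmax T \<phi> n x")
        case True
        then have "bmax T \<phi> n x = \<phi> x + bmax T \<phi> k (T x)" by (auto simp: Suc max_def split: if_splits)
        then show ?thesis using True bmax_mono[of T \<phi> k "T x"] Suc by (simp add: I_def)
      next
        case False
        then have "bmax T \<phi> n x = 0" using bmax_nonneg[of T \<phi> n x] by linarith
        then show ?thesis using False bmax_nonneg[of T \<phi> n "T x"] by (simp add: I_def)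
      qed
    qed simp_all
    finally show ?thesis .
  qed
  moreover have "(\<lambda>n. \<integral>x. I n x * \<phi> x \<partial>M) \<longlonglongrightarrow> (\<integral>x. \<phi> x \<partial>M)"
  proof (rule integral_dominated_convergence[where w = "\<lambda>_. B"])
    show "AE x in M. (\<lambda>n. I n x * \<phi> x) \<longlonglongrightarrow> \<phi> x"
      using pos
    proof eventually_elim
      fix x assume "\<exists>k. 0 < birkhoff_sum T \<phi> k x"
      then obtain k where k: "0 < birkhoff_sum T \<phi> k x" by auto
      have "I n x * \<phi> x = \<phi> x" if "k \<le> n" for n
        using birkhoff_sum_le_bmax[OF that, of T \<phi> x] k by (simp add: I_def)
      then show "(\<lambda>n. I n x * \<phi> x) \<longlonglongrightarrow> \<phi> x"
        by (intro tendsto_eventually) (auto simp: eventually_sequentially)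
    qed
    show "AE x in M. norm (I n x * \<phi> x) \<le> B" for n
      using B order_trans[OF abs_ge_zero B] by (auto simp: I_def indicator_def)
  qed simp_all
  ultimately show ?thesis by (intro LIMSEQ_le_const) auto
qed

text \<open>The set where the Birkhoff sums of \<open>\<phi> - c\<close> are unbounded above is strictly invariant. It cannot have
  measure \<open>1\<close>, for then the maximal ergodic theorem would make the mean of \<open>\<phi> - c\<close> nonnegative.\<close>

lemma (in prob_space) ergodic_upper_bound:
  assumes T[measurable]: "T \<in> M \<rightarrow>\<^sub>M M" and inv: "distr M M T = M"
    and erg: "\<forall>A\<in>sets M. T -` A \<inter> space M = A \<longrightarrow> prob A = 0 \<or> prob A = 1"
    and phi[measurable]: "\<phi> \<in> borel_measurable M" and B: "\<And>x. \<bar>\<phi> x\<bar> \<le> B"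
    and c: "(\<integral>x. \<phi> x \<partial>M) < c"
  shows "AE x in M. \<exists>A. \<forall>n. birkhoff_sum T \<phi> n x \<le> c * real n + A"
proof -
  define \<psi> where "\<psi> x = \<phi> x - c" for x
  have [measurable]: "\<psi> \<in> borel_measurable M" unfolding \<psi>_def by measurable
  define E where "E = {x\<in>space M. \<forall>A::nat. \<exists>n. real A < birkhoff_sum T \<psi> n x}"
  have [measurable]: "E \<in> sets M" unfolding E_def by measurable
  have shift: "(\<forall>A::nat. \<exists>n. real A < birkhoff_sum T \<psi> n (T x)) \<longleftrightarrow> (\<forall>A::nat. \<exists>n. real A < birkhoff_sum T \<psi> n x)" for x
  proof (intro iffI allI)
    fix A assume h: "\<forall>A::nat. \<exists>n. real A < birkhoff_sum T \<psi> n (T x)"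
    \<comment> \<open>The sums at \<open>x\<close> and \<open>T x\<close> differ by an index shift and the bounded term \<open>\<psi> x\<close>.\<close>
    obtain A' :: nat where "real A + \<bar>\<psi> x\<bar> < real A'" using reals_Archimedean2 by blast
    moreover obtain n where "real A' < birkhoff_sum T \<psi> n (T x)" using h by blast
    ultimately have "real A < birkhoff_sum T \<psi> (Suc n) x" by (simp add: birkhoff_sum_Suc)
    then show "\<exists>n. real A < birkhoff_sum T \<psi> n x" by blast
  next
    fix A assume h: "\<forall>A::nat. \<exists>n. real A < birkhoff_sum T \<psi> n x"
    obtain A' :: nat where A': "real A + \<bar>\<psi> x\<bar> < real A'" using reals_Archimedean2 by blast
    moreover obtain n where n: "real A' < birkhoff_sum T \<psi> n x" using h by blast
    moreover have "n \<noteq> 0" using n by (intro notI) simp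
    then obtain k where "n = Suc k" by (cases n) auto
    ultimately have "real A < birkhoff_sum T \<psi> k (T x)" by (simp add: birkhoff_sum_Suc)
    then show "\<exists>n. real A < birkhoff_sum T \<psi> n (T x)" by blast
  qed
  have "T -` E \<inter> space M = E"
    using measurable_space[OF T] by (auto simp: E_def shift)
  then have "prob E = 0 \<or> prob E = 1" using erg by auto
  moreover have "prob E \<noteq> 1"
  proof
    assume "prob E = 1"
    then have "AE x in M. x \<in> E" by (simp add: AE_in_set_eq_1)
    then have "AE x in M. \<exists>k. 0 < birkhoff_sum T \<psi> k x"
    proof eventually_elim
      fix x assume "x \<in> E"
      then obtain n where "real 0 < birkhoff_sum T \<psi> n x" unfolding E_def by blast
      then show "\<exists>k. 0 < birkhoff_sum T \<psi> k x" by (intro exI[of _ n]) simp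
    qed
    then have "0 \<le> (\<integral>x. \<psi> x \<partial>M)"
    proof (rule maximal_ergodic[OF T inv, rotated 2])
      show "\<bar>\<psi> x\<bar> \<le> B + \<bar>c\<bar>" for x using B[of x] unfolding \<psi>_def by linarith
    qed measurable
    moreover have "integrable M \<phi>" using B by (intro integrable_const_bound[where B = B]) auto
    then have "(\<integral>x. \<psi> x \<partial>M) = (\<integral>x. \<phi> x \<partial>M) - c" unfolding \<psi>_def by (simp add: prob_space)
    ultimately show False using c by linarith
  qed
  ultimately have "E \<in> null_sets M" by (auto simp: null_sets_def emeasure_eq_measure)
  from AE_not_in[OF this] AE_space show ?thesis
  proof eventually_elim
    fix x assume "x \<notin> E" "x \<in> space M"
    then obtain A :: nat where A: "\<And>n. birkhoff_sum T \<psi> n x \<le> real A" by (auto simp: E_def not_less)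
    have "birkhoff_sum T \<phi> n x \<le> c * real n + real A" for n
      using A[of n] unfolding \<psi>_def birkhoff_sum_diff_const by linarith
    then show "\<exists>A. \<forall>n. birkhoff_sum T \<phi> n x \<le> c * real n + A" by blast
  qed
qed

lemma eventually_div_le:
  assumes A: "\<forall>n. s n \<le> c * real n + A" and c: "c < d"
  shows "\<forall>\<^sub>F n in sequentially. s n / real n < (d::real)"
proof -
  obtain n0 :: nat where n0: "\<bar>A\<bar> / (d - c) < real n0" using reals_Archimedean2 by blast
  have "s n / real n < d" if n: "Suc n0 \<le> n" for n
  proof -
    have "\<bar>A\<bar> < real n0 * (d - c)" using n0 c by (simp add: field_simps)
    also have "\<dots> \<le> real n * (d - c)" using n c by (intro mult_right_mono) auto
    finally have "s n < d * real n" using A[rule_format, of n] by (simp add: algebra_simps)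
    then show ?thesis using n by (simp add: field_simps)
  qed
  then show ?thesis by (auto simp: eventually_sequentially)
qed

theorem (in prob_space) birkhoff:
  assumes T[measurable]: "T \<in> M \<rightarrow>\<^sub>M M" and inv: "distr M M T = M"
    and erg: "\<forall>A\<in>sets M. T -` A \<inter> space M = A \<longrightarrow> prob A = 0 \<or> prob A = 1"
    and phi[measurable]: "\<phi> \<in> borel_measurable M" and B: "\<And>x. \<bar>\<phi> x\<bar> \<le> B"
  shows "AE x in M. (\<lambda>n. birkhoff_sum T \<phi> n x / real n) \<longlonglongrightarrow> (\<integral>x. \<phi> x \<partial>M)"
proof -
  let ?I = "\<integral>x. \<phi> x \<partial>M"
  have "AE x in M. \<exists>A. \<forall>n. birkhoff_sum T \<phi> n x \<le> (?I + 1 / real (Suc j)) * real n + A" for j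
    by (rule ergodic_upper_bound[OF T inv erg phi B]) auto
  then have up: "AE x in M. \<forall>j. \<exists>A. \<forall>n. birkhoff_sum T \<phi> n x \<le> (?I + 1 / real (Suc j)) * real n + A"
    by (simp add: AE_all_countable)
  have "AE x in M. \<exists>A. \<forall>n. birkhoff_sum T (\<lambda>x. - \<phi> x) n x \<le> (- ?I + 1 / real (Suc j)) * real n + A" for j
    using B by (intro ergodic_upper_bound[OF T inv erg]) auto
  then have lo: "AE x in M. \<forall>j. \<exists>A. \<forall>n. birkhoff_sum T (\<lambda>x. - \<phi> x) n x \<le> (- ?I + 1 / real (Suc j)) * real n + A"
    by (simp add: AE_all_countable)
  from up lo show ?thesis
  proof eventually_elim
    fix x assume u: "\<forall>j. \<exists>A. \<forall>n. birkhoff_sum T \<phi> n x \<le> (?I + 1 / real (Suc j)) * real n + A"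
      and l: "\<forall>j. \<exists>A. \<forall>n. birkhoff_sum T (\<lambda>x. - \<phi> x) n x \<le> (- ?I + 1 / real (Suc j)) * real n + A"
    show "(\<lambda>n. birkhoff_sum T \<phi> n x / real n) \<longlonglongrightarrow> ?I"
    proof (rule order_tendstoI)
      fix a assume "?I < a"
      then obtain j where j: "1 / real (Suc j) < a - ?I"
        using reals_Archimedean[of "a - ?I"] by (auto simp: inverse_eq_divide)
      obtain A where "\<forall>n. birkhoff_sum T \<phi> n x \<le> (?I + 1 / real (Suc j)) * real n + A" using u by blast
      then show "\<forall>\<^sub>F n in sequentially. birkhoff_sum T \<phi> n x / real n < a"
        by (rule eventually_div_le) (use j in linarith)
    next
      fix a assume "a < ?I"
      then obtain j where j: "1 / real (Suc j) < ?I - a"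
        using reals_Archimedean[of "?I - a"] by (auto simp: inverse_eq_divide)
      obtain A where "\<forall>n. birkhoff_sum T (\<lambda>x. - \<phi> x) n x \<le> (- ?I + 1 / real (Suc j)) * real n + A" using l by blast
      then have "\<forall>\<^sub>F n in sequentially. birkhoff_sum T (\<lambda>x. - \<phi> x) n x / real n < - a"
        by (rule eventually_div_le) (use j in linarith)
      then show "\<forall>\<^sub>F n in sequentially. a < birkhoff_sum T \<phi> n x / real n"
        by eventually_elim (simp add: birkhoff_sum_uminus)
    qed
  qed
qed

section \<open>The invariant measure seen from the base\<close>

text \<open>The measure \<open>N\<close> is kept as a separate parameter, so that facts about \<open>restrict_space\<close> enter only
  through a few transfer lemmas.\<close>

locale induced_system = gibbs_markov N F P J C \<beta> \<delta>
  for N :: "'a measure" and F :: "'a \<Rightarrow> 'a" and P J C \<beta> \<delta> +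
  fixes m \<mu> :: "'a measure" and \<Delta> :: "'a set" and f :: "'a \<Rightarrow> 'a" and R :: "'a \<Rightarrow> nat"
  assumes N_eq: "N = restrict_space m \<Delta>" and Delta_sets: "\<Delta> \<in> sets m"
    and f_measurable [measurable]: "f \<in> m \<rightarrow>\<^sub>M m"
    and R_measurable [measurable]: "R \<in> N \<rightarrow>\<^sub>M count_space UNIV"
    and R_pos: "x \<in> space N \<Longrightarrow> 1 \<le> R x"
    and R_integrable: "integrable N (\<lambda>x. real (R x))"
    and R_const: "\<lbrakk>\<omega> \<in> P; x \<in> \<omega>; y \<in> \<omega>\<rbrakk> \<Longrightarrow> R x = R y"
    and F_eq: "\<lbrakk>\<omega> \<in> P; x \<in> \<omega>\<rbrakk> \<Longrightarrow> F x = (f ^^ R x) x"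
    and ergodic: "ergodic_invariant_prob m f \<mu>"
    and ac: "absolutely_continuous m \<mu>" and mu_pos: "0 < measure \<mu> \<Delta>"
    and sep: "separability N F P" and aper: "aperiodic N F P"
begin

lemma sets_mu [measurable_cong]: "sets \<mu> = sets m"
  and mu_prob: "prob_space \<mu>" and mu_inv: "distr \<mu> \<mu> f = \<mu>"
  and mu_erg: "\<forall>A\<in>sets \<mu>. f -` A \<inter> space \<mu> = A \<longrightarrow> measure \<mu> A = 0 \<or> measure \<mu> A = 1"
  using ergodic by (auto simp: ergodic_invariant_prob_def)

lemma f_measurable_mu [measurable]: "f \<in> \<mu> \<rightarrow>\<^sub>M \<mu>"
  using f_measurable measurable_cong_sets[OF sets_mu sets_mu] by blast

lemma space_N: "space N = \<Delta>"
  using Delta_sets sets.sets_into_space by (auto simp: N_eq space_restrict_space)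

lemma space_mu: "space \<mu> = space m"
  by (rule sets_eq_imp_space_eq[OF sets_mu])

lemma measurable_N: "g \<in> m \<rightarrow>\<^sub>M M' \<Longrightarrow> g \<in> N \<rightarrow>\<^sub>M M'"
  unfolding N_eq by (rule measurable_restrict_space1)

lemma null_N_mu: "Z \<in> null_sets N \<Longrightarrow> Z \<in> null_sets \<mu>"
  using ac Delta_sets by (auto simp: N_eq null_sets_restrict_space absolutely_continuous_def)

lemma f_funpow_measurable [measurable]: "f ^^ n \<in> m \<rightarrow>\<^sub>M m"
  by (rule measurable_compose_n) measurable

lemma f_funpow_measurable_N [measurable]: "f ^^ n \<in> N \<rightarrow>\<^sub>M m"
  by (intro measurable_N f_funpow_measurable)

lemma birkhoff_sum_measurable_N [measurable]: "\<phi> \<in> borel_measurable m \<Longrightarrow> birkhoff_sum f \<phi> n \<in> borel_measurable N"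
  by (intro measurable_N birkhoff_sum_measurable) measurable

text \<open>The time of the \<open>k\<close>-th return to the base.\<close>

definition \<tau> :: "nat \<Rightarrow> 'a \<Rightarrow> nat" where
  "\<tau> k x = (\<Sum>i<k. R ((F ^^ i) x))"

lemma tau_0 [simp]: "\<tau> 0 x = 0" and tau_Suc: "\<tau> (Suc k) x = \<tau> k x + R ((F ^^ k) x)"
  by (simp_all add: \<tau>_def)

lemma tau_add: "\<tau> (k + l) x = \<tau> k x + \<tau> l ((F ^^ k) x)"
proof (induction l)
  case (Suc l)
  have "(F ^^ (k + l)) x = (F ^^ l) ((F ^^ k) x)" by (metis add.commute comp_apply funpow_add)
  with Suc show ?case by (simp add: tau_Suc)
qed simp

lemma tau_measurable [measurable]: "\<tau> k \<in> N \<rightarrow>\<^sub>M count_space UNIV"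
proof (induction k)
  case 0
  have "(\<lambda>x. 0::nat) \<in> N \<rightarrow>\<^sub>M count_space UNIV" by simp
  then show ?case by (simp cong: measurable_cong)
next
  case (Suc k)
  note Suc[measurable]
  have "(\<lambda>x. \<tau> k x + R ((F ^^ k) x)) \<in> N \<rightarrow>\<^sub>M count_space UNIV" by measurable
  then show ?case by (simp add: tau_Suc cong: measurable_cong)
qed

lemma tau_less: "x \<in> space N \<Longrightarrow> \<tau> k x < \<tau> (Suc k) x"
  using R_pos[OF funpow_space, of x k] by (simp add: tau_Suc)

lemma tau_strict_mono: "x \<in> space N \<Longrightarrow> strict_mono (\<lambda>k. \<tau> k x)"
  by (intro strict_monoI_Suc tau_less)

lemma tau_ge: "x \<in> space N \<Longrightarrow> k \<le> \<tau> k x"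
  using strict_mono_imp_increasing[OF tau_strict_mono] by blast

lemma F_iter:
  assumes "\<forall>i<k. (F ^^ i) x \<in> \<Union>P" shows "(F ^^ k) x = (f ^^ \<tau> k x) x"
  using assms
proof (induction k)
  case (Suc k)
  then obtain \<omega> where w: "\<omega> \<in> P" "(F ^^ k) x \<in> \<omega>" by auto
  have "(F ^^ Suc k) x = (f ^^ R ((F ^^ k) x)) ((F ^^ k) x)" using F_eq[OF w] by simp
  also have "\<dots> = (f ^^ (R ((F ^^ k) x) + \<tau> k x)) x" using Suc by (simp add: funpow_add)
  finally show ?case by (simp add: tau_Suc add.commute)
qed simp

lemma good_F_iter: "good x \<Longrightarrow> (F ^^ k) x = (f ^^ \<tau> k x) x"
  by (intro F_iter) (auto simp: good_def)

lemma tau_cyl: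
  assumes "ws \<in> words k" "x \<in> cyl ws" "y \<in> cyl ws" "i < k"
  shows "R ((F ^^ i) x) = R ((F ^^ i) y)"
  using assms words_nth[OF assms(1,4)] words_length[OF assms(1)]
  by (intro R_const[of "ws ! i"]) (auto simp: cyl_def)

lemma cylfun_tau: "cylfun k (\<tau> k)"
  unfolding cylfun_def \<tau>_def by (auto intro!: sum.cong tau_cyl)

lemma nn_integral_funpow_le:
  assumes "g \<in> borel_measurable N"
  shows "(\<integral>\<^sup>+x. g ((F ^^ n) x) \<partial>N) \<le> ennreal (K * measure N (space N)) * (\<integral>\<^sup>+x. g x \<partial>N)"
  using quasi_independence[OF assms, of "\<lambda>_. 1" n] K_pos
  by (simp add: cylfun_def emeasure_eq_measure ennreal_mult)

text \<open>Summed over \<open>j\<close>, the number of visits to \<open>A\<close> before the return to the base.\<close>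

definition visit :: "'a set \<Rightarrow> nat \<Rightarrow> 'a \<Rightarrow> ennreal" where
  "visit A j x = (if j < R x then indicator A ((f ^^ j) x) else 0)"

lemma visit_measurable [measurable]:
  assumes [measurable]: "A \<in> sets m" shows "visit A j \<in> borel_measurable N"
  unfolding visit_def by measurable

text \<open>At time \<open>i\<close> the orbit sits \<open>j\<close> steps after its \<open>q\<close>-th return, for exactly one pair \<open>(q, j)\<close>. The event
  \<open>\<tau> q x = i - j\<close> depends on the first \<open>q\<close> symbols and the visit on \<open>F\<^sup>q x\<close>, so quasi-independence
  splits them; for fixed \<open>j\<close> the events are disjoint in \<open>q\<close>, which keeps the bound uniform in \<open>i\<close>.\<close>

lemma occupation_bound:
  assumes A[measurable]: "A \<in> sets m"
  shows "(\<integral>\<^sup>+x. indicator A ((f ^^ i) x) \<partial>N) \<le> ennreal (K * measure N (space N)) * (\<integral>\<^sup>+x. (\<Sum>j. visit A j x) \<partial>N)"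
proof -
  define W where "W q j x = (if \<tau> q x + j = i then 1 else 0 :: ennreal)" for q j x
  have [measurable]: "W q j \<in> borel_measurable N" for q j unfolding W_def by measurable
  have cW: "cylfun q (W q j)" for q j
    using cylfun_tau[of q] unfolding cylfun_def W_def by metis
  have "(\<integral>\<^sup>+x. indicator A ((f ^^ i) x) \<partial>N) \<le> (\<integral>\<^sup>+x. (\<Sum>j\<le>i. \<Sum>q\<le>i. W q j x * visit A j ((F ^^ q) x)) \<partial>N)"
  proof (intro nn_integral_mono_AE, use AE_good AE_space in eventually_elim)
    fix x assume x: "good x" "x \<in> space N"
    define q where "q = Max {q. q \<le> i \<and> \<tau> q x \<le> i}"
    have fin: "finite {q. q \<le> i \<and> \<tau> q x \<le> i}" by (rule finite_subset[of _ "{..i}"]) auto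
    have qin: "q \<in> {q. q \<le> i \<and> \<tau> q x \<le> i}"
      unfolding q_def by (rule Max_in[OF fin]) (auto intro!: exI[of _ 0])
    have nxt: "i < \<tau> (Suc q) x"
    proof (rule ccontr)
      assume "\<not> ?thesis"
      moreover have "Suc q \<le> \<tau> (Suc q) x" using tau_ge[OF x(2)] .
      ultimately have "Suc q \<in> {q. q \<le> i \<and> \<tau> q x \<le> i}" by auto
      then have "Suc q \<le> q" unfolding q_def by (rule Max_ge[OF fin])
      then show False by simp
    qed
    define j where "j = i - \<tau> q x"
    have j: "\<tau> q x + j = i" "j < R ((F ^^ q) x)" "j \<le> i" "q \<le> i"
      using qin nxt by (auto simp: j_def tau_Suc)
    have "(f ^^ j) ((F ^^ q) x) = (f ^^ i) x"
      unfolding good_F_iter[OF x(1)] using j(1) by (metis add.commute comp_apply funpow_add)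
    then have "indicator A ((f ^^ i) x) = W q j x * visit A j ((F ^^ q) x)"
      using j by (simp add: W_def visit_def)
    also have "\<dots> \<le> (\<Sum>q\<le>i. W q j x * visit A j ((F ^^ q) x))"
      using j by (intro member_le_sum) auto
    also have "\<dots> \<le> (\<Sum>j\<le>i. \<Sum>q\<le>i. W q j x * visit A j ((F ^^ q) x))"
      using j by (intro member_le_sum[where f = "\<lambda>j. \<Sum>q\<le>i. W q j x * visit A j ((F ^^ q) x)"]) auto
    finally show "indicator A ((f ^^ i) x) \<le> (\<Sum>j\<le>i. \<Sum>q\<le>i. W q j x * visit A j ((F ^^ q) x))" .
  qed
  also have "\<dots> = (\<Sum>j\<le>i. \<Sum>q\<le>i. (\<integral>\<^sup>+x. W q j x * visit A j ((F ^^ q) x) \<partial>N))"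
    by (subst nn_integral_sum, measurable, intro sum.cong refl, subst nn_integral_sum) auto
  also have "\<dots> \<le> (\<Sum>j\<le>i. \<Sum>q\<le>i. ennreal K * (\<integral>\<^sup>+x. W q j x \<partial>N) * (\<integral>\<^sup>+x. visit A j x \<partial>N))"
    by (intro sum_mono quasi_independence cW) measurable
  also have "\<dots> = (\<Sum>j\<le>i. ennreal K * (\<integral>\<^sup>+x. (\<Sum>q\<le>i. W q j x) \<partial>N) * (\<integral>\<^sup>+x. visit A j x \<partial>N))"
    by (simp add: nn_integral_sum sum_distrib_left sum_distrib_right)
  also have "\<dots> \<le> (\<Sum>j\<le>i. ennreal K * ennreal (measure N (space N)) * (\<integral>\<^sup>+x. visit A j x \<partial>N))"
  proof (intro sum_mono mult_right_mono mult_left_mono)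
    fix j
    have "(\<integral>\<^sup>+x. (\<Sum>q\<le>i. W q j x) \<partial>N) \<le> (\<integral>\<^sup>+x. 1 \<partial>N)"
    proof (intro nn_integral_mono)
      fix x assume x: "x \<in> space N"
      have one: "q = q'" if "\<tau> q x + j = i" "\<tau> q' x + j = i" for q q'
        using strict_mono_eq[OF tau_strict_mono[OF x], of q q'] that by simp
      show "(\<Sum>q\<le>i. W q j x) \<le> 1"
      proof (cases "\<exists>q\<le>i. \<tau> q x + j = i")
        case True
        then obtain q where q: "q \<le> i" "\<tau> q x + j = i" by auto
        have "(\<Sum>q\<le>i. W q j x) = (\<Sum>q'\<le>i. if q' = q then 1 else 0)"
          using q one by (intro sum.cong) (auto simp: W_def)
        also have "\<dots> = 1" using q by (subst sum.delta) auto
        finally show ?thesis by simp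
      next
        case False
        then have "(\<Sum>q\<le>i. W q j x) = 0" by (intro sum.neutral) (auto simp: W_def)
        then show ?thesis by simp
      qed
    qed
    then show "(\<integral>\<^sup>+x. (\<Sum>q\<le>i. W q j x) \<partial>N) \<le> ennreal (measure N (space N))"
      by (simp add: emeasure_eq_measure)
  qed simp_all
  also have "\<dots> = ennreal (K * measure N (space N)) * (\<Sum>j\<le>i. (\<integral>\<^sup>+x. visit A j x \<partial>N))"
    using K_pos by (simp add: sum_distrib_left ennreal_mult)
  also have "\<dots> \<le> ennreal (K * measure N (space N)) * (\<Sum>j. (\<integral>\<^sup>+x. visit A j x \<partial>N))"
    by (intro mult_left_mono sum_le_suminf) auto
  also have "(\<Sum>j. (\<integral>\<^sup>+x. visit A j x \<partial>N)) = (\<integral>\<^sup>+x. (\<Sum>j. visit A j x) \<partial>N)"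
    by (intro nn_integral_suminf[symmetric]) measurable
  finally show ?thesis .
qed

lemma LIMSEQ_iff_nat:
  fixes u :: "nat \<Rightarrow> real"
  shows "u \<longlonglongrightarrow> l \<longleftrightarrow> (\<forall>j::nat. \<exists>n0. \<forall>n\<ge>n0. \<bar>u n - l\<bar> < 1 / real (Suc j))"
proof
  assume "u \<longlonglongrightarrow> l"
  then show "\<forall>j::nat. \<exists>n0. \<forall>n\<ge>n0. \<bar>u n - l\<bar> < 1 / real (Suc j)"
    by (auto simp: LIMSEQ_iff)
next
  assume h: "\<forall>j::nat. \<exists>n0. \<forall>n\<ge>n0. \<bar>u n - l\<bar> < 1 / real (Suc j)"
  show "u \<longlonglongrightarrow> l"
    unfolding LIMSEQ_iff
  proof (intro allI impI)
    fix r :: real assume "0 < r"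
    then obtain j where j: "1 / real (Suc j) < r"
      using reals_Archimedean[of r] by (auto simp: inverse_eq_divide)
    then show "\<exists>no. \<forall>n\<ge>no. norm (u n - l) < r" using h by (metis order_less_trans real_norm_def)
  qed
qed

lemma birkhoff_sum_average_shift:
  assumes lim: "(\<lambda>n. birkhoff_sum f \<phi> n x / real n) \<longlonglongrightarrow> l"
  shows "(\<lambda>n. birkhoff_sum f \<phi> n ((f ^^ r) x) / real n) \<longlonglongrightarrow> l"
proof -
  have 1: "(\<lambda>n. birkhoff_sum f \<phi> (n + r) x / real (n + r)) \<longlonglongrightarrow> l"
    using LIMSEQ_ignore_initial_segment[OF lim] .
  have 2: "(\<lambda>n. (real n + real r) / real n) \<longlonglongrightarrow> 1" by real_asymp
  have 3: "(\<lambda>n. birkhoff_sum f \<phi> r x / real n) \<longlonglongrightarrow> 0" by (rule lim_const_over_n)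
  have "(\<lambda>n. birkhoff_sum f \<phi> (n + r) x / real (n + r) * ((real n + real r) / real n) - birkhoff_sum f \<phi> r x / real n) \<longlonglongrightarrow> l * 1 - 0"
    by (intro tendsto_intros 1 2 3)
  moreover have "\<forall>\<^sub>F n in sequentially. birkhoff_sum f \<phi> (n + r) x / real (n + r) * ((real n + real r) / real n) - birkhoff_sum f \<phi> r x / real n
      = birkhoff_sum f \<phi> n ((f ^^ r) x) / real n"
    using eventually_gt_at_top[of 0]
  proof eventually_elim
    fix n :: nat assume n: "0 < n"
    have "birkhoff_sum f \<phi> (n + r) x = birkhoff_sum f \<phi> r x + birkhoff_sum f \<phi> n ((f ^^ r) x)"
      using birkhoff_sum_add[of f \<phi> r n x] by (simp add: add.commute)
    moreover have "s / real (n + r) * ((real n + real r) / real n) = s / real n" for s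
      using n by simp
    ultimately show "birkhoff_sum f \<phi> (n + r) x / real (n + r) * ((real n + real r) / real n) - birkhoff_sum f \<phi> r x / real n
      = birkhoff_sum f \<phi> n ((f ^^ r) x) / real n" by (metis add_diff_cancel_left' diff_divide_distrib)
  qed
  ultimately show ?thesis by (auto intro: Lim_transform_eventually)
qed

text \<open>The ergodic theorem yields convergence \<open>\<mu>\<close>-almost everywhere, hence on a subset of the base of positive
  \<open>N\<close>-measure because \<open>\<mu>\<close> charges the base and is absolutely continuous. Convergence is not affected by shifting the starting
  point, so this subset is forward invariant under \<open>F\<close> and ergodicity of \<open>F\<close> makes it full.\<close>

theorem birkhoff_N:
  assumes phi[measurable]: "\<phi> \<in> borel_measurable m" and B: "\<And>x. \<bar>\<phi> x\<bar> \<le> B"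
  shows "AE x in N. (\<lambda>n. birkhoff_sum f \<phi> n x / real n) \<longlonglongrightarrow> (\<integral>x. \<phi> x \<partial>\<mu>)"
proof -
  interpret mu: prob_space \<mu> by (rule mu_prob)
  let ?c = "\<integral>x. \<phi> x \<partial>\<mu>"
  define G where "G = {x\<in>space N. (\<lambda>n. birkhoff_sum f \<phi> n x / real n) \<longlonglongrightarrow> ?c}"
  have G[measurable]: "G \<in> sets N" unfolding G_def LIMSEQ_iff_nat by measurable
  have [measurable]: "\<phi> \<in> borel_measurable \<mu>" using phi measurable_cong_sets[OF sets_mu refl] by blast
  have bk: "AE x in \<mu>. (\<lambda>n. birkhoff_sum f \<phi> n x / real n) \<longlonglongrightarrow> ?c"
    by (rule mu.birkhoff[OF f_measurable_mu mu_inv mu_erg _ B]) measurable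
  have "0 < measure N G"
  proof (rule ccontr)
    assume "\<not> ?thesis"
    then have "G \<in> null_sets N" by (auto simp: null_sets_def emeasure_eq_measure zero_less_measure_iff)
    then have "G \<in> null_sets \<mu>" by (rule null_N_mu)
    from AE_not_in[OF this] bk have "AE x in \<mu>. x \<notin> \<Delta>"
      by eventually_elim (auto simp: G_def space_N)
    then have "\<Delta> \<in> null_sets \<mu>" using Delta_sets sets_mu by (subst AE_iff_null_sets) auto
    then show False using mu_pos by (simp add: measure_def null_sets_def)
  qed
  moreover have "AE x in N. x \<in> G \<longrightarrow> F x \<in> G"
    using AE_good
  proof eventually_elim
    fix x assume x: "good x"
    have "(F ^^ 0) x \<in> \<Union>P" using x unfolding good_def by blast
    then obtain \<omega> where w: "\<omega> \<in> P" "x \<in> \<omega>" by auto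
    show "x \<in> G \<longrightarrow> F x \<in> G"
      using birkhoff_sum_average_shift[of \<phi> x ?c "R x"] F_eq[OF w] measurable_space[OF F_measurable, of x]
      by (auto simp: G_def)
  qed
  ultimately have "AE x in N. x \<in> G" by (intro ergodic_F[OF sep aper G])
  then show ?thesis by eventually_elim (simp add: G_def)
qed

text \<open>By Fatou's lemma, since the time averages of \<open>indicator A\<close> converge to \<open>\<mu>(A)\<close> almost everywhere on the
  base and their integrals are controlled uniformly by \<open>occupation_bound\<close>.\<close>

theorem domination:
  assumes A[measurable]: "A \<in> sets m"
  shows "emeasure \<mu> A \<le> ennreal K * (\<integral>\<^sup>+x. (\<Sum>j. visit A j x) \<partial>N)"
proof -
  interpret mu: prob_space \<mu> by (rule mu_prob)
  let ?D = "ennreal (K * measure N (space N)) * (\<integral>\<^sup>+x. (\<Sum>j. visit A j x) \<partial>N)"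
  define u where "u n x = ennreal (birkhoff_sum f (indicator A) n x / real n)" for n x
  have [measurable]: "u n \<in> borel_measurable N" for n
    unfolding u_def by measurable
  have "AE x in N. (\<lambda>n. birkhoff_sum f (indicator A) n x / real n) \<longlonglongrightarrow> (\<integral>x. indicator A x \<partial>\<mu>)"
    by (rule birkhoff_N[where B = 1]) (auto simp: indicator_def)
  then have lim: "AE x in N. (\<lambda>n. u n x) \<longlonglongrightarrow> ennreal (measure \<mu> A)"
    by eventually_elim (use A sets_mu in \<open>auto simp: u_def intro!: tendsto_ennrealI\<close>)
  have ub: "(\<integral>\<^sup>+x. u n x \<partial>N) \<le> ?D" for n
  proof (cases "n = 0")
    case False
    have "u n x = ennreal (1 / real n) * (\<Sum>i<n. indicator A ((f ^^ i) x))" for x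
      by (simp add: u_def birkhoff_sum_def divide_inverse mult.commute ennreal_mult sum_nonneg sum_ennreal[symmetric] ennreal_indicator)
    then have "(\<integral>\<^sup>+x. u n x \<partial>N) = ennreal (1 / real n) * (\<Sum>i<n. (\<integral>\<^sup>+x. indicator A ((f ^^ i) x) \<partial>N))"
      by (simp add: nn_integral_cmult nn_integral_sum)
    also have "\<dots> \<le> ennreal (1 / real n) * (\<Sum>i<n. ?D)"
      by (intro mult_left_mono sum_mono occupation_bound) auto
    also have "\<dots> = (ennreal (1 / real n) * ennreal (real n)) * ?D"
      by (simp add: mult_ac ennreal_of_nat_eq_real_of_nat)
    also have "ennreal (1 / real n) * ennreal (real n) = 1"
      using False by (simp flip: ennreal_mult)
    finally show ?thesis by simp
  qed (simp add: u_def)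
  have "ennreal (measure N (space N)) * emeasure \<mu> A = (\<integral>\<^sup>+x. ennreal (measure \<mu> A) \<partial>N)"
    by (simp add: emeasure_eq_measure mu.emeasure_eq_measure mult.commute)
  also have "\<dots> = (\<integral>\<^sup>+x. liminf (\<lambda>n. u n x) \<partial>N)"
    using lim by (intro nn_integral_cong_AE) (auto elim!: eventually_mono dest: lim_imp_Liminf[rotated])
  also have "\<dots> \<le> liminf (\<lambda>n. \<integral>\<^sup>+x. u n x \<partial>N)"
    by (intro nn_integral_liminf) measurable
  also have "\<dots> \<le> liminf (\<lambda>n. ?D)"
    by (intro Liminf_mono always_eventually allI ub)
  also have "\<dots> = ?D" by (simp add: Liminf_const)
  also have "\<dots> = ennreal (measure N (space N)) * (ennreal K * (\<integral>\<^sup>+x. (\<Sum>j. visit A j x) \<partial>N))"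
    using K_pos by (simp add: ennreal_mult mult_ac)
  finally show ?thesis
    using space_pos by (subst (asm) ennreal_mult_le_mult_iff) auto
qed

end

section \<open>Block sums over returns and their cylinder envelopes\<close>

context induced_system begin

lemma R_nn_integral_finite: "(\<integral>\<^sup>+x. ennreal (real (R x)) \<partial>N) < \<infinity>"
  using R_integrable by (simp add: integrable_iff_bounded)

text \<open>Measures the failure of \<open>T\<close> to be bounded by \<open>t\<close>, and controls both uniform integrability and the large
  blocks.\<close>

definition tail_integral :: "('a \<Rightarrow> real) \<Rightarrow> real \<Rightarrow> ennreal" where
  "tail_integral T t = (\<integral>\<^sup>+x. ennreal (if t < T x then T x else 0) \<partial>N)"

lemma tail_integral_tendsto_0:
  assumes T: "integrable N T"
  shows "(\<lambda>n. tail_integral T (real n)) \<longlonglongrightarrow> 0"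
proof -
  have [measurable]: "T \<in> borel_measurable N" using T by auto
  have "(\<lambda>n. \<integral>\<^sup>+x. ennreal (if real n < T x then T x else 0) \<partial>N) \<longlonglongrightarrow> (\<integral>\<^sup>+x. 0 \<partial>N)"
  proof (rule nn_integral_dominated_convergence[where w = "\<lambda>x. ennreal (norm (T x))"])
    show "AE x in N. (\<lambda>n. ennreal (if real n < T x then T x else 0)) \<longlonglongrightarrow> 0"
    proof (intro AE_I2 tendsto_eventually)
      fix x
      obtain n0 :: nat where "T x < real n0" using reals_Archimedean2 by blast
      then show "\<forall>\<^sub>F n in sequentially. ennreal (if real n < T x then T x else 0) = 0"
        by (auto simp: eventually_sequentially intro!: exI[of _ n0])
    qed
    show "(\<integral>\<^sup>+x. ennreal (norm (T x)) \<partial>N) < \<infinity>" using T by (simp add: integrable_iff_bounded)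
  qed (auto intro!: AE_I2 ennreal_leI)
  then show ?thesis by (simp add: tail_integral_def)
qed

lemma tail_integral_small:
  assumes T: "integrable N T" and e: "0 < e"
  obtains M :: nat where "0 < M" "tail_integral T (real M) \<le> ennreal e"
proof -
  have "\<forall>\<^sub>F n in sequentially. tail_integral T (real n) < ennreal e"
    using tail_integral_tendsto_0[OF T] e by (intro order_tendstoD) auto
  then have "\<forall>\<^sub>F n in sequentially. tail_integral T (real n) < ennreal e \<and> 0 < n"
    using eventually_gt_at_top[of 0] by eventually_elim auto
  then show thesis using that by (auto simp: eventually_sequentially intro: less_imp_le)
qed

text \<open>The factor by which \<open>F\<^sup>n\<close> can increase integrals with respect to \<open>N\<close>, for every \<open>n\<close>.\<close>

definition KN :: real where "KN = K * measure N (space N)"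

lemma KN_pos: "0 < KN" using K_pos space_pos by (simp add: KN_def)

text \<open>The sum of \<open>\<phi>\<close> along the orbit of \<open>f\<close> up to the \<open>k\<close>-th return.\<close>

definition return_sum :: "('a \<Rightarrow> real) \<Rightarrow> nat \<Rightarrow> 'a \<Rightarrow> real" where
  "return_sum \<phi> k x = birkhoff_sum f \<phi> (\<tau> k x) x"

lemma return_sum_measurable [measurable]:
  assumes [measurable]: "\<phi> \<in> borel_measurable m"
  shows "return_sum \<phi> k \<in> borel_measurable N"
proof -
  have "(\<lambda>x. birkhoff_sum f \<phi> (\<tau> k x) x) \<in> borel_measurable N"
    by (rule measurable_compose_countable[OF _ tau_measurable]) measurable
  then show ?thesis by (simp add: return_sum_def cong: measurable_cong)
qed

lemma return_sum_bound: "(\<And>x. \<bar>\<phi> x\<bar> \<le> B) \<Longrightarrow> \<bar>return_sum \<phi> k x\<bar> \<le> B * real (\<tau> k x)"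
  unfolding return_sum_def by (rule birkhoff_sum_bound)

text \<open>Along the times \<open>\<tau> k x\<close> the averages \<open>return_sum \<phi> k x / \<tau> k x\<close> tend to \<open>0\<close> almost everywhere and stay
  bounded, while \<open>\<tau> k / k\<close> is uniformly integrable: it is an average of functions \<open>R \<circ> F\<^sup>i\<close> whose tails are
  all bounded by that of \<open>R\<close>.\<close>

lemma return_sum_mean_small:
  assumes phi[measurable]: "\<phi> \<in> borel_measurable m" and B: "\<And>x. \<bar>\<phi> x\<bar> \<le> B"
    and zero: "(\<integral>x. \<phi> x \<partial>\<mu>) = 0" and e: "0 < e"
  shows "\<forall>\<^sub>F k in sequentially. (\<integral>\<^sup>+x. ennreal \<bar>return_sum \<phi> k x\<bar> \<partial>N) \<le> ennreal (e * real k)"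
proof -
  have B0: "0 \<le> B" using B[of undefined] by linarith
  have e': "0 < e / (2 * (B + 1) * KN)" using e B0 KN_pos by simp
  obtain M :: nat where M: "0 < M" "tail_integral (\<lambda>x. real (R x)) (real M) \<le> ennreal (e / (2 * (B + 1) * KN))"
    by (rule tail_integral_small[OF R_integrable e']) blast
  define \<rho> where "\<rho> k x = \<bar>return_sum \<phi> k x / real (\<tau> k x)\<bar>" for k x
  have [measurable]: "\<rho> k \<in> borel_measurable N" for k unfolding \<rho>_def by measurable
  have rB: "\<rho> k x \<le> B" for k x
  proof (cases "\<tau> k x = 0")
    case False
    then show ?thesis using return_sum_bound[where k = k and x = x, OF B] by (simp add: \<rho>_def abs_divide divide_le_eq)
  qed (simp add: \<rho>_def B0)
  have "(\<lambda>k. \<integral>\<^sup>+x. ennreal (\<rho> k x) \<partial>N) \<longlonglongrightarrow> (\<integral>\<^sup>+x. 0 \<partial>N)"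
  proof (rule nn_integral_dominated_convergence[where w = "\<lambda>x. ennreal B"])
    show "AE x in N. (\<lambda>k. ennreal (\<rho> k x)) \<longlonglongrightarrow> 0"
      using birkhoff_N[OF phi B] AE_space[of N]
    proof eventually_elim
      fix x assume lim: "(\<lambda>n. birkhoff_sum f \<phi> n x / real n) \<longlonglongrightarrow> (\<integral>x. \<phi> x \<partial>\<mu>)" and x: "x \<in> space N"
      have "filterlim (\<lambda>k. \<tau> k x) at_top sequentially"
        using tau_strict_mono[OF x] by (rule filterlim_subseq)
      from filterlim_compose[OF lim this] have "(\<lambda>k. return_sum \<phi> k x / real (\<tau> k x)) \<longlonglongrightarrow> 0"
        by (simp add: return_sum_def zero)
      then have "(\<lambda>k. \<rho> k x) \<longlonglongrightarrow> 0" unfolding \<rho>_def by (rule tendsto_rabs_zero)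
      from tendsto_ennrealI[OF this] show "(\<lambda>k. ennreal (\<rho> k x)) \<longlonglongrightarrow> 0" by simp
    qed
    show "AE x in N. ennreal (\<rho> k x) \<le> ennreal B" for k
      using rB by (auto intro!: ennreal_leI)
    show "(\<integral>\<^sup>+x. ennreal B \<partial>N) < \<infinity>" by (simp add: emeasure_eq_measure ennreal_mult_less_top)
  qed measurable
  then have "(\<lambda>k. \<integral>\<^sup>+x. ennreal (\<rho> k x) \<partial>N) \<longlonglongrightarrow> 0" by simp
  then have "\<forall>\<^sub>F k in sequentially. (\<integral>\<^sup>+x. ennreal (\<rho> k x) \<partial>N) < ennreal (e / (2 * real M))"
    using e M(1) by (intro order_tendstoD) auto
  then show ?thesis
  proof eventually_elim
    fix k assume small: "(\<integral>\<^sup>+x. ennreal (\<rho> k x) \<partial>N) < ennreal (e / (2 * real M))"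
    define t where "t x = (if real M < real (R x) then real (R x) else 0)" for x
    have [measurable]: "t \<in> borel_measurable N" unfolding t_def by measurable
    have "(\<integral>\<^sup>+x. ennreal \<bar>return_sum \<phi> k x\<bar> \<partial>N)
      \<le> (\<integral>\<^sup>+x. ennreal (real M * real k) * ennreal (\<rho> k x) + ennreal B * (\<Sum>i<k. ennreal (t ((F ^^ i) x))) \<partial>N)"
    proof (intro nn_integral_mono)
      fix x assume x: "x \<in> space N"
      have t0: "0 \<le> t y" for y by (simp add: t_def)
      have "real (\<tau> k x) = (\<Sum>i<k. real (R ((F ^^ i) x)))" by (simp add: \<tau>_def)
      also have "\<dots> \<le> (\<Sum>i<k. real M + t ((F ^^ i) x))" by (intro sum_mono) (auto simp: t_def)
      finally have tb: "real (\<tau> k x) \<le> real M * real k + (\<Sum>i<k. t ((F ^^ i) x))"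
        by (simp add: sum.distrib mult.commute)
      have r0: "0 \<le> \<rho> k x" by (simp add: \<rho>_def)
      have "\<bar>return_sum \<phi> k x\<bar> = \<rho> k x * real (\<tau> k x)"
        by (cases "\<tau> k x = 0") (auto simp: \<rho>_def return_sum_def abs_divide)
      also have "\<dots> \<le> \<rho> k x * (real M * real k + (\<Sum>i<k. t ((F ^^ i) x)))"
        by (intro mult_left_mono tb r0)
      also have "\<dots> \<le> real M * real k * \<rho> k x + B * (\<Sum>i<k. t ((F ^^ i) x))"
        using mult_right_mono[OF rB[of k x], of "\<Sum>i<k. t ((F ^^ i) x)"] t0
        by (simp add: algebra_simps sum_nonneg)
      finally have "ennreal \<bar>return_sum \<phi> k x\<bar> \<le> ennreal (real M * real k * \<rho> k x + B * (\<Sum>i<k. t ((F ^^ i) x)))"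
        by (rule ennreal_leI)
      also have "\<dots> = ennreal (real M * real k) * ennreal (\<rho> k x) + ennreal B * (\<Sum>i<k. ennreal (t ((F ^^ i) x)))"
        using r0 B0 t0 by (simp add: ennreal_plus ennreal_mult sum_nonneg sum_ennreal)
      finally show "ennreal \<bar>return_sum \<phi> k x\<bar> \<le> ennreal (real M * real k) * ennreal (\<rho> k x) + ennreal B * (\<Sum>i<k. ennreal (t ((F ^^ i) x)))" .
    qed
    also have "\<dots> = ennreal (real M * real k) * (\<integral>\<^sup>+x. ennreal (\<rho> k x) \<partial>N)
        + ennreal B * (\<Sum>i<k. (\<integral>\<^sup>+x. ennreal (t ((F ^^ i) x)) \<partial>N))"
      by (simp add: nn_integral_add nn_integral_cmult nn_integral_sum)
    also have "\<dots> \<le> ennreal (real M * real k) * ennreal (e / (2 * real M))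
        + ennreal B * (\<Sum>i<k. ennreal KN * ennreal (e / (2 * (B + 1) * KN)))"
    proof (intro add_mono mult_left_mono sum_mono)
      fix i
      have "(\<integral>\<^sup>+x. ennreal (t ((F ^^ i) x)) \<partial>N) \<le> ennreal KN * (\<integral>\<^sup>+x. ennreal (t x) \<partial>N)"
        unfolding KN_def by (rule nn_integral_funpow_le) measurable
      also have "(\<integral>\<^sup>+x. ennreal (t x) \<partial>N) = tail_integral (\<lambda>x. real (R x)) (real M)"
        by (simp add: tail_integral_def t_def)
      also have "ennreal KN * \<dots> \<le> ennreal KN * ennreal (e / (2 * (B + 1) * KN))"
        by (intro mult_left_mono M) auto
      finally show "(\<integral>\<^sup>+x. ennreal (t ((F ^^ i) x)) \<partial>N) \<le> ennreal KN * ennreal (e / (2 * (B + 1) * KN))" .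
      qed (use small in \<open>simp_all add: less_imp_le\<close>)
    also have "\<dots> = ennreal (real M * real k * (e / (2 * real M)) + B * (real k * (KN * (e / (2 * (B + 1) * KN)))))"
    proof -
      have gen: "ennreal p * ennreal q + ennreal r * (of_nat k * (ennreal s * ennreal t)) = ennreal (p * q + r * (real k * (s * t)))"
        if "0 \<le> p" "0 \<le> q" "0 \<le> r" "0 \<le> s" "0 \<le> t" for p q r s t :: real
        using that by (simp add: ennreal_plus ennreal_mult ennreal_of_nat_eq_real_of_nat)
      show ?thesis
        unfolding sum_constant card_lessThan using e e' B0 KN_pos by (intro gen) (auto intro: less_imp_le)
    qed
    also have "\<dots> \<le> ennreal (e * real k)"
    proof (intro ennreal_leI)
      have "real M * real k * (e / (2 * real M)) = e / 2 * real k" using M(1) by simp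
      moreover have "B * (real k * (KN * (e / (2 * (B + 1) * KN)))) = (B / (B + 1)) * (e / 2 * real k)"
      proof -
        have "KN * (e / (2 * (B + 1) * KN)) = e / (2 * (B + 1))" using KN_pos by simp
        then have "B * (real k * (KN * (e / (2 * (B + 1) * KN)))) = B * (real k * (e / (2 * (B + 1))))" by (simp only:)
        then show ?thesis by (simp add: mult.commute)
      qed
      moreover have "(B / (B + 1)) * (e / 2 * real k) \<le> 1 * (e / 2 * real k)"
        using e B0 by (intro mult_right_mono) (auto simp: field_simps)
      ultimately show "real M * real k * (e / (2 * real M)) + B * (real k * (KN * (e / (2 * (B + 1) * KN)))) \<le> e * real k"
        by linarith
    qed
    finally show "(\<integral>\<^sup>+x. ennreal \<bar>return_sum \<phi> k x\<bar> \<partial>N) \<le> ennreal (e * real k)" .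
  qed
qed

lemma cylfun_measurable:
  fixes W :: "'a \<Rightarrow> real"
  assumes W: "cylfun n W" and off: "\<And>x. x \<in> space N - \<Union>(cyl ` words n) \<Longrightarrow> W x = c"
  shows "W \<in> borel_measurable N"
proof (rule measurable_piecewise_restrict[of "insert (space N - \<Union>(cyl ` words n)) (cyl ` words n)"])
  have U: "\<Union>(cyl ` words n) \<in> sets N"
    using countable_words by (intro sets.countable_UN') (auto intro: cyl_sets)
  show "countable (insert (space N - \<Union>(cyl ` words n)) (cyl ` words n))"
    using countable_words by auto
  show "space N \<subseteq> \<Union>(insert (space N - \<Union>(cyl ` words n)) (cyl ` words n))" by auto
  fix \<Omega> assume Om: "\<Omega> \<in> insert (space N - \<Union>(cyl ` words n)) (cyl ` words n)"
  then show "\<Omega> \<inter> space N \<in> sets N" using U by (auto intro: cyl_sets)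
  have "\<exists>c. \<forall>x\<in>\<Omega>. W x = c"
    using Om
  proof
    assume "\<Omega> \<in> cyl ` words n"
    then obtain ws where "ws \<in> words n" "\<Omega> = cyl ws" by auto
    then show ?thesis using W unfolding cylfun_def by blast
  next
    assume "\<Omega> = space N - \<Union>(cyl ` words n)"
    then show ?thesis using off by auto
  qed
  then obtain c where c: "\<And>x. x \<in> \<Omega> \<Longrightarrow> W x = c" by blast
  have "(\<lambda>_. c) \<in> borel_measurable (restrict_space N \<Omega>)" by simp
  then show "W \<in> borel_measurable (restrict_space N \<Omega>)"
    by (rule measurable_cong[THEN iffD1, rotated]) (simp add: space_restrict_space c)
qed

text \<open>A bound for the oscillation of \<open>return_sum\<close> on a \<open>k\<close>-cylinder: the \<open>i\<close>-th excursion has \<open>R (F\<^sup>i x)\<close> terms,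
  along which points that agree for \<open>k - i\<close> more symbols differ by at most \<open>c \<theta>\<^bsup>k-i\<^esup>\<close>.\<close>

definition varsum :: "real \<Rightarrow> real \<Rightarrow> nat \<Rightarrow> 'a \<Rightarrow> real" where
  "varsum c \<theta> k x = (\<Sum>i<k. c * real (R ((F ^^ i) x)) * \<theta> ^ (k - i))"

definition same_cyl :: "nat \<Rightarrow> 'a \<Rightarrow> 'a set" where
  "same_cyl k x = {y. \<exists>ws\<in>words k. x \<in> cyl ws \<and> y \<in> cyl ws}"

text \<open>The infimum over the cylinder, corrected by the oscillation, is an upper bound that depends on the
  cylinder only. Taking the infimum keeps the integral comparable with that of \<open>return_sum\<close>.\<close>

definition envelope :: "real \<Rightarrow> real \<Rightarrow> ('a \<Rightarrow> real) \<Rightarrow> nat \<Rightarrow> 'a \<Rightarrow> real" where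
  "envelope c \<theta> \<phi> k x = Inf ((\<lambda>y. \<bar>return_sum \<phi> k y\<bar>) ` same_cyl k x) + varsum c \<theta> k x"

text \<open>What remains of Hoelder continuity and expansion: \<open>\<phi>\<close> oscillates geometrically little, uniformly along
  one excursion, on pairs of points with a long common itinerary.\<close>

definition variation_bound :: "real \<Rightarrow> real \<Rightarrow> ('a \<Rightarrow> real) \<Rightarrow> bool" where
  "variation_bound c \<theta> \<phi> \<longleftrightarrow> 0 \<le> c \<and> 0 < \<theta> \<and> \<theta> < 1 \<and>
     (\<forall>\<omega>\<in>P. \<forall>x\<in>\<omega>. \<forall>y\<in>\<omega>. \<forall>n. \<forall>j<R x. enat n \<le> separation_time F P x y \<longrightarrow>
        \<bar>\<phi> ((f ^^ j) x) - \<phi> ((f ^^ j) y)\<bar> \<le> c * \<theta> ^ n)"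

lemma return_sum_eq_sum:
  assumes "\<forall>i<k. (F ^^ i) x \<in> \<Union>P"
  shows "return_sum \<phi> k x = (\<Sum>i<k. birkhoff_sum f \<phi> (R ((F ^^ i) x)) ((F ^^ i) x))"
  using assms
proof (induction k)
  case (Suc k)
  have "return_sum \<phi> (Suc k) x = return_sum \<phi> k x + birkhoff_sum f \<phi> (R ((F ^^ k) x)) ((f ^^ \<tau> k x) x)"
    by (simp add: return_sum_def tau_Suc birkhoff_sum_add)
  also have "(f ^^ \<tau> k x) x = (F ^^ k) x" using Suc.prems by (intro F_iter[symmetric]) auto
  finally show ?case using Suc by simp
qed (simp add: return_sum_def)

lemma return_sum_variation:
  assumes v: "variation_bound c \<theta> \<phi>" and ws: "ws \<in> words k" "x \<in> cyl ws" "y \<in> cyl ws"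
  shows "\<bar>return_sum \<phi> k x - return_sum \<phi> k y\<bar> \<le> varsum c \<theta> k x"
proof -
  have l: "length ws = k" using ws(1) by (rule words_length)
  have mem: "(F ^^ i) x \<in> ws ! i" "(F ^^ i) y \<in> ws ! i" "ws ! i \<in> P" if "i < k" for i
    using ws that l words_nth[OF ws(1) that] by (auto simp: cyl_def)
  have eq: "return_sum \<phi> k x - return_sum \<phi> k y = (\<Sum>i<k. birkhoff_sum f \<phi> (R ((F ^^ i) x)) ((F ^^ i) x) - birkhoff_sum f \<phi> (R ((F ^^ i) y)) ((F ^^ i) y))"
    using mem by (subst (1 2) return_sum_eq_sum) (auto simp: sum_subtractf)
  have "\<bar>return_sum \<phi> k x - return_sum \<phi> k y\<bar> \<le> (\<Sum>i<k. \<bar>birkhoff_sum f \<phi> (R ((F ^^ i) x)) ((F ^^ i) x) - birkhoff_sum f \<phi> (R ((F ^^ i) y)) ((F ^^ i) y)\<bar>)"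
    unfolding eq by (rule sum_abs)
  also have "\<dots> \<le> (\<Sum>i<k. c * real (R ((F ^^ i) x)) * \<theta> ^ (k - i))"
  proof (intro sum_mono)
    fix i assume "i \<in> {..<k}"
    then have i: "i < k" by simp
    let ?x = "(F ^^ i) x" and ?y = "(F ^^ i) y"
    have sep: "enat (k - i) \<le> separation_time F P ?x ?y"
    proof (rule separation_time_ge, intro allI impI)
      fix j assume j: "j < k - i"
      have *: "(F ^^ j) ((F ^^ i) z) = (F ^^ (i + j)) z" for z
        by (metis add.commute comp_apply funpow_add)
      have ij: "i + j < k" using j by linarith
      show "\<exists>\<omega>\<in>P. (F ^^ j) ?x \<in> \<omega> \<and> (F ^^ j) ?y \<in> \<omega>"
        unfolding * using mem[OF ij] by (intro bexI[of _ "ws ! (i + j)"] conjI)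
    qed
    have RR: "R ?x = R ?y" by (rule tau_cyl[OF ws i])
    have "\<bar>birkhoff_sum f \<phi> (R ?x) ?x - birkhoff_sum f \<phi> (R ?y) ?y\<bar> = \<bar>\<Sum>j<R ?x. \<phi> ((f ^^ j) ?x) - \<phi> ((f ^^ j) ?y)\<bar>"
      by (simp add: birkhoff_sum_def RR sum_subtractf)
    also have "\<dots> \<le> (\<Sum>j<R ?x. \<bar>\<phi> ((f ^^ j) ?x) - \<phi> ((f ^^ j) ?y)\<bar>)" by (rule sum_abs)
    also have "\<dots> \<le> (\<Sum>j<R ?x. c * \<theta> ^ (k - i))"
      using v mem[OF i] sep unfolding variation_bound_def by (intro sum_mono) blast
    finally show "\<bar>birkhoff_sum f \<phi> (R ?x) ?x - birkhoff_sum f \<phi> (R ?y) ?y\<bar> \<le> c * real (R ?x) * \<theta> ^ (k - i)"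
      by (simp add: mult_ac)
  qed
  finally show ?thesis by (simp add: varsum_def)
qed

lemma same_cyl_eq: "ws \<in> words k \<Longrightarrow> x \<in> cyl ws \<Longrightarrow> same_cyl k x = cyl ws"
  unfolding same_cyl_def using cyl_unique by blast

lemma varsum_bounds:
  assumes v: "variation_bound c \<theta> \<phi>" shows "0 \<le> varsum c \<theta> k x" "varsum c \<theta> k x \<le> c * real (\<tau> k x)"
proof -
  have c: "0 \<le> c" "0 < \<theta>" "\<theta> < 1" using v by (auto simp: variation_bound_def)
  show "0 \<le> varsum c \<theta> k x" unfolding varsum_def using c by (intro sum_nonneg) auto
  have "varsum c \<theta> k x \<le> (\<Sum>i<k. c * real (R ((F ^^ i) x)) * 1)"
    unfolding varsum_def using c by (intro sum_mono mult_left_mono power_le_one) auto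
  also have "\<dots> = c * real (\<tau> k x)" by (simp add: \<tau>_def sum_distrib_left)
  finally show "varsum c \<theta> k x \<le> c * real (\<tau> k x)" .
qed

lemma envelope_cyl:
  assumes v: "variation_bound c \<theta> \<phi>" and ws: "ws \<in> words k" "x \<in> cyl ws"
  shows "\<bar>return_sum \<phi> k x\<bar> \<le> envelope c \<theta> \<phi> k x" "envelope c \<theta> \<phi> k x \<le> \<bar>return_sum \<phi> k x\<bar> + varsum c \<theta> k x"
    "0 \<le> envelope c \<theta> \<phi> k x"
proof -
  have eq: "same_cyl k x = cyl ws" by (rule same_cyl_eq[OF ws])
  have "\<bar>return_sum \<phi> k x\<bar> - varsum c \<theta> k x \<le> Inf ((\<lambda>y. \<bar>return_sum \<phi> k y\<bar>) ` cyl ws)"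
  proof (rule cINF_greatest)
    show "cyl ws \<noteq> {}" using ws by auto
    fix y assume "y \<in> cyl ws"
    then show "\<bar>return_sum \<phi> k x\<bar> - varsum c \<theta> k x \<le> \<bar>return_sum \<phi> k y\<bar>"
      using return_sum_variation[OF v ws(1) ws(2), of y] by linarith
  qed
  then show 1: "\<bar>return_sum \<phi> k x\<bar> \<le> envelope c \<theta> \<phi> k x" by (simp add: envelope_def eq)
  then show "0 \<le> envelope c \<theta> \<phi> k x" by linarith
  have "Inf ((\<lambda>y. \<bar>return_sum \<phi> k y\<bar>) ` cyl ws) \<le> \<bar>return_sum \<phi> k x\<bar>"
    by (rule cINF_lower[OF _ ws(2)]) (auto intro!: bdd_belowI[of _ 0])
  then show "envelope c \<theta> \<phi> k x \<le> \<bar>return_sum \<phi> k x\<bar> + varsum c \<theta> k x" by (simp add: envelope_def eq)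
qed

lemma cylfun_envelope: "cylfun k (envelope c \<theta> \<phi> k)"
  unfolding cylfun_def envelope_def varsum_def by (auto simp: same_cyl_eq intro!: sum.cong tau_cyl)

lemma varsum_measurable [measurable]: "varsum c \<theta> k \<in> borel_measurable N"
  unfolding varsum_def by measurable

lemma envelope_measurable [measurable]: "envelope c \<theta> \<phi> k \<in> borel_measurable N"
proof -
  have "(\<lambda>x. Inf ((\<lambda>y. \<bar>return_sum \<phi> k y\<bar>) ` same_cyl k x)) \<in> borel_measurable N"
  proof (rule cylfun_measurable[where n = k and c = "Inf {}"])
    show "cylfun k (\<lambda>x. Inf ((\<lambda>y. \<bar>return_sum \<phi> k y\<bar>) ` same_cyl k x))"
      unfolding cylfun_def by (auto simp: same_cyl_eq)
    fix x assume "x \<in> space N - \<Union>(cyl ` words k)"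
    then have "same_cyl k x = {}" by (auto simp: same_cyl_def)
    then show "Inf ((\<lambda>y. \<bar>return_sum \<phi> k y\<bar>) ` same_cyl k x) = Inf {}" by simp
  qed
  then show ?thesis unfolding envelope_def by measurable
qed

lemma envelope_le_tau:
  assumes v: "variation_bound c \<theta> \<phi>" and B: "\<And>x. \<bar>\<phi> x\<bar> \<le> B" and x: "good x" "x \<in> space N"
  shows "\<bar>return_sum \<phi> k x\<bar> \<le> envelope c \<theta> \<phi> k x" "0 \<le> envelope c \<theta> \<phi> k x"
    "envelope c \<theta> \<phi> k x \<le> (B + c) * real (\<tau> k x)"
    "envelope c \<theta> \<phi> k x \<le> \<bar>return_sum \<phi> k x\<bar> + varsum c \<theta> k x"
proof -
  obtain ws where ws: "ws \<in> words k" "x \<in> cyl ws" using good_in_cyl[OF x] by blast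
  show "\<bar>return_sum \<phi> k x\<bar> \<le> envelope c \<theta> \<phi> k x" "0 \<le> envelope c \<theta> \<phi> k x"
    "envelope c \<theta> \<phi> k x \<le> \<bar>return_sum \<phi> k x\<bar> + varsum c \<theta> k x"
    using envelope_cyl[OF v ws] by auto
  then show "envelope c \<theta> \<phi> k x \<le> (B + c) * real (\<tau> k x)"
    using return_sum_bound[of \<phi> B k x] B varsum_bounds[OF v, of k x] by (simp add: algebra_simps)
qed

text \<open>Independent of \<open>k\<close>, since the weights \<open>\<theta>\<^bsup>k-i\<^esup>\<close> form a geometric series and each \<open>R \<circ> F\<^sup>i\<close> has integral
  at most \<open>KN\<close> times that of \<open>R\<close>. So the passage to the envelope costs nothing at the scale \<open>k\<close>.\<close>

lemma varsum_integral:
  assumes v: "variation_bound c \<theta> \<phi>"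
  shows "(\<integral>\<^sup>+x. ennreal (varsum c \<theta> k x) \<partial>N) \<le> ennreal (c * KN * (\<integral>x. real (R x) \<partial>N) / (1 - \<theta>))"
proof -
  have c: "0 \<le> c" "0 < \<theta>" "\<theta> < 1" using v by (auto simp: variation_bound_def)
  let ?r = "\<integral>x. real (R x) \<partial>N"
  have r: "(\<integral>\<^sup>+x. ennreal (real (R x)) \<partial>N) = ennreal ?r"
    using R_integrable by (intro nn_integral_eq_integral) auto
  have r0: "0 \<le> ?r" by (intro integral_nonneg_AE) auto
  have "(\<integral>\<^sup>+x. ennreal (varsum c \<theta> k x) \<partial>N) = (\<integral>\<^sup>+x. (\<Sum>i<k. ennreal (c * \<theta> ^ (k - i)) * ennreal (real (R ((F ^^ i) x)))) \<partial>N)"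
  proof (intro nn_integral_cong)
    fix x
    have "(\<Sum>i<k. ennreal (c * \<theta> ^ (k - i)) * ennreal (real (R ((F ^^ i) x))))
      = (\<Sum>i<k. ennreal (c * real (R ((F ^^ i) x)) * \<theta> ^ (k - i)))"
      using c by (intro sum.cong refl) (simp add: ennreal_mult[symmetric] mult.assoc mult.commute)
    also have "\<dots> = ennreal (varsum c \<theta> k x)"
      unfolding varsum_def using c by (intro sum_ennreal) auto
    finally show "ennreal (varsum c \<theta> k x) = (\<Sum>i<k. ennreal (c * \<theta> ^ (k - i)) * ennreal (real (R ((F ^^ i) x))))" ..
  qed
  also have "\<dots> = (\<Sum>i<k. ennreal (c * \<theta> ^ (k - i)) * (\<integral>\<^sup>+x. ennreal (real (R ((F ^^ i) x))) \<partial>N))"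
  proof (subst nn_integral_sum)
    show "(\<lambda>x. ennreal (c * \<theta> ^ (k - i)) * ennreal (real (R ((F ^^ i) x)))) \<in> borel_measurable N" for i
      by measurable
    show "(\<Sum>i<k. \<integral>\<^sup>+x. ennreal (c * \<theta> ^ (k - i)) * ennreal (real (R ((F ^^ i) x))) \<partial>N)
      = (\<Sum>i<k. ennreal (c * \<theta> ^ (k - i)) * (\<integral>\<^sup>+x. ennreal (real (R ((F ^^ i) x))) \<partial>N))"
      by (intro sum.cong refl nn_integral_cmult) measurable
  qed
  also have "\<dots> \<le> (\<Sum>i<k. ennreal (c * \<theta> ^ (k - i)) * (ennreal KN * ennreal ?r))"
    unfolding r[symmetric] KN_def by (intro sum_mono mult_left_mono nn_integral_funpow_le) auto
  also have "\<dots> = ennreal (c * KN * ?r * (\<Sum>i<k. \<theta> ^ (k - i)))"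
  proof -
    have "ennreal (c * \<theta> ^ (k - i)) * (ennreal KN * ennreal ?r) = ennreal (c * KN * ?r * \<theta> ^ (k - i))" for i
      using c KN_pos r0 by (simp add: ennreal_mult[symmetric] mult.assoc mult.left_commute mult.commute)
    then show ?thesis using c KN_pos r0 by (simp add: sum_distrib_left)
  qed
  also have "\<dots> \<le> ennreal (c * KN * ?r * (1 / (1 - \<theta>)))"
  proof (intro ennreal_leI mult_left_mono)
    have "(\<Sum>i<k. \<theta> ^ (k - i)) \<le> (\<Sum>i<k. \<theta> ^ (k - Suc i))"
      using c by (intro sum_mono power_decreasing) auto
    also have "\<dots> = (\<Sum>i<k. \<theta> ^ i)" by (rule sum.nat_diff_reindex)
    also have "\<dots> = (1 - \<theta> ^ k) / (1 - \<theta>)" using c by (simp add: sum_gp_strict)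
    also have "\<dots> \<le> 1 / (1 - \<theta>)" using c by (intro divide_right_mono) auto
    finally show "(\<Sum>i<k. \<theta> ^ (k - i)) \<le> 1 / (1 - \<theta>)" .
  qed (use c KN_pos r0 in auto)
  finally show ?thesis by simp
qed

theorem envelope_mean_small:
  assumes v: "variation_bound c \<theta> \<phi>"
    and phi[measurable]: "\<phi> \<in> borel_measurable m" and B: "\<And>x. \<bar>\<phi> x\<bar> \<le> B"
    and zero: "(\<integral>x. \<phi> x \<partial>\<mu>) = 0" and e: "0 < e"
  shows "\<forall>\<^sub>F k in sequentially. (\<integral>\<^sup>+x. ennreal (envelope c \<theta> \<phi> k x) \<partial>N) \<le> ennreal (e * real k)"
proof -
  let ?v = "c * KN * (\<integral>x. real (R x) \<partial>N) / (1 - \<theta>)"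
  have c: "0 \<le> c" "\<theta> < 1" using v by (auto simp: variation_bound_def)
  have v0: "0 \<le> ?v" using c KN_pos by (intro divide_nonneg_nonneg mult_nonneg_nonneg integral_nonneg_AE) auto
  have "\<forall>\<^sub>F k in sequentially. (\<integral>\<^sup>+x. ennreal \<bar>return_sum \<phi> k x\<bar> \<partial>N) \<le> ennreal (e / 2 * real k)"
    using e by (intro return_sum_mean_small[OF phi B zero]) auto
  moreover have "\<forall>\<^sub>F k in sequentially. ?v \<le> e / 2 * real k"
  proof -
    obtain n0 :: nat where n0: "?v / (e / 2) < real n0" using reals_Archimedean2 by blast
    have "?v \<le> e / 2 * real k" if "n0 \<le> k" for k
    proof -
      have "?v / (e / 2) \<le> real k" using n0 that by linarith
      then have "?v \<le> real k * (e / 2)" using e by (subst (asm) pos_divide_le_eq) auto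
      then show ?thesis by (simp only: mult.commute)
    qed
    then show ?thesis by (auto simp: eventually_sequentially)
  qed
  ultimately show ?thesis
  proof eventually_elim
    fix k assume 1: "(\<integral>\<^sup>+x. ennreal \<bar>return_sum \<phi> k x\<bar> \<partial>N) \<le> ennreal (e / 2 * real k)" and 2: "?v \<le> e / 2 * real k"
    have "(\<integral>\<^sup>+x. ennreal (envelope c \<theta> \<phi> k x) \<partial>N) \<le> (\<integral>\<^sup>+x. ennreal \<bar>return_sum \<phi> k x\<bar> + ennreal (varsum c \<theta> k x) \<partial>N)"
    proof (intro nn_integral_mono_AE, use AE_good AE_space in eventually_elim)
      fix x assume x: "good x" "x \<in> space N"
      show "ennreal (envelope c \<theta> \<phi> k x) \<le> ennreal \<bar>return_sum \<phi> k x\<bar> + ennreal (varsum c \<theta> k x)"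
        using envelope_le_tau(4)[OF v B x, of k] varsum_bounds(1)[OF v, of k x]
        by (simp add: ennreal_plus[symmetric] ennreal_leI del: ennreal_plus)
    qed
    also have "\<dots> = (\<integral>\<^sup>+x. ennreal \<bar>return_sum \<phi> k x\<bar> \<partial>N) + (\<integral>\<^sup>+x. ennreal (varsum c \<theta> k x) \<partial>N)"
      by (intro nn_integral_add) measurable
    also have "\<dots> \<le> ennreal (e / 2 * real k) + ennreal (e / 2 * real k)"
      using 1 order_trans[OF varsum_integral[OF v, of k] ennreal_leI[OF 2]] by (rule add_mono)
    also have "\<dots> = ennreal (e * real k)" using e by (simp add: ennreal_plus[symmetric] del: ennreal_plus)
    finally show "(\<integral>\<^sup>+x. ennreal (envelope c \<theta> \<phi> k x) \<partial>N) \<le> ennreal (e * real k)" .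
  qed
qed

end

section \<open>Exponential moments of block sums\<close>

context gibbs_markov begin

lemma cyl_drop:
  assumes ws: "ws \<in> words n" "x \<in> cyl ws" and le: "i + k \<le> n"
  shows "take k (drop i ws) \<in> words k \<and> (F ^^ i) x \<in> cyl (take k (drop i ws))"
proof -
  have l: "length ws = n" using ws(1) by (rule words_length)
  have "set ws \<subseteq> P" using ws(1) by (auto simp: words_def)
  then have "set (take k (drop i ws)) \<subseteq> P"
    using set_take_subset[of k "drop i ws"] set_drop_subset[of i ws] by blast
  then have "take k (drop i ws) \<in> words k" using l le by (auto simp: words_def)
  moreover have "(F ^^ i) x \<in> cyl (take k (drop i ws))"
  proof -
    have "(F ^^ j) ((F ^^ i) x) \<in> ws ! (i + j)" if j: "j < k" for j
    proof -
      have "(F ^^ j) ((F ^^ i) x) = (F ^^ (i + j)) x" by (metis add.commute comp_apply funpow_add)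
      then show ?thesis using ws(2) l le j by (auto simp: cyl_def)
    qed
    then show ?thesis using ws(2) l le by (auto simp: cyl_def intro: funpow_space)
  qed
  ultimately show ?thesis by simp
qed

lemma cylfun_compose_funpow:
  assumes W: "cylfun k W" and le: "i + k \<le> n" shows "cylfun n (\<lambda>x. W ((F ^^ i) x))"
  unfolding cylfun_def
proof (intro ballI)
  fix ws x y assume a: "ws \<in> words n" "x \<in> cyl ws" "y \<in> cyl ws"
  show "W ((F ^^ i) x) = W ((F ^^ i) y)"
    using cyl_drop[OF a(1,2) le] cyl_drop[OF a(1,3) le] W unfolding cylfun_def by blast
qed

text \<open>Conditioning on the past: the first \<open>Q\<close> factors depend on \<open>k Q\<close> symbols, so the next factor \<open>1 + h\<close>
  contributes at most \<open>1 + K \<integral>h\<close>. Writing the factor as \<open>1 + h\<close> confines the constant \<open>K\<close> to the small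
  part; otherwise it would be raised to the power \<open>Q\<close>.\<close>

lemma product_bound:
  fixes h :: "'a \<Rightarrow> ennreal"
  assumes [measurable]: "h \<in> borel_measurable N" and h: "cylfun k h"
  shows "(\<integral>\<^sup>+x. (\<Prod>j<Q. 1 + h ((F ^^ (k * j)) x)) \<partial>N)
    \<le> ennreal (measure N (space N)) * (1 + ennreal K * (\<integral>\<^sup>+x. h x \<partial>N)) ^ Q"
proof (induction Q)
  case 0 then show ?case by (simp add: emeasure_eq_measure)
next
  case (Suc Q)
  define W where "W x = (\<Prod>j<Q. 1 + h ((F ^^ (k * j)) x))" for x
  have [measurable]: "W \<in> borel_measurable N" unfolding W_def by measurable
  have cW: "cylfun (k * Q) W"
    unfolding cylfun_def
  proof (intro ballI)
    fix ws x y assume a: "ws \<in> words (k * Q)" "x \<in> cyl ws" "y \<in> cyl ws"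
    show "W x = W y"
      unfolding W_def
    proof (intro prod.cong refl)
      fix j assume "j \<in> {..<Q}"
      then have "k * Suc j \<le> k * Q" by (intro mult_le_mono2) auto
      then have "k * j + k \<le> k * Q" by simp
      from cylfun_compose_funpow[OF h this] a
      have "h ((F ^^ (k * j)) x) = h ((F ^^ (k * j)) y)" unfolding cylfun_def by blast
      then show "1 + h ((F ^^ (k * j)) x) = 1 + h ((F ^^ (k * j)) y)" by simp
    qed
  qed
  have "(\<integral>\<^sup>+x. (\<Prod>j<Suc Q. 1 + h ((F ^^ (k * j)) x)) \<partial>N) = (\<integral>\<^sup>+x. W x + W x * h ((F ^^ (k * Q)) x) \<partial>N)"
    by (intro nn_integral_cong) (simp add: W_def distrib_left)
  also have "\<dots> = (\<integral>\<^sup>+x. W x \<partial>N) + (\<integral>\<^sup>+x. W x * h ((F ^^ (k * Q)) x) \<partial>N)"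
    by (intro nn_integral_add) measurable
  also have "\<dots> \<le> (\<integral>\<^sup>+x. W x \<partial>N) + ennreal K * (\<integral>\<^sup>+x. W x \<partial>N) * (\<integral>\<^sup>+x. h x \<partial>N)"
    by (intro add_left_mono quasi_independence cW) measurable
  also have "\<dots> = (\<integral>\<^sup>+x. W x \<partial>N) * (1 + ennreal K * (\<integral>\<^sup>+x. h x \<partial>N))"
    by (simp add: distrib_left mult_ac)
  also have "\<dots> \<le> (ennreal (measure N (space N)) * (1 + ennreal K * (\<integral>\<^sup>+x. h x \<partial>N)) ^ Q) * (1 + ennreal K * (\<integral>\<^sup>+x. h x \<partial>N))"
    using Suc by (intro mult_right_mono) (auto simp: W_def)
  finally show ?case by (simp only: mult_ac power_Suc)
qed

end

lemma exp_minus_one_le: "exp u - 1 \<le> u * exp (u::real)"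
proof -
  have "1 - u \<le> exp (- u)" using exp_ge_add_one_self[of "- u"] by simp
  then have "(1 - u) * exp u \<le> exp (- u) * exp u" by (intro mult_right_mono) auto
  then show ?thesis by (simp add: algebra_simps exp_minus)
qed

context induced_system begin

text \<open>Chernoff's inequality for the blocks truncated at \<open>L\<close>. With \<open>e\<^sup>u - 1 \<le> u e\<^sup>u\<close>, values of \<open>U\<close> up to \<open>M\<close>
  contribute at most \<open>2 lam \<integral>U\<close> to the exponential moment, and larger ones at most
  \<open>lam e\<^bsup>lam L\<^esup>\<close> times a tail integral; the hypotheses leave a quarter of the exponent.\<close>

lemma large_sum_bound:
  fixes U T :: "'a \<Rightarrow> real" and n :: real
  assumes U[measurable]: "U \<in> borel_measurable N" and cU: "cylfun k U"
    and T[measurable]: "T \<in> borel_measurable N"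
    and UT: "AE x in N. 0 \<le> U x \<and> U x \<le> T x"
    and k: "real Q * real k \<le> n" and lam: "0 < lam" and L: "0 \<le> L" and M: "lam * M \<le> 1 / 2" and gam: "0 < \<gamma>"
    and meanU: "(\<integral>\<^sup>+x. ennreal (U x) \<partial>N) \<le> ennreal (\<gamma> / (4 * K) * real k)"
    and tailT: "ennreal (exp (lam * L)) * tail_integral T M \<le> ennreal (\<gamma> / (4 * K) * real k)"
  shows "measure N {x\<in>space N. \<gamma> * n \<le> (\<Sum>j<Q. min (U ((F ^^ (k * j)) x)) L)}
    \<le> measure N (space N) * exp (- (lam * \<gamma> * n / 4))"
proof -
  define h where "h x = ennreal (exp (lam * min (U x) L) - 1)" for x
  have [measurable]: "h \<in> borel_measurable N" unfolding h_def by measurable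
  have ch: "cylfun k h" using cU unfolding cylfun_def h_def by metis
  have "(\<integral>\<^sup>+x. h x \<partial>N) \<le> (\<integral>\<^sup>+x. ennreal lam * (2 * ennreal (U x) + ennreal (exp (lam * L)) * ennreal (if M < T x then T x else 0)) \<partial>N)"
  proof (intro nn_integral_mono_AE, use UT in eventually_elim)
    fix x assume x: "0 \<le> U x \<and> U x \<le> T x"
    let ?u = "lam * min (U x) L"
    have u: "0 \<le> ?u" using x lam L by auto
    have "exp ?u - 1 \<le> ?u * exp ?u" by (rule exp_minus_one_le)
    also have "\<dots> \<le> (lam * U x) * exp ?u"
      using lam by (intro mult_right_mono mult_left_mono) auto
    also have "\<dots> \<le> lam * (2 * U x + exp (lam * L) * (if M < T x then T x else 0))"
    proof (cases "U x \<le> M")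
      case True
      have "?u \<le> lam * M" using lam True by (intro mult_left_mono) auto
      then have "exp ?u \<le> exp (1 / 2)" using M by (subst exp_le_cancel_iff) linarith
      then have "exp ?u \<le> 2" using exp_half_le2 by linarith
      then have "(lam * U x) * exp ?u \<le> (lam * U x) * 2" using lam x by (intro mult_left_mono) auto
      also have "\<dots> \<le> lam * (2 * U x + exp (lam * L) * (if M < T x then T x else 0))"
      proof -
        have "0 \<le> exp (lam * L) * (if M < T x then T x else 0)" using x by simp
        then have "U x * 2 \<le> 2 * U x + exp (lam * L) * (if M < T x then T x else 0)" by linarith
        then show ?thesis unfolding mult.assoc using lam by (intro mult_left_mono) auto
      qed
      finally show ?thesis .
    next
      case False
      have "exp ?u \<le> exp (lam * L)" using lam by (auto intro!: mult_left_mono)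
      then have "(lam * U x) * exp ?u \<le> (lam * T x) * exp (lam * L)" using lam x by (intro mult_mono) auto
      also have "\<dots> \<le> lam * (2 * U x + exp (lam * L) * (if M < T x then T x else 0))"
      proof -
        have "(lam * T x) * exp (lam * L) = lam * (exp (lam * L) * T x)" by (simp only: mult_ac)
        also have "\<dots> \<le> lam * (2 * U x + exp (lam * L) * T x)"
          using lam x by (intro mult_left_mono) auto
        finally show ?thesis using False x by simp
      qed
      finally show ?thesis .
    qed
    finally have "h x \<le> ennreal (lam * (2 * U x + exp (lam * L) * (if M < T x then T x else 0)))"
      unfolding h_def by (rule ennreal_leI)
    also have "\<dots> = ennreal lam * (2 * ennreal (U x) + ennreal (exp (lam * L)) * ennreal (if M < T x then T x else 0))"
      using lam x by (simp add: ennreal_mult ennreal_plus)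
    finally show "h x \<le> ennreal lam * (2 * ennreal (U x) + ennreal (exp (lam * L)) * ennreal (if M < T x then T x else 0))" .
  qed
  also have "\<dots> = ennreal lam * (2 * (\<integral>\<^sup>+x. ennreal (U x) \<partial>N) + ennreal (exp (lam * L)) * tail_integral T M)"
    unfolding tail_integral_def by (simp add: nn_integral_cmult nn_integral_add)
  also have "\<dots> \<le> ennreal lam * (2 * ennreal (\<gamma> / (4 * K) * real k) + ennreal (\<gamma> / (4 * K) * real k))"
    by (intro mult_left_mono add_mono meanU tailT) auto
  also have "\<dots> = ennreal (lam * (3 * \<gamma> / (4 * K)) * real k)"
  proof -
    have g: "ennreal lam * (2 * ennreal y + ennreal y) = ennreal (lam * (3 * y))" if "0 \<le> y" for y
    proof -
      have "2 * ennreal y + ennreal y = ennreal (3 * y)"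
      proof -
        have "2 * ennreal y + ennreal y = ennreal (2 * y) + ennreal y" using that by (simp add: ennreal_mult)
        also have "\<dots> = ennreal (2 * y + y)" using that by (intro ennreal_plus[symmetric]) auto
        finally show ?thesis by simp
      qed
      then show ?thesis using lam that by (simp add: ennreal_mult)
    qed
    have "0 \<le> \<gamma> / (4 * K) * real k" using gam K_pos by simp
    from g[OF this] show ?thesis by (simp add: mult_ac)
  qed
  finally have hI: "(\<integral>\<^sup>+x. h x \<partial>N) \<le> ennreal (lam * (3 * \<gamma> / (4 * K)) * real k)" .
  define y where "y = K * (lam * (3 * \<gamma> / (4 * K)) * real k)"
  have y: "y = lam * (3 * \<gamma> / 4) * real k" "0 \<le> y"
    using K_pos lam gam by (auto simp: y_def)
  have "(\<integral>\<^sup>+x. (\<Prod>j<Q. 1 + h ((F ^^ (k * j)) x)) \<partial>N) \<le> ennreal (measure N (space N)) * (1 + ennreal K * (\<integral>\<^sup>+x. h x \<partial>N)) ^ Q"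
    by (rule product_bound[OF _ ch]) measurable
  also have "\<dots> \<le> ennreal (measure N (space N)) * (1 + ennreal K * ennreal (lam * (3 * \<gamma> / (4 * K)) * real k)) ^ Q"
    using hI by (intro mult_left_mono power_mono add_left_mono) auto
  also have "1 + ennreal K * ennreal (lam * (3 * \<gamma> / (4 * K)) * real k) = ennreal (1 + y)"
  proof -
    have "ennreal K * ennreal (lam * (3 * \<gamma> / (4 * K)) * real k) = ennreal y"
      unfolding y_def using K_pos lam gam by (intro ennreal_mult[symmetric]) auto
    then show ?thesis using y(2) by (simp add: ennreal_plus)
  qed
  also have "ennreal (measure N (space N)) * ennreal (1 + y) ^ Q = ennreal (measure N (space N) * (1 + y) ^ Q)"
    using y(2) by (subst ennreal_mult) (auto simp: ennreal_power[symmetric] simp del: ennreal_plus)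
  finally have prodI: "(\<integral>\<^sup>+x. (\<Prod>j<Q. 1 + h ((F ^^ (k * j)) x)) \<partial>N) \<le> ennreal (measure N (space N) * (1 + y) ^ Q)" .
  have "(1 + y) ^ Q \<le> exp y ^ Q" using y(2) exp_ge_add_one_self[of y] by (intro power_mono) auto
  also have "\<dots> = exp (real Q * y)" by (simp add: exp_of_nat_mult)
  also have "\<dots> \<le> exp (lam * (3 * \<gamma> / 4) * n)"
  proof -
    have "real Q * y = lam * (3 * \<gamma> / 4) * (real Q * real k)" by (simp add: y(1))
    also have "\<dots> \<le> lam * (3 * \<gamma> / 4) * n" using k lam gam by (intro mult_left_mono) auto
    finally show ?thesis by simp
  qed
  finally have pw: "(1 + y) ^ Q \<le> exp (lam * (3 * \<gamma> / 4) * n)" .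
  define A where "A = {x\<in>space N. \<gamma> * n \<le> (\<Sum>j<Q. min (U ((F ^^ (k * j)) x)) L)}"
  have [measurable]: "A \<in> sets N" unfolding A_def by measurable
  have UTn: "AE x in N. \<forall>j. 0 \<le> U ((F ^^ (k * j)) x)"
  proof (subst AE_all_countable, intro allI)
    fix j show "AE x in N. 0 \<le> U ((F ^^ (k * j)) x)"
      using AE_compose_funpow[OF UT, of "k * j"] by eventually_elim simp
  qed
  have "ennreal (exp (lam * \<gamma> * n)) * emeasure N A = (\<integral>\<^sup>+x. ennreal (exp (lam * \<gamma> * n)) * indicator A x \<partial>N)"
    by (simp add: nn_integral_cmult_indicator)
  also have "\<dots> \<le> (\<integral>\<^sup>+x. (\<Prod>j<Q. 1 + h ((F ^^ (k * j)) x)) \<partial>N)"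
  proof (intro nn_integral_mono_AE, use UTn in eventually_elim)
    fix x assume x: "\<forall>j. 0 \<le> U ((F ^^ (k * j)) x)"
    have "1 + h ((F ^^ (k * j)) x) = ennreal (exp (lam * min (U ((F ^^ (k * j)) x)) L))" for j
    proof -
      have "0 \<le> lam * min (U ((F ^^ (k * j)) x)) L" using x lam L by auto
      then have "1 \<le> exp (lam * min (U ((F ^^ (k * j)) x)) L)" by simp
      then have "ennreal 1 + ennreal (exp (lam * min (U ((F ^^ (k * j)) x)) L) - 1) = ennreal (exp (lam * min (U ((F ^^ (k * j)) x)) L))"
        by (subst ennreal_plus[symmetric]) auto
      then show ?thesis by (simp add: h_def)
    qed
    then have "(\<Prod>j<Q. 1 + h ((F ^^ (k * j)) x)) = ennreal (exp (lam * (\<Sum>j<Q. min (U ((F ^^ (k * j)) x)) L)))"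
      by (simp add: prod_ennreal exp_sum[symmetric] sum_distrib_left)
    moreover have "exp (lam * \<gamma> * n) \<le> exp (lam * (\<Sum>j<Q. min (U ((F ^^ (k * j)) x)) L))" if "x \<in> A"
      using that lam by (auto simp: A_def mult.assoc intro!: mult_left_mono)
    ultimately show "ennreal (exp (lam * \<gamma> * n)) * indicator A x \<le> (\<Prod>j<Q. 1 + h ((F ^^ (k * j)) x))"
      by (auto simp: indicator_def intro!: ennreal_leI)
  qed
  also note prodI
  finally have "ennreal (exp (lam * \<gamma> * n) * measure N A) \<le> ennreal (measure N (space N) * (1 + y) ^ Q)"
    by (simp add: emeasure_eq_measure ennreal_mult)
  then have "exp (lam * \<gamma> * n) * measure N A \<le> measure N (space N) * (1 + y) ^ Q"
    using y(2) by (subst (asm) ennreal_le_iff) auto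
  also have "\<dots> \<le> measure N (space N) * exp (lam * (3 * \<gamma> / 4) * n)"
    by (intro mult_left_mono pw) auto
  finally have "measure N A \<le> measure N (space N) * exp (lam * (3 * \<gamma> / 4) * n) / exp (lam * \<gamma> * n)"
    by (simp add: field_simps)
  also have "\<dots> = measure N (space N) * exp (lam * (3 * \<gamma> / 4) * n - lam * \<gamma> * n)" by (simp only: exp_diff times_divide_eq_right)
  also have "lam * (3 * \<gamma> / 4) * n - lam * \<gamma> * n = - (lam * \<gamma> * n / 4)" by (simp add: algebra_simps)
  finally show ?thesis by (simp add: A_def)
qed

end

section \<open>Deviations of Birkhoff sums\<close>

context induced_system begin

lemma return_sum_block_sum:
  assumes x: "good x"
  shows "return_sum \<phi> (k * q) x = (\<Sum>j<q. return_sum \<phi> k ((F ^^ (k * j)) x))"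
proof (induction q)
  case 0 show ?case by (simp add: return_sum_def)
next
  case (Suc q)
  have "return_sum \<phi> (k * Suc q) x = birkhoff_sum f \<phi> (\<tau> (k * q) x + \<tau> k ((F ^^ (k * q)) x)) x"
    by (simp add: return_sum_def tau_add add.commute[of k])
  also have "\<dots> = return_sum \<phi> (k * q) x + return_sum \<phi> k ((F ^^ (k * q)) x)"
    by (simp add: return_sum_def birkhoff_sum_add good_F_iter[OF x, of "k * q"])
  finally show ?case using Suc by simp
qed

text \<open>A sum up to an arbitrary time is split at the last completed block of \<open>k\<close> returns. There are at most
  \<open>n div k\<close> completed blocks because each return takes at least one unit of time, and the unfinished
  block is bounded by its length.\<close>

lemma partial_sum_bound:
  assumes x: "good x" "x \<in> space N" and k: "0 < k" and n': "n' \<le> n"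
    and B: "\<And>x. \<bar>\<phi> x\<bar> \<le> B"
    and exU: "\<And>y. good y \<Longrightarrow> y \<in> space N \<Longrightarrow> \<bar>return_sum \<phi> k y\<bar> \<le> U y \<and> 0 \<le> U y \<and> U y \<le> T y \<and> B * real (\<tau> k y) \<le> T y"
    and T: "\<And>j. j \<le> n div k \<Longrightarrow> T ((F ^^ (k * j)) x) \<le> L"
    and S: "(\<Sum>j<n div k. min (U ((F ^^ (k * j)) x)) L) \<le> s"
  shows "\<bar>birkhoff_sum f \<phi> n' x\<bar> \<le> s + L"
proof -
  define q where "q = Max {q. \<tau> (k * q) x \<le> n'}"
  have qk: "q \<le> k * q" for q using k by simp
  have sub: "q \<le> n div k" if "\<tau> (k * q) x \<le> n'" for q
  proof -
    have "k * q \<le> n" using tau_ge[OF x(2), of "k * q"] that n' by linarith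
    then show ?thesis using k by (simp add: less_eq_div_iff_mult_less_eq mult.commute)
  qed
  have fin: "finite {q. \<tau> (k * q) x \<le> n'}" by (rule finite_subset[of _ "{..n div k}"]) (auto intro: sub)
  have "q \<in> {q. \<tau> (k * q) x \<le> n'}" unfolding q_def by (rule Max_in[OF fin]) (auto intro!: exI[of _ 0])
  then have q: "\<tau> (k * q) x \<le> n'" by simp
  have nxt: "n' < \<tau> (k * Suc q) x"
  proof (rule ccontr)
    assume "\<not> ?thesis"
    then have "Suc q \<le> q" unfolding q_def by (intro Max_ge[OF fin]) auto
    then show False by simp
  qed
  let ?y = "\<lambda>j. (F ^^ (k * j)) x"
  have y: "good (?y j)" "?y j \<in> space N" for j using good_funpow[OF x(1)] funpow_space[OF x(2)] by auto
  define r where "r = n' - \<tau> (k * q) x"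
  have "\<tau> (k * Suc q) x = \<tau> (k * q) x + \<tau> k (?y q)" by (simp add: tau_add add.commute[of k])
  then have r: "n' = \<tau> (k * q) x + r" "r \<le> \<tau> k (?y q)" using q nxt by (auto simp: r_def)
  have "birkhoff_sum f \<phi> n' x = return_sum \<phi> (k * q) x + birkhoff_sum f \<phi> r (?y q)"
    unfolding r(1) birkhoff_sum_add return_sum_def good_F_iter[OF x(1), of "k * q"] ..
  moreover have "\<bar>birkhoff_sum f \<phi> r (?y q)\<bar> \<le> L"
  proof -
    have B0: "0 \<le> B" using B[of x] by linarith
    have "\<bar>birkhoff_sum f \<phi> r (?y q)\<bar> \<le> B * real r" by (rule birkhoff_sum_bound[OF B])
    also have "\<dots> \<le> B * real (\<tau> k (?y q))" using r(2) B0 by (intro mult_left_mono) auto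
    also have "\<dots> \<le> T (?y q)" using exU[OF y] by blast
    also have "\<dots> \<le> L" by (rule T[OF sub[OF q]])
    finally show ?thesis .
  qed
  moreover have "\<bar>return_sum \<phi> (k * q) x\<bar> \<le> s"
  proof -
    have "\<bar>return_sum \<phi> (k * q) x\<bar> \<le> (\<Sum>j<q. \<bar>return_sum \<phi> k (?y j)\<bar>)"
      unfolding return_sum_block_sum[OF x(1)] by (rule sum_abs)
    also have "\<dots> \<le> (\<Sum>j<q. U (?y j))" using exU[OF y] by (intro sum_mono) blast
    also have "\<dots> \<le> (\<Sum>j<n div k. U (?y j))" using sub[OF q] exU[OF y] by (intro sum_mono2) auto
    also have "\<dots> = (\<Sum>j<n div k. min (U (?y j)) L)"
    proof (intro sum.cong refl)
      fix j assume "j \<in> {..<n div k}"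
      then have "U (?y j) \<le> L" using exU[OF y, of j] T[of j] by force
      then show "U (?y j) = min (U (?y j)) L" by simp
    qed
    finally show ?thesis using S by linarith
  qed
  ultimately show ?thesis by linarith
qed

text \<open>By domination, a deviation under \<open>\<mu>\<close> starts from a point \<open>f\<^sup>j x\<close> with \<open>x\<close> in the base and \<open>j < R x\<close>.
  Either \<open>R x\<close> is of order \<open>n\<close>, which costs a tail integral of \<open>R\<close>, or the deviation is visible from
  \<open>F x\<close> on. The latter event is quasi-independent of \<open>R x\<close>, so summing over \<open>j < R x\<close> costs only the
  factor \<open>\<integral>R\<close> rather than a power of \<open>n\<close>.\<close>

theorem deviation_bound:
  assumes v: "variation_bound c \<theta> \<phi>"
    and phi[measurable]: "\<phi> \<in> borel_measurable m" and B: "\<And>x. \<bar>\<phi> x\<bar> \<le> B" and B1: "0 < B"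
    and gam: "0 < \<gamma>" and k: "0 < k" and lam: "0 < lam" and M: "lam * M \<le> 1 / 2"
    and L: "0 \<le> L" "L \<le> \<gamma> * real n"
    and meanU: "(\<integral>\<^sup>+x. ennreal (envelope c \<theta> \<phi> k x) \<partial>N) \<le> ennreal (\<gamma> / (4 * K) * real k)"
    and tailT: "ennreal (exp (lam * L)) * tail_integral (\<lambda>x. (B + c) * real (\<tau> k x)) M \<le> ennreal (\<gamma> / (4 * K) * real k)"
  shows "emeasure \<mu> {x\<in>space m. 3 * \<gamma> * real n < \<bar>birkhoff_sum f \<phi> n x\<bar>}
    \<le> ennreal K * (tail_integral (\<lambda>x. real (R x)) (\<gamma> * real n / B)
       + ennreal (K * (\<integral>x. real (R x) \<partial>N) * (KN * ((real n + 1) * measure N {x\<in>space N. L < (B + c) * real (\<tau> k x)})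
           + measure N (space N) * exp (- (lam * \<gamma> * real n / 4)))))"
proof -
  define Bad where "Bad = {x\<in>space m. 3 * \<gamma> * real n < \<bar>birkhoff_sum f \<phi> n x\<bar>}"
  have [measurable]: "Bad \<in> sets m" unfolding Bad_def by measurable
  have c0: "0 \<le> c" using v by (simp add: variation_bound_def)
  let ?U = "envelope c \<theta> \<phi> k" and ?T = "\<lambda>x. (B + c) * real (\<tau> k x)" and ?Q = "n div k"
  have exU: "\<bar>return_sum \<phi> k y\<bar> \<le> ?U y \<and> 0 \<le> ?U y \<and> ?U y \<le> ?T y \<and> B * real (\<tau> k y) \<le> ?T y"
    if "good y" "y \<in> space N" for y
    using envelope_le_tau[OF v B that, of k] c0 by (auto simp: mult_right_mono)
  have Tm[measurable]: "?T \<in> borel_measurable N" by measurable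
  define E1 where "E1 = (\<Union>j\<le>?Q. {x\<in>space N. L < ?T ((F ^^ (k * j)) x)})"
  define E2 where "E2 = {x\<in>space N. \<gamma> * real n \<le> (\<Sum>j<?Q. min (?U ((F ^^ (k * j)) x)) L)}"
  define E where "E = E1 \<union> E2"
  have mE1: "{x\<in>space N. L < ?T ((F ^^ (k * j)) x)} \<in> sets N" for j by measurable
  have [measurable]: "E1 \<in> sets N" unfolding E1_def using mE1 by (intro sets.finite_UN) auto
  have [measurable]: "E2 \<in> sets N" unfolding E2_def by measurable
  have [measurable]: "E \<in> sets N" unfolding E_def by measurable
  have tail_j: "measure N {x\<in>space N. L < ?T ((F ^^ i) x)} \<le> KN * measure N {x\<in>space N. L < ?T x}" for i
  proof -
    have "emeasure N {x\<in>space N. L < ?T ((F ^^ i) x)} = (\<integral>\<^sup>+x. indicator {x\<in>space N. L < ?T x} ((F ^^ i) x) \<partial>N)"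
      by (subst nn_integral_indicator[symmetric], measurable, intro nn_integral_cong) (auto simp: indicator_def funpow_space)
    also have "\<dots> \<le> ennreal (K * measure N (space N)) * (\<integral>\<^sup>+x. indicator {x\<in>space N. L < ?T x} x \<partial>N)"
      by (rule nn_integral_funpow_le) measurable
    also have "(\<integral>\<^sup>+x. indicator {x\<in>space N. L < ?T x} x \<partial>N) = emeasure N {x\<in>space N. L < ?T x}"
      by (rule nn_integral_indicator) measurable
    finally have "ennreal (measure N {x\<in>space N. L < ?T ((F ^^ i) x)}) \<le> ennreal (KN * measure N {x\<in>space N. L < ?T x})"
      using KN_pos by (simp add: emeasure_eq_measure ennreal_mult KN_def)
    then show ?thesis using KN_pos by (subst (asm) ennreal_le_iff) auto
  qed
  have "measure N E1 \<le> (\<Sum>j\<le>?Q. measure N {x\<in>space N. L < ?T ((F ^^ (k * j)) x)})"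
    unfolding E1_def using mE1 by (intro finite_measure_subadditive_finite) auto
  also have "\<dots> \<le> (\<Sum>j\<le>?Q. KN * measure N {x\<in>space N. L < ?T x})"
    by (intro sum_mono tail_j)
  also have "\<dots> = (real ?Q + 1) * (KN * measure N {x\<in>space N. L < ?T x})" by simp
  also have "\<dots> \<le> (real n + 1) * (KN * measure N {x\<in>space N. L < ?T x})"
    using KN_pos by (intro mult_right_mono) auto
  finally have E1: "measure N E1 \<le> KN * ((real n + 1) * measure N {x\<in>space N. L < ?T x})" by (simp add: mult_ac)
  have "real ?Q * real k = real (?Q * k)" by simp
  also have "\<dots> \<le> real n" unfolding of_nat_le_iff by (rule div_times_less_eq_dividend)
  finally have Qk: "real ?Q * real k \<le> real n" .
  have UT: "AE x in N. 0 \<le> ?U x \<and> ?U x \<le> ?T x"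
    using AE_good AE_space[of N] by eventually_elim (use exU in blast)
  have E2: "measure N E2 \<le> measure N (space N) * exp (- (lam * \<gamma> * real n / 4))"
    unfolding E2_def
    by (rule large_sum_bound[OF envelope_measurable cylfun_envelope Tm UT Qk lam L(1) M gam meanU tailT])
  have "measure N E \<le> measure N E1 + measure N E2" unfolding E_def by (intro measure_Un_le) auto
  with E1 E2 have mE: "measure N E \<le> KN * ((real n + 1) * measure N {x\<in>space N. L < ?T x}) + measure N (space N) * exp (- (lam * \<gamma> * real n / 4))"
    by linarith
  have "(\<Sum>j. visit Bad j x) \<le> ennreal (if \<gamma> * real n / B < real (R x) then real (R x) else 0) + ennreal (real (R x)) * indicator E (F x)"
    if x: "good x" "x \<in> space N" for x
  proof -
    have "(F ^^ 0) x \<in> \<Union>P" using x unfolding good_def by blast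
    then obtain \<omega> where w: "\<omega> \<in> P" "x \<in> \<omega>" by auto
    have Fx: "F x = (f ^^ R x) x" by (rule F_eq[OF w])
    have visit0: "visit Bad j x = 0" if h: "R x \<le> \<gamma> * real n / B" "F x \<notin> E" for j
    proof (cases "j < R x")
      case True
      have BR: "B * real (R x) \<le> \<gamma> * real n" using h(1) B1 by (simp add: field_simps)
      have Fs: "good (F x)" "F x \<in> space N" using good_funpow[OF x(1), of 1] funpow_space[OF x(2), of 1] by auto
      have part: "\<bar>birkhoff_sum f \<phi> n' (F x)\<bar> \<le> \<gamma> * real n + L" if "n' \<le> n" for n'
      proof (rule partial_sum_bound[OF Fs k that B exU])
        show "?T ((F ^^ (k * j)) (F x)) \<le> L" if "j \<le> ?Q" for j
          using h(2) that Fs(2) unfolding E_def E1_def by (auto simp: not_less)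
        show "(\<Sum>j<?Q. min (?U ((F ^^ (k * j)) (F x))) L) \<le> \<gamma> * real n"
          using h(2) Fs(2) unfolding E_def E2_def by auto
      qed
      have "\<bar>birkhoff_sum f \<phi> n ((f ^^ j) x)\<bar> \<le> 3 * \<gamma> * real n"
      proof (cases "n \<le> R x - j")
        case True
        have "\<bar>birkhoff_sum f \<phi> n ((f ^^ j) x)\<bar> \<le> B * real n" by (rule birkhoff_sum_bound[OF B])
        also have "\<dots> \<le> B * real (R x)" using True B1 by (intro mult_left_mono) auto
        also have "\<dots> \<le> 1 * (\<gamma> * real n)" using BR by simp
        also have "\<dots> \<le> 3 * (\<gamma> * real n)" using gam by (intro mult_right_mono) auto
        finally show ?thesis by simp
      next
        case False
        have fx: "(f ^^ (R x - j)) ((f ^^ j) x) = F x"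
          unfolding Fx using \<open>j < R x\<close> by (metis comp_apply funpow_add le_add_diff_inverse2 less_imp_le)
        have "birkhoff_sum f \<phi> n ((f ^^ j) x) = birkhoff_sum f \<phi> ((R x - j) + (n - (R x - j))) ((f ^^ j) x)"
          using False by simp
        also have "\<dots> = birkhoff_sum f \<phi> (R x - j) ((f ^^ j) x) + birkhoff_sum f \<phi> (n - (R x - j)) (F x)"
          unfolding birkhoff_sum_add fx ..
        finally have "\<bar>birkhoff_sum f \<phi> n ((f ^^ j) x)\<bar> \<le> \<bar>birkhoff_sum f \<phi> (R x - j) ((f ^^ j) x)\<bar> + \<bar>birkhoff_sum f \<phi> (n - (R x - j)) (F x)\<bar>"
          by linarith
        moreover have "\<bar>birkhoff_sum f \<phi> (R x - j) ((f ^^ j) x)\<bar> \<le> B * real (R x - j)" by (rule birkhoff_sum_bound[OF B])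
        moreover have "B * real (R x - j) \<le> B * real (R x)" using B1 by (intro mult_left_mono) auto
        moreover have "\<bar>birkhoff_sum f \<phi> (n - (R x - j)) (F x)\<bar> \<le> \<gamma> * real n + L" by (rule part) simp
        ultimately show ?thesis using BR L(2) by linarith
      qed
      then show ?thesis by (simp add: visit_def Bad_def indicator_def)
    qed (simp add: visit_def)
    have "(\<Sum>j. visit Bad j x) \<le> (\<Sum>j. if j < R x then 1 else (0::ennreal))"
      by (intro suminf_le) (auto simp: visit_def indicator_def)
    also have "\<dots> = (\<Sum>j<R x. 1)"
      by (subst suminf_finite[of "{..<R x}"]) (auto intro!: sum.cong)
    also have "\<dots> = ennreal (real (R x))" by (simp add: ennreal_of_nat_eq_real_of_nat)
    finally have tot: "(\<Sum>j. visit Bad j x) \<le> ennreal (real (R x))" .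
    show ?thesis
    proof (cases "R x \<le> \<gamma> * real n / B \<and> F x \<notin> E")
      case True
      then have "(\<Sum>j. visit Bad j x) = 0" using visit0 by simp
      then show ?thesis by simp
    next
      case False
      show ?thesis
      proof (cases "F x \<in> E")
        case True
        then show ?thesis using add_increasing[OF zero_le tot] by simp
      next
        case F: False
        then have "\<gamma> * real n / B < real (R x)" using False by linarith
        then show ?thesis using tot F by simp
      qed
    qed
  qed
  then have "(\<integral>\<^sup>+x. (\<Sum>j. visit Bad j x) \<partial>N) \<le> (\<integral>\<^sup>+x. ennreal (if \<gamma> * real n / B < real (R x) then real (R x) else 0) + ennreal (real (R x)) * indicator E (F x) \<partial>N)"
    by (intro nn_integral_mono_AE, use AE_good AE_space in eventually_elim) blast
  also have "\<dots> = tail_integral (\<lambda>x. real (R x)) (\<gamma> * real n / B) + (\<integral>\<^sup>+x. ennreal (real (R x)) * indicator E (F x) \<partial>N)"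
    unfolding tail_integral_def by (intro nn_integral_add) measurable
  also have "(\<integral>\<^sup>+x. ennreal (real (R x)) * indicator E (F x) \<partial>N) \<le> ennreal K * (\<integral>\<^sup>+x. ennreal (real (R x)) \<partial>N) * (\<integral>\<^sup>+x. indicator E x \<partial>N)"
  proof -
    have "cylfun 1 (\<lambda>x. ennreal (real (R x)))"
    proof -
      have "R x = R y" if "ws \<in> words 1" "x \<in> cyl ws" "y \<in> cyl ws" for ws x y
        using tau_cyl[OF that, of 0] by simp
      then show ?thesis unfolding cylfun_def by metis
    qed
    then show ?thesis using quasi_independence[of "indicator E" "\<lambda>x. ennreal (real (R x))" 1] by simp
  qed
  also have "\<dots> = ennreal (K * (\<integral>x. real (R x) \<partial>N) * measure N E)"
  proof -
    have "(\<integral>\<^sup>+x. ennreal (real (R x)) \<partial>N) = ennreal (\<integral>x. real (R x) \<partial>N)"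
      using R_integrable by (intro nn_integral_eq_integral) auto
    moreover have "0 \<le> (\<integral>x. real (R x) \<partial>N)" by (intro integral_nonneg_AE) auto
    ultimately show ?thesis using K_pos by (simp add: emeasure_eq_measure ennreal_mult)
  qed
  also have "\<dots> \<le> ennreal (K * (\<integral>x. real (R x) \<partial>N) * (KN * ((real n + 1) * measure N {x\<in>space N. L < ?T x}) + measure N (space N) * exp (- (lam * \<gamma> * real n / 4))))"
    using K_pos mE by (intro ennreal_leI mult_left_mono mult_nonneg_nonneg integral_nonneg_AE) auto
  finally have "(\<integral>\<^sup>+x. (\<Sum>j. visit Bad j x) \<partial>N) \<le> tail_integral (\<lambda>x. real (R x)) (\<gamma> * real n / B)
     + ennreal (K * (\<integral>x. real (R x) \<partial>N) * (KN * ((real n + 1) * measure N {x\<in>space N. L < ?T x}) + measure N (space N) * exp (- (lam * \<gamma> * real n / 4))))"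
    by (simp add: add_left_mono)
  then have "ennreal K * (\<integral>\<^sup>+x. (\<Sum>j. visit Bad j x) \<partial>N) \<le> ennreal K * (tail_integral (\<lambda>x. real (R x)) (\<gamma> * real n / B)
     + ennreal (K * (\<integral>x. real (R x) \<partial>N) * (KN * ((real n + 1) * measure N {x\<in>space N. L < ?T x}) + measure N (space N) * exp (- (lam * \<gamma> * real n / 4)))))"
    by (intro mult_left_mono) auto
  with domination[OF \<open>Bad \<in> sets m\<close>] show ?thesis unfolding Bad_def[symmetric] by (rule order_trans)
qed

end

section \<open>Polynomial and stretched exponential rates\<close>

context induced_system begin

lemma two_powr_less_one: "1 < a \<Longrightarrow> 2 powr (1 - a) < (1::real)"
  using powr_less_mono[of "1 - a" 0 "2::real"] by simp

text \<open>Dyadic decomposition: \<open>T\<close> is at most \<open>2\<^bsup>i+1\<^esup> t\<close> on the shell where it first fails to exceed that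
  value, and the shells contribute a geometric series with ratio \<open>2\<^bsup>1-a\<^esup>\<close>.\<close>

lemma tail_integral_le:
  assumes T[measurable]: "T \<in> borel_measurable N" and t: "0 < t" and a: "1 < a" and A: "0 \<le> A"
    and tail: "\<And>s. t \<le> s \<Longrightarrow> measure N {x\<in>space N. s < T x} \<le> A * s powr (- a)"
  shows "tail_integral T t \<le> ennreal (2 * A / (1 - 2 powr (1 - a)) * t powr (1 - a))"
proof -
  define q where "q = (2::real) powr (1 - a)"
  have q: "0 < q" "q < 1" unfolding q_def by (rule powr_gt_zero[THEN iffD2], simp) (rule two_powr_less_one[OF a])
  define b where "b i = 2 ^ Suc i * t" for i :: nat
  have b0: "0 < b i" for i using t by (simp add: b_def)
  have "tail_integral T t \<le> (\<integral>\<^sup>+x. (\<Sum>i. ennreal (b i) * indicator {x\<in>space N. b i / 2 < T x} x) \<partial>N)"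
    unfolding tail_integral_def
  proof (intro nn_integral_mono)
    fix x assume x: "x \<in> space N"
    show "ennreal (if t < T x then T x else 0) \<le> (\<Sum>i. ennreal (b i) * indicator {x\<in>space N. b i / 2 < T x} x)"
    proof (cases "t < T x")
      case True
      obtain n where n: "T x / t < 2 ^ n" using real_arch_pow[of 2 "T x / t"] by auto
      have ex: "T x \<le> b n"
      proof -
        have "T x < 2 ^ n * t" using n t by (simp add: pos_divide_less_eq)
        also have "\<dots> \<le> b n" using t by (simp add: b_def)
        finally show ?thesis by simp
      qed
      define i where "i = (LEAST i. T x \<le> b i)"
      have i1: "T x \<le> b i" unfolding i_def using ex by (rule LeastI)
      have i2: "b i / 2 < T x"
      proof (cases i)
        case 0 then show ?thesis using True by (simp add: b_def)
      next
        case (Suc j)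
        then have "\<not> T x \<le> b j" using not_less_Least[of j "\<lambda>i. T x \<le> b i"] by (simp add: i_def)
        then show ?thesis by (simp add: Suc b_def not_le mult_ac)
      qed
      have "ennreal (if t < T x then T x else 0) \<le> ennreal (b i) * indicator {x\<in>space N. b i / 2 < T x} x"
        using True i1 i2 x by (simp add: ennreal_leI)
      also have "\<dots> \<le> (\<Sum>i. ennreal (b i) * indicator {x\<in>space N. b i / 2 < T x} x)"
      proof -
        have single: "g i \<le> (\<Sum>j. g j)" for g :: "nat \<Rightarrow> ennreal"
          using sum_le_suminf[of g "{i}"] by simp
        show ?thesis by (rule single[of "\<lambda>i. ennreal (b i) * indicator {x\<in>space N. b i / 2 < T x} x"])
      qed
      finally show ?thesis .
    qed simp
  qed
  also have "\<dots> = (\<Sum>i. ennreal (b i) * emeasure N {x\<in>space N. b i / 2 < T x})"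
    by (subst nn_integral_suminf) (auto simp: nn_integral_cmult_indicator)
  also have "\<dots> \<le> (\<Sum>i. ennreal (2 * A * t powr (1 - a) * q ^ i))"
  proof (intro suminf_le)
    fix i
    have p: "b i / 2 = 2 powr real i * t" by (simp add: b_def powr_realpow)
    have "t \<le> b i / 2" using t by (simp add: b_def)
    then have "b i * measure N {x\<in>space N. b i / 2 < T x} \<le> b i * (A * (b i / 2) powr (- a))"
      using b0[of i] by (intro mult_left_mono tail) auto
    also have "\<dots> = 2 * A * ((b i / 2) * (b i / 2) powr (- a))" by simp
    also have "(b i / 2) * (b i / 2) powr (- a) = (b i / 2) powr (1 - a)"
      using b0[of i] powr_mult_base[of "b i / 2" "- a"] by simp
    also have "\<dots> = (2 powr real i) powr (1 - a) * t powr (1 - a)"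
      unfolding p using t by (simp add: powr_mult)
    also have "(2 powr real i) powr (1 - a) = q ^ i"
      by (simp add: q_def powr_powr powr_realpow[symmetric] mult.commute)
    finally have "b i * measure N {x\<in>space N. b i / 2 < T x} \<le> 2 * A * t powr (1 - a) * q ^ i" by (simp add: mult_ac)
    then show "ennreal (b i) * emeasure N {x\<in>space N. b i / 2 < T x} \<le> ennreal (2 * A * t powr (1 - a) * q ^ i)"
      using b0[of i] by (simp add: emeasure_eq_measure ennreal_mult[symmetric] ennreal_leI)
  qed auto
  also have "\<dots> = ennreal (2 * A * t powr (1 - a) * (1 / (1 - q)))"
  proof -
    have "(\<lambda>i. 2 * A * t powr (1 - a) * q ^ i) sums (2 * A * t powr (1 - a) * (1 / (1 - q)))"
      using q by (intro sums_mult geometric_sums) auto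
    then show ?thesis using A q by (intro suminf_ennreal_eq) auto
  qed
  finally show ?thesis by (simp add: q_def)
qed

text \<open>If a sum of \<open>k\<close> return times is large, one of them exceeds the average.\<close>

lemma tau_tail:
  assumes D: "0 < D" and k: "0 < k"
  shows "measure N {x\<in>space N. s < D * real (\<tau> k x)} \<le> real k * KN * measure N {x\<in>space N. s / (D * real k) < real (R x)}"
proof -
  let ?A = "{x\<in>space N. s / (D * real k) < real (R x)}"
  have mA: "{x\<in>space N. (F ^^ i) x \<in> ?A} \<in> sets N" for i by measurable
  have "measure N {x\<in>space N. s < D * real (\<tau> k x)} \<le> measure N (\<Union>i<k. {x\<in>space N. (F ^^ i) x \<in> ?A})"
  proof (intro finite_measure_mono subsetI)
    fix x assume "x \<in> {x\<in>space N. s < D * real (\<tau> k x)}"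
    then have x: "x \<in> space N" "s < D * real (\<tau> k x)" by auto
    have "\<exists>i<k. s / (D * real k) < real (R ((F ^^ i) x))"
    proof (rule ccontr)
      assume none: "\<not> ?thesis"
      have "real (R ((F ^^ i) x)) \<le> s / (D * real k)" if "i < k" for i
        using none that linorder_not_less by blast
      then have "(\<Sum>i<k. real (R ((F ^^ i) x))) \<le> (\<Sum>i<k. s / (D * real k))" by (intro sum_mono) simp
      then have "real (\<tau> k x) \<le> real k * (s / (D * real k))" by (simp add: \<tau>_def)
      also have "\<dots> = s / D" using k by simp
      finally show False using x(2) D by (simp add: field_simps)
    qed
    then show "x \<in> (\<Union>i<k. {x\<in>space N. (F ^^ i) x \<in> ?A})" using x(1) by (auto intro: funpow_space)
  qed (use mA in auto)
  also have "\<dots> \<le> (\<Sum>i<k. measure N {x\<in>space N. (F ^^ i) x \<in> ?A})"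
    using mA by (intro finite_measure_subadditive_finite) auto
  also have "\<dots> \<le> (\<Sum>i<k. KN * measure N ?A)"
  proof (intro sum_mono)
    fix i
    have "emeasure N {x\<in>space N. (F ^^ i) x \<in> ?A} = (\<integral>\<^sup>+x. indicator ?A ((F ^^ i) x) \<partial>N)"
      using mA[of i] by (subst nn_integral_indicator[symmetric], simp, intro nn_integral_cong) (auto simp: indicator_def funpow_space)
    also have "\<dots> \<le> ennreal (K * measure N (space N)) * (\<integral>\<^sup>+x. indicator ?A x \<partial>N)"
      by (rule nn_integral_funpow_le) measurable
    also have "(\<integral>\<^sup>+x. indicator ?A x \<partial>N) = emeasure N ?A" by (rule nn_integral_indicator) measurable
    finally have "ennreal (measure N {x\<in>space N. (F ^^ i) x \<in> ?A}) \<le> ennreal (KN * measure N ?A)"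
      using KN_pos by (simp add: emeasure_eq_measure ennreal_mult KN_def)
    then show "measure N {x\<in>space N. (F ^^ i) x \<in> ?A} \<le> KN * measure N ?A"
      using KN_pos by (subst (asm) ennreal_le_iff) auto
  qed
  finally show ?thesis by simp
qed

lemma tau_integrable: "integrable N (\<lambda>x. D * real (\<tau> k x))"
proof -
  have "integrable N (\<lambda>x. real (R ((F ^^ i) x)))" for i
  proof (rule integrableI_bounded)
    have "(\<integral>\<^sup>+x. ennreal (real (R ((F ^^ i) x))) \<partial>N) \<le> ennreal (K * measure N (space N)) * (\<integral>\<^sup>+x. ennreal (real (R x)) \<partial>N)"
      by (rule nn_integral_funpow_le) measurable
    also have "\<dots> < \<infinity>" using R_nn_integral_finite by (simp add: ennreal_mult_less_top)
    finally show "(\<integral>\<^sup>+x. ennreal (norm (real (R ((F ^^ i) x)))) \<partial>N) < \<infinity>" by simp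
  qed measurable
  then show ?thesis by (simp add: \<tau>_def)
qed

lemma block_length:
  assumes "variation_bound c \<theta> \<phi>" "\<phi> \<in> borel_measurable m" "\<And>x. \<bar>\<phi> x\<bar> \<le> B"
    "(\<integral>x. \<phi> x \<partial>\<mu>) = 0" "0 < e"
  obtains k where "0 < k" "(\<integral>\<^sup>+x. ennreal (envelope c \<theta> \<phi> k x) \<partial>N) \<le> ennreal (e * real k)"
proof -
  have "\<forall>\<^sub>F k in sequentially. 0 < k \<and> (\<integral>\<^sup>+x. ennreal (envelope c \<theta> \<phi> k x) \<partial>N) \<le> ennreal (e * real k)"
    using envelope_mean_small[OF assms] eventually_gt_at_top[of 0] by eventually_elim auto
  then show thesis using that by (auto simp: eventually_sequentially)
qed

text \<open>The level \<open>L = \<gamma> n / 16\<close> is chosen against \<open>lam = 4 (a - 1) ln n / (\<gamma> n)\<close>: then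
  \<open>exp (lam L) = n\<^bsup>(a-1)/4\<^esup>\<close> is beaten by the tail integral \<open>O(n\<^bsup>-(a-1)/2\<^esup>)\<close> beyond \<open>M = sqrt n\<close>, while
  \<open>exp (- lam \<gamma> n / 4)\<close> is exactly \<open>n\<^bsup>1-a\<^esup>\<close>.\<close>

theorem polynomial_deviations:
  assumes v: "variation_bound c \<theta> \<phi>"
    and phi[measurable]: "\<phi> \<in> borel_measurable m" and B: "\<And>x. \<bar>\<phi> x\<bar> \<le> B" and B1: "0 < B"
    and zero: "(\<integral>x. \<phi> x \<partial>\<mu>) = 0" and gam: "0 < \<gamma>" and a: "1 < a" and A: "0 \<le> A"
    and tail: "\<And>s. 0 < s \<Longrightarrow> measure N {x\<in>space N. s < real (R x)} \<le> A * s powr (- a)"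
  shows "\<exists>C\<ge>0. \<forall>\<^sub>F n in sequentially. measure \<mu> {x\<in>space m. 3 * \<gamma> * real n < \<bar>birkhoff_sum f \<phi> n x\<bar>} \<le> C * real n powr (1 - a)"
proof -
  interpret mu: prob_space \<mu> by (rule mu_prob)
  have c0: "0 \<le> c" using v by (simp add: variation_bound_def)
  have "0 < \<gamma> / (4 * K)" using gam K_pos by simp
  from block_length[OF v phi B zero this] obtain k where
    k: "0 < k" and meanU: "(\<integral>\<^sup>+x. ennreal (envelope c \<theta> \<phi> k x) \<partial>N) \<le> ennreal (\<gamma> / (4 * K) * real k)" by blast
  define D where "D = B + c"
  have D: "0 < D" using B1 c0 by (simp add: D_def)
  define A' where "A' = real k * KN * (A * (1 / (D * real k)) powr (- a))"
  have A'0: "0 \<le> A'" using A KN_pos by (simp add: A'_def)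
  have tailT: "measure N {x\<in>space N. s < D * real (\<tau> k x)} \<le> A' * s powr (- a)" if s: "0 < s" for s
  proof -
    have "measure N {x\<in>space N. s < D * real (\<tau> k x)} \<le> real k * KN * (A * (s / (D * real k)) powr (- a))"
      using KN_pos D k s by (intro order_trans[OF tau_tail[OF D k]] mult_left_mono tail) auto
    also have "(s / (D * real k)) powr (- a) = (1 / (D * real k)) powr (- a) * s powr (- a)"
      using s D k by (subst powr_mult[symmetric]) auto
    finally show ?thesis by (simp add: A'_def mult_ac)
  qed
  \<comment> \<open>The constants of \<open>tail_integral_le\<close> for \<open>D \<tau> k\<close> and for \<open>R\<close>.\<close>
  define c1 where "c1 = 2 * A' / (1 - 2 powr (1 - a))"
  define c2 where "c2 = 2 * A / (1 - 2 powr (1 - a))"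
  have "2 powr (1 - a) < (1::real)" by (rule two_powr_less_one[OF a])
  then have c12: "0 \<le> c1" "0 \<le> c2" using A A'0 by (auto simp: c1_def c2_def)
  define y where "y = \<gamma> / (4 * K) * real k"
  have y: "0 < y" using gam K_pos k by (simp add: y_def)
  define lam where "lam n = 4 * (a - 1) / \<gamma> * (ln (real n) / real n)" for n
  define r where "r = (\<integral>x. real (R x) \<partial>N)"
  have r0: "0 \<le> r" unfolding r_def by (intro integral_nonneg_AE) auto
  define Cc where "Cc = K * (c2 * (\<gamma> / B) powr (1 - a) + K * r * (KN * (2 * (A' * (\<gamma> / 16) powr (- a))) + measure N (space N)))"
  have Cc0: "0 \<le> Cc" unfolding Cc_def using K_pos KN_pos c12 r0 A'0 by auto
  have e1: "\<forall>\<^sub>F n::nat in sequentially. lam n * sqrt (real n) \<le> 1 / 2"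
  proof -
    have "(\<lambda>n::nat. ln (real n) / real n * sqrt (real n)) \<longlonglongrightarrow> 0" by real_asymp
    then have "(\<lambda>n::nat. 4 * (a - 1) / \<gamma> * (ln (real n) / real n * sqrt (real n))) \<longlonglongrightarrow> 4 * (a - 1) / \<gamma> * 0"
      by (intro tendsto_intros)
    then have "\<forall>\<^sub>F n::nat in sequentially. 4 * (a - 1) / \<gamma> * (ln (real n) / real n * sqrt (real n)) < 1 / 2"
      by (intro order_tendstoD) auto
    then show ?thesis by eventually_elim (simp add: lam_def mult.assoc)
  qed
  have e2: "\<forall>\<^sub>F n::nat in sequentially. c1 * real n powr (- ((a - 1) / 4)) \<le> y"
  proof -
    have "(\<lambda>n::nat. real n powr (- ((a - 1) / 4))) \<longlonglongrightarrow> 0"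
      using a by (intro tendsto_neg_powr filterlim_real_sequentially) auto
    then have "(\<lambda>n::nat. c1 * real n powr (- ((a - 1) / 4))) \<longlonglongrightarrow> c1 * 0" by (intro tendsto_intros)
    then have "\<forall>\<^sub>F n::nat in sequentially. c1 * real n powr (- ((a - 1) / 4)) < y"
      using y by (intro order_tendstoD) auto
    then show ?thesis by eventually_elim simp
  qed
  have "\<forall>\<^sub>F n in sequentially. measure \<mu> {x\<in>space m. 3 * \<gamma> * real n < \<bar>birkhoff_sum f \<phi> n x\<bar>} \<le> Cc * real n powr (1 - a)"
    using e1 e2 eventually_gt_at_top[of 1]
  proof eventually_elim
    fix n :: nat assume n1: "lam n * sqrt (real n) \<le> 1 / 2" and n2: "c1 * real n powr (- ((a - 1) / 4)) \<le> y" and n: "1 < n"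
    have rn: "0 < real n" "1 \<le> real n" using n by auto
    have sq: "0 < sqrt (real n)" using n by simp
    have lam0: "0 < lam n" using a gam n by (simp add: lam_def)
    have lamn: "lam n * real n = 4 * (a - 1) / \<gamma> * ln (real n)" using n by (simp add: lam_def)
    have expL: "exp (lam n * (\<gamma> / 16 * real n)) = real n powr ((a - 1) / 4)"
    proof -
      have "lam n * (\<gamma> / 16 * real n) = (lam n * real n) * (\<gamma> / 16)" by simp
      also have "\<dots> = (a - 1) / 4 * ln (real n)" unfolding lamn using gam by simp
      finally show ?thesis using n by (simp add: powr_def)
    qed
    have expg: "exp (- (lam n * \<gamma> * real n / 4)) = real n powr (1 - a)"
    proof -
      have "lam n * \<gamma> * real n / 4 = (lam n * real n) * (\<gamma> / 4)" by simp
      also have "\<dots> = (a - 1) * ln (real n)" unfolding lamn using gam by simp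
      finally have "- (lam n * \<gamma> * real n / 4) = (1 - a) * ln (real n)" by (simp add: algebra_simps)
      then show ?thesis using n by (simp add: powr_def)
    qed
    have tT: "ennreal (exp (lam n * (\<gamma> / 16 * real n))) * tail_integral (\<lambda>x. (B + c) * real (\<tau> k x)) (sqrt (real n)) \<le> ennreal (\<gamma> / (4 * K) * real k)"
    proof -
      have "tail_integral (\<lambda>x. D * real (\<tau> k x)) (sqrt (real n)) \<le> ennreal (c1 * sqrt (real n) powr (1 - a))"
        unfolding c1_def
      proof (rule tail_integral_le[OF _ sq a A'0])
        fix s assume "sqrt (real n) \<le> s"
        then show "measure N {x\<in>space N. s < D * real (\<tau> k x)} \<le> A' * s powr (- a)" using sq by (intro tailT) linarith
      qed measurable
      also have "sqrt (real n) powr (1 - a) = real n powr ((1 - a) / 2)"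
        using rn by (simp add: powr_half_sqrt[symmetric] powr_powr)
      finally have "ennreal (exp (lam n * (\<gamma> / 16 * real n))) * tail_integral (\<lambda>x. D * real (\<tau> k x)) (sqrt (real n))
         \<le> ennreal (real n powr ((a - 1) / 4)) * ennreal (c1 * real n powr ((1 - a) / 2))"
        unfolding expL by (intro mult_left_mono) auto
      also have "\<dots> = ennreal (c1 * real n powr (- ((a - 1) / 4)))"
      proof -
        have "real n powr ((a - 1) / 4) * real n powr ((1 - a) / 2) = real n powr (- ((a - 1) / 4))"
        proof -
          have e: "(a - 1) / 4 + (1 - a) / 2 = - ((a - 1) / 4)" by (simp add: field_simps)
          show ?thesis by (simp only: powr_add[symmetric] e)
        qed
        then show ?thesis using c12 by (simp add: ennreal_mult[symmetric] mult.left_commute)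
      qed
      also have "\<dots> \<le> ennreal y" by (intro ennreal_leI n2)
      finally show ?thesis by (simp add: D_def y_def)
    qed
    have "emeasure \<mu> {x\<in>space m. 3 * \<gamma> * real n < \<bar>birkhoff_sum f \<phi> n x\<bar>}
      \<le> ennreal K * (tail_integral (\<lambda>x. real (R x)) (\<gamma> * real n / B)
       + ennreal (K * (\<integral>x. real (R x) \<partial>N) * (KN * ((real n + 1) * measure N {x\<in>space N. \<gamma> / 16 * real n < (B + c) * real (\<tau> k x)})
           + measure N (space N) * exp (- (lam n * \<gamma> * real n / 4)))))"
      using rn gam by (intro deviation_bound[OF v phi B B1 gam k lam0 n1 _ _ meanU tT]) auto
    also have "\<dots> \<le> ennreal K * (ennreal (c2 * (\<gamma> * real n / B) powr (1 - a))
       + ennreal (K * r * (KN * (2 * real n * (A' * (\<gamma> / 16 * real n) powr (- a)))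
           + measure N (space N) * real n powr (1 - a))))"
    proof (intro mult_left_mono add_mono)
      show "tail_integral (\<lambda>x. real (R x)) (\<gamma> * real n / B) \<le> ennreal (c2 * (\<gamma> * real n / B) powr (1 - a))"
        unfolding c2_def
      proof (rule tail_integral_le[OF _ _ a A])
        show t0: "0 < \<gamma> * real n / B" using rn gam B1 by simp
        fix s assume "\<gamma> * real n / B \<le> s"
        then show "measure N {x\<in>space N. s < real (R x)} \<le> A * s powr (- a)" using t0 by (intro tail) linarith
      qed measurable
      show "ennreal (K * (\<integral>x. real (R x) \<partial>N) * (KN * ((real n + 1) * measure N {x\<in>space N. \<gamma> / 16 * real n < (B + c) * real (\<tau> k x)})
           + measure N (space N) * exp (- (lam n * \<gamma> * real n / 4))))
         \<le> ennreal (K * r * (KN * (2 * real n * (A' * (\<gamma> / 16 * real n) powr (- a)))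
           + measure N (space N) * real n powr (1 - a)))"
        unfolding expg r_def[symmetric] D_def[symmetric]
        using K_pos KN_pos r0 rn gam A'0
        by (intro ennreal_leI mult_left_mono add_mono mult_mono tailT order_refl) auto
    qed auto
    also have "\<dots> = ennreal (Cc * real n powr (1 - a))"
    proof -
      have p1: "(\<gamma> * real n / B) powr (1 - a) = (\<gamma> / B) powr (1 - a) * real n powr (1 - a)"
        using gam B1 by (subst powr_mult[symmetric]) auto
      have p2: "real n * (\<gamma> / 16 * real n) powr (- a) = (\<gamma> / 16) powr (- a) * real n powr (1 - a)"
      proof -
        have "real n * real n powr (- a) = real n powr (1 - a)"
          using rn powr_mult_base[of "real n" "- a"] by simp
        then show ?thesis using gam by (subst powr_mult) auto
      qed
      have p3: "2 * real n * (A' * (\<gamma> / 16 * real n) powr (- a)) = 2 * (A' * (\<gamma> / 16) powr (- a)) * real n powr (1 - a)"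
        using p2 by (metis (no_types, opaque_lifting) mult.assoc mult.left_commute)
      define z where "z = real n powr (1 - a)"
      have z: "0 \<le> z" by (simp add: z_def)
      show ?thesis
        unfolding p1 p3 z_def[symmetric] Cc_def
        using K_pos KN_pos c12 r0 A'0 z
        by (subst ennreal_plus[symmetric], simp, simp, subst ennreal_mult[symmetric], simp, simp) (simp add: algebra_simps)
    qed
    finally show "measure \<mu> {x\<in>space m. 3 * \<gamma> * real n < \<bar>birkhoff_sum f \<phi> n x\<bar>} \<le> Cc * real n powr (1 - a)"
      using Cc0 by (simp add: mu.emeasure_eq_measure)
  qed
  then show ?thesis using Cc0 by blast
qed

lemma powr_le_exp:
  assumes "0 < y" "0 < p" shows "(y / p) powr p \<le> exp (y::real)"
proof -
  have "y / p \<le> exp (y / p)" using exp_ge_add_one_self[of "y / p"] by linarith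
  then have "(y / p) powr p \<le> exp (y / p) powr p" using assms by (intro powr_mono2) auto
  also have "\<dots> = exp y" using assms by (simp add: powr_def)
  finally show ?thesis .
qed

text \<open>Half of the exponent is kept as a constant factor; the other half dominates \<open>s\<^sup>-\<^sup>2\<close> and reduces the
  claim to a polynomial tail.\<close>

lemma stretched_tail_integral:
  assumes A: "0 \<le> A" and a: "0 < a" and kap: "0 < \<kappa>" and t: "0 < t"
    and tail: "\<And>s. 0 < s \<Longrightarrow> measure N {x\<in>space N. s < real (R x)} \<le> A * exp (- \<kappa> * s powr a)"
  shows "tail_integral (\<lambda>x. real (R x)) t
    \<le> ennreal (4 * (A * exp (- (\<kappa> / 2) * t powr a) * (\<kappa> * a / 4) powr (- (2 / a))) / t)"
proof -
  let ?A = "A * exp (- (\<kappa> / 2) * t powr a) * (\<kappa> * a / 4) powr (- (2 / a))"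
  have "tail_integral (\<lambda>x. real (R x)) t \<le> ennreal (2 * ?A / (1 - 2 powr (1 - 2)) * t powr (1 - 2))"
  proof (rule tail_integral_le[OF _ t])
    fix s assume s: "t \<le> s"
    have s0: "0 < s" using s t by linarith
    have m1: "measure N {x\<in>space N. s < real (R x)} \<le> A * exp (- \<kappa> * s powr a)" by (rule tail[OF s0])
    have "exp (- \<kappa> * s powr a) = exp (- (\<kappa> / 2) * s powr a) * exp (- (\<kappa> / 2) * s powr a)"
      by (simp add: exp_add[symmetric])
    also have "\<dots> \<le> exp (- (\<kappa> / 2) * t powr a) * ((\<kappa> * a / 4) powr (- (2 / a)) * s powr (- 2))"
    proof (intro mult_mono)
      have "t powr a \<le> s powr a" using s t a by (intro powr_mono2) auto
      then show "exp (- (\<kappa> / 2) * s powr a) \<le> exp (- (\<kappa> / 2) * t powr a)" using kap by simp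
      have "(\<kappa> * a / 4) powr (2 / a) * s powr 2 = (\<kappa> * a / 4 * s powr a) powr (2 / a)"
        using a kap s0 by (subst powr_mult) (auto simp: powr_powr)
      also have "\<kappa> * a / 4 * s powr a = (\<kappa> / 2 * s powr a) / (2 / a)" by simp
      also have "\<dots> powr (2 / a) \<le> exp (\<kappa> / 2 * s powr a)" using a kap s0 by (intro powr_le_exp) auto
      finally have "(\<kappa> * a / 4) powr (2 / a) * s powr 2 \<le> exp (\<kappa> / 2 * s powr a)" .
      then have "inverse (exp (\<kappa> / 2 * s powr a)) \<le> inverse ((\<kappa> * a / 4) powr (2 / a) * s powr 2)"
        using a kap s0 by (intro le_imp_inverse_le mult_pos_pos) auto
      then show "exp (- (\<kappa> / 2) * s powr a) \<le> (\<kappa> * a / 4) powr (- (2 / a)) * s powr (- 2)"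
        by (simp only: powr_minus inverse_mult_distrib exp_minus[symmetric] mult_minus_left)
    qed auto
    finally have "A * exp (- \<kappa> * s powr a) \<le> A * (exp (- (\<kappa> / 2) * t powr a) * ((\<kappa> * a / 4) powr (- (2 / a)) * s powr (- 2)))"
      using A by (intro mult_left_mono)
    with m1 show "measure N {x\<in>space N. s < real (R x)} \<le> ?A * s powr (- 2)"
      by (simp only: mult.assoc)
  qed (use A in auto)
  also have "2 * ?A / (1 - 2 powr (1 - 2)) * t powr (1 - 2) = 4 * ?A / t"
  proof -
    have e: "(1 - 2 :: real) = - 1" by simp
    have "2 * X / (1 - 2 powr (1 - 2)) * t powr (1 - 2) = 4 * X / t" for X :: real
      unfolding e using t by (simp only: powr_neg_one) simp
    then show ?thesis .
  qed
  finally show ?thesis .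
qed

text \<open>With \<open>lam L = 1\<close> the factor \<open>exp (lam L)\<close> stays bounded, so the threshold \<open>M\<close> can be a constant. The
  union bound over the blocks gives \<open>exp (- \<kappa>' n\<^bsup>th a\<^esup>)\<close> and the exponential moment
  \<open>exp (- \<gamma> n\<^bsup>1-th\<^esup> / 4)\<close>; for \<open>th = 1 / (a + 2)\<close> the first exponent is \<open>a / (a + 2)\<close> and the second
  is larger.\<close>

theorem stretched_deviations:
  assumes v: "variation_bound c \<theta> \<phi>"
    and phi[measurable]: "\<phi> \<in> borel_measurable m" and B: "\<And>x. \<bar>\<phi> x\<bar> \<le> B" and B1: "0 < B"
    and zero: "(\<integral>x. \<phi> x \<partial>\<mu>) = 0" and gam: "0 < \<gamma>" and a: "0 < a" and A: "0 \<le> A" and kap: "0 < \<kappa>"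
    and tail: "\<And>s. 0 < s \<Longrightarrow> measure N {x\<in>space N. s < real (R x)} \<le> A * exp (- \<kappa> * s powr a)"
  shows "\<exists>C\<ge>0. \<exists>c'>0. \<forall>\<^sub>F n in sequentially.
    measure \<mu> {x\<in>space m. 3 * \<gamma> * real n < \<bar>birkhoff_sum f \<phi> n x\<bar>} \<le> C * exp (- c' * real n powr (a / (a + 2)))"
proof -
  interpret mu: prob_space \<mu> by (rule mu_prob)
  have c0: "0 \<le> c" using v by (simp add: variation_bound_def)
  have "0 < \<gamma> / (4 * K)" using gam K_pos by simp
  from block_length[OF v phi B zero this] obtain k where
    k: "0 < k" and meanU: "(\<integral>\<^sup>+x. ennreal (envelope c \<theta> \<phi> k x) \<partial>N) \<le> ennreal (\<gamma> / (4 * K) * real k)" by blast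
  define D where "D = B + c"
  have D: "0 < D" using B1 c0 by (simp add: D_def)
  define A' where "A' = real k * KN * A"
  have A'0: "0 \<le> A'" using A KN_pos by (simp add: A'_def)
  define \<kappa>' where "\<kappa>' = \<kappa> * (1 / (D * real k)) powr a"
  have kap': "0 < \<kappa>'" using kap D k by (simp add: \<kappa>'_def)
  have tailT: "measure N {x\<in>space N. s < D * real (\<tau> k x)} \<le> A' * exp (- \<kappa>' * s powr a)" if s: "0 < s" for s
  proof -
    have "measure N {x\<in>space N. s < D * real (\<tau> k x)} \<le> real k * KN * (A * exp (- \<kappa> * (s / (D * real k)) powr a))"
      using KN_pos D k s by (intro order_trans[OF tau_tail[OF D k]] mult_left_mono tail) auto
    also have "(s / (D * real k)) powr a = (1 / (D * real k)) powr a * s powr a"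
      using s D k by (subst powr_mult[symmetric]) auto
    finally show ?thesis by (simp add: A'_def \<kappa>'_def mult_ac)
  qed
  define y where "y = \<gamma> / (4 * K) * real k"
  have y: "0 < y" using gam K_pos k by (simp add: y_def)
  then have "0 < y / exp 1" by simp
  from tail_integral_small[OF tau_integrable this] obtain M :: nat where
    M: "tail_integral (\<lambda>x. D * real (\<tau> k x)) (real M) \<le> ennreal (y / exp 1)" by blast
  define th where "th = 1 / (a + 2)"
  define b where "b = a / (a + 2)"
  have th: "0 < th" "th < 1" and b: "0 < b" "b \<le> 1 - th" "b \<le> a" and tha: "th * a = b"
    using a by (auto simp: th_def b_def field_simps)
  define r where "r = (\<integral>x. real (R x) \<partial>N)"
  have r0: "0 \<le> r" unfolding r_def by (intro integral_nonneg_AE) auto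
  define D2 where "D2 = (\<kappa> * a / 4) powr (- (2 / a))"
  have D20: "0 \<le> D2" by (simp add: D2_def)
  \<comment> \<open>One bound for each of the three contributions: a block above \<open>L\<close>, the exponential moment and a first
    return of order \<open>n\<close>. Halving \<open>\<kappa>'\<close> absorbs the number of blocks.\<close>
  define c' where "c' = min (\<kappa>' / 2) (min (\<gamma> / 4) (\<kappa> / 2 * (\<gamma> / B) powr a))"
  have c'0: "0 < c'" using kap kap' gam B1 by (simp add: c'_def)
  define Cc where "Cc = K * (4 * (A * D2) * (B / \<gamma>) + K * r * (KN * A' + measure N (space N)))"
  have Cc0: "0 \<le> Cc" unfolding Cc_def using K_pos KN_pos r0 A'0 A D20 B1 gam by auto
  have e1: "\<forall>\<^sub>F n::nat in sequentially. real n powr (th - 1) < \<gamma>"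
  proof -
    have "(\<lambda>n::nat. real n powr (th - 1)) \<longlonglongrightarrow> 0"
      using th by (intro tendsto_neg_powr filterlim_real_sequentially) auto
    then show ?thesis using gam by (intro order_tendstoD) auto
  qed
  have e2: "\<forall>\<^sub>F n::nat in sequentially. real n powr (- th) * real M < 1 / 2"
  proof -
    have "(\<lambda>n::nat. real n powr (- th)) \<longlonglongrightarrow> 0"
      using th by (intro tendsto_neg_powr filterlim_real_sequentially) auto
    then have "(\<lambda>n::nat. real n powr (- th) * real M) \<longlonglongrightarrow> 0 * real M" by (intro tendsto_intros)
    then show ?thesis by (intro order_tendstoD) auto
  qed
  have e3: "\<forall>\<^sub>F n::nat in sequentially. (real n + 1) * exp (- (\<kappa>' / 2) * real n powr b) < 1"
  proof -
    have "(\<lambda>n::nat. (real n + 1) * exp (- (\<kappa>' / 2) * real n powr b)) \<longlonglongrightarrow> 0"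
      using kap' b(1) by real_asymp
    then show ?thesis by (intro order_tendstoD) auto
  qed
  have "\<forall>\<^sub>F n in sequentially. measure \<mu> {x\<in>space m. 3 * \<gamma> * real n < \<bar>birkhoff_sum f \<phi> n x\<bar>} \<le> Cc * exp (- c' * real n powr b)"
    using e1 e2 e3 eventually_gt_at_top[of 1]
  proof eventually_elim
    fix n :: nat assume n1: "real n powr (th - 1) < \<gamma>" and n2: "real n powr (- th) * real M < 1 / 2"
      and n3: "(real n + 1) * exp (- (\<kappa>' / 2) * real n powr b) < 1" and n: "1 < n"
    have rn: "0 < real n" "1 \<le> real n" using n by auto
    define E where "E = exp (- c' * real n powr b)"
    have E0: "0 \<le> E" by (simp add: E_def)
    define L where "L = real n powr th"
    define lam where "lam = real n powr (- th)"
    have L0: "0 < L" and lam0: "0 < lam" using n by (auto simp: L_def lam_def)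
    have lamL: "lam * L = 1" using rn by (simp add: lam_def L_def powr_add[symmetric])
    have Ln: "L \<le> \<gamma> * real n"
    proof -
      have "L = real n powr (th - 1) * real n"
        using rn powr_mult_base[of "real n" "th - 1"] by (simp add: L_def mult.commute)
      also have "\<dots> \<le> \<gamma> * real n" using n1 by (intro mult_right_mono) auto
      finally show ?thesis .
    qed
    have tT: "ennreal (exp (lam * L)) * tail_integral (\<lambda>x. (B + c) * real (\<tau> k x)) (real M) \<le> ennreal (\<gamma> / (4 * K) * real k)"
    proof -
      have "ennreal (exp (lam * L)) * tail_integral (\<lambda>x. D * real (\<tau> k x)) (real M) \<le> ennreal (exp 1) * ennreal (y / exp 1)"
        unfolding lamL by (intro mult_left_mono M) auto
      also have "\<dots> = ennreal y" using y by (simp add: ennreal_mult[symmetric])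
      finally show ?thesis by (simp add: D_def y_def)
    qed
    have M2: "lam * real M \<le> 1 / 2" using n2 by (simp add: lam_def)
    have p1: "tail_integral (\<lambda>x. real (R x)) (\<gamma> * real n / B) \<le> ennreal (4 * (A * D2) * (B / \<gamma>) * E)"
    proof -
      let ?t = "\<gamma> * real n / B"
      have t0: "0 < ?t" using gam rn B1 by simp
      have tail_t: "tail_integral (\<lambda>x. real (R x)) ?t \<le> ennreal (4 * (A * exp (- (\<kappa> / 2) * ?t powr a) * D2) / ?t)"
        unfolding D2_def by (rule stretched_tail_integral[OF A a kap t0 tail])
      have "4 * (A * exp (- (\<kappa> / 2) * ?t powr a) * D2) / ?t = 4 * (A * D2) * (1 / ?t) * exp (- (\<kappa> / 2) * ?t powr a)"
        by simp
      also have "\<dots> \<le> 4 * (A * D2) * (B / \<gamma>) * E"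
      proof (intro mult_mono)
        have "\<gamma> / B \<le> ?t" using gam B1 rn by (simp add: field_simps)
        then have "1 / ?t \<le> 1 / (\<gamma> / B)" using gam B1 t0 by (intro divide_left_mono mult_pos_pos) auto
        then show "1 / ?t \<le> B / \<gamma>" by simp
        have "?t powr a = (\<gamma> / B) powr a * real n powr a" using gam B1 by (subst powr_mult[symmetric]) auto
        also have "\<dots> \<ge> (\<gamma> / B) powr a * real n powr b" using b rn by (intro mult_left_mono powr_mono) auto
        finally have "\<kappa> / 2 * ((\<gamma> / B) powr a * real n powr b) \<le> \<kappa> / 2 * ?t powr a" using kap by (intro mult_left_mono) auto
        moreover have "c' * real n powr b \<le> (\<kappa> / 2 * (\<gamma> / B) powr a) * real n powr b"
          by (intro mult_right_mono) (auto simp: c'_def)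
        ultimately have "c' * real n powr b \<le> \<kappa> / 2 * ?t powr a" by (simp only: mult.assoc)
        then show "exp (- (\<kappa> / 2) * ?t powr a) \<le> E" unfolding E_def by simp
      qed (use A D20 B1 gam rn in auto)
      finally show ?thesis using tail_t by (meson ennreal_leI order_trans)
    qed
    have p2: "(real n + 1) * measure N {x\<in>space N. L < D * real (\<tau> k x)} \<le> A' * E"
    proof -
      have La: "L powr a = real n powr b" using rn by (simp add: L_def powr_powr tha)
      have "(real n + 1) * measure N {x\<in>space N. L < D * real (\<tau> k x)} \<le> (real n + 1) * (A' * exp (- \<kappa>' * real n powr b))"
        using tailT[OF L0] rn by (intro mult_left_mono) (auto simp: La)
      also have "exp (- \<kappa>' * real n powr b) = exp (- (\<kappa>' / 2) * real n powr b) * exp (- (\<kappa>' / 2) * real n powr b)"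
        by (simp add: exp_add[symmetric])
      also have "(real n + 1) * (A' * (exp (- (\<kappa>' / 2) * real n powr b) * exp (- (\<kappa>' / 2) * real n powr b)))
        = A' * (((real n + 1) * exp (- (\<kappa>' / 2) * real n powr b)) * exp (- (\<kappa>' / 2) * real n powr b))" by (simp only: mult_ac)
      also have "\<dots> \<le> A' * (1 * E)"
      proof (intro mult_left_mono mult_mono)
        have "c' * real n powr b \<le> (\<kappa>' / 2) * real n powr b" by (intro mult_right_mono) (auto simp: c'_def)
        then show "exp (- (\<kappa>' / 2) * real n powr b) \<le> E" unfolding E_def by simp
      qed (use n3 A'0 in auto)
      finally show ?thesis by simp
    qed
    have p3: "exp (- (lam * \<gamma> * real n / 4)) \<le> E"
    proof -
      have "lam * real n = real n powr (1 - th)"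
        using rn powr_mult_base[of "real n" "- th"] by (simp add: lam_def mult.commute)
      also have "\<dots> \<ge> real n powr b" using b rn by (intro powr_mono) auto
      finally have "\<gamma> / 4 * real n powr b \<le> \<gamma> / 4 * (lam * real n)" using gam by (intro mult_left_mono) auto
      moreover have "c' * real n powr b \<le> \<gamma> / 4 * real n powr b" by (intro mult_right_mono) (auto simp: c'_def)
      ultimately have "c' * real n powr b \<le> lam * \<gamma> * real n / 4" by (simp add: mult_ac)
      then show ?thesis unfolding E_def by simp
    qed
    have "emeasure \<mu> {x\<in>space m. 3 * \<gamma> * real n < \<bar>birkhoff_sum f \<phi> n x\<bar>}
      \<le> ennreal K * (tail_integral (\<lambda>x. real (R x)) (\<gamma> * real n / B)
       + ennreal (K * (\<integral>x. real (R x) \<partial>N) * (KN * ((real n + 1) * measure N {x\<in>space N. L < (B + c) * real (\<tau> k x)})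
           + measure N (space N) * exp (- (lam * \<gamma> * real n / 4)))))"
      using L0 by (intro deviation_bound[OF v phi B B1 gam k lam0 M2 _ Ln meanU tT]) auto
    also have "\<dots> \<le> ennreal K * (ennreal (4 * (A * D2) * (B / \<gamma>) * E)
       + ennreal (K * r * (KN * (A' * E) + measure N (space N) * E)))"
    proof (intro mult_left_mono add_mono p1)
      show "ennreal (K * (\<integral>x. real (R x) \<partial>N) * (KN * ((real n + 1) * measure N {x\<in>space N. L < (B + c) * real (\<tau> k x)})
           + measure N (space N) * exp (- (lam * \<gamma> * real n / 4))))
         \<le> ennreal (K * r * (KN * (A' * E) + measure N (space N) * E))"
        unfolding r_def[symmetric] D_def[symmetric] using K_pos KN_pos r0
        by (intro ennreal_leI mult_left_mono add_mono p2 p3) auto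
    qed auto
    also have "\<dots> = ennreal (Cc * E)"
    proof -
      have g: "ennreal K * (ennreal u + ennreal w) = ennreal (K * (u + w))" if "0 \<le> u" "0 \<le> w" for u w
        using that K_pos by (simp add: ennreal_mult)
      have "ennreal K * (ennreal (4 * (A * D2) * (B / \<gamma>) * E) + ennreal (K * r * (KN * (A' * E) + measure N (space N) * E)))
        = ennreal (K * (4 * (A * D2) * (B / \<gamma>) * E + K * r * (KN * (A' * E) + measure N (space N) * E)))"
        by (rule g) (use K_pos KN_pos r0 A'0 A D20 B1 gam E0 in auto)
      also have "K * (4 * (A * D2) * (B / \<gamma>) * E + K * r * (KN * (A' * E) + measure N (space N) * E)) = Cc * E"
        unfolding Cc_def by (simp only: distrib_left distrib_right mult.assoc mult.commute mult.left_commute)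
      finally show ?thesis .
    qed
    finally show "measure \<mu> {x\<in>space m. 3 * \<gamma> * real n < \<bar>birkhoff_sum f \<phi> n x\<bar>} \<le> Cc * exp (- c' * real n powr b)"
      using Cc0 E0 by (simp add: mu.emeasure_eq_measure E_def)
  qed
  then show ?thesis unfolding b_def using Cc0 c'0 by blast
qed

end

section \<open>Hoelder observables and the conclusion\<close>

text \<open>Finitely many exceptional \<open>n\<close> are absorbed into the constant, because \<open>u\<close> is bounded by \<open>1\<close>.\<close>

lemma eventually_le_imp_all:
  fixes u r :: "nat \<Rightarrow> real"
  assumes ev: "\<forall>\<^sub>F n in sequentially. u n \<le> C * r n" and C: "0 \<le> C"
    and r: "\<And>n. 1 \<le> n \<Longrightarrow> 0 < r n" and u: "\<And>n. u n \<le> 1"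
  shows "\<exists>C'>0. \<forall>n\<ge>1. u n \<le> C' * r n"
proof -
  obtain n0 where n0: "\<And>n. n0 \<le> n \<Longrightarrow> u n \<le> C * r n" using ev by (auto simp: eventually_sequentially)
  define C' where "C' = C + 1 + (\<Sum>i\<in>{1..<n0}. 1 / r i)"
  have s0: "0 \<le> (\<Sum>i\<in>{1..<n0}. 1 / r i)" using r by (intro sum_nonneg) (auto intro: less_imp_le)
  have "u n \<le> C' * r n" if n: "1 \<le> n" for n
  proof (cases "n0 \<le> n")
    case True
    have "u n \<le> C * r n" by (rule n0[OF True])
    also have "\<dots> \<le> C' * r n" using s0 r[OF n] by (intro mult_right_mono) (auto simp: C'_def)
    finally show ?thesis .
  next
    case False
    have "1 / r n \<le> (\<Sum>i\<in>{1..<n0}. 1 / r i)"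
      using False n r by (intro member_le_sum) (auto intro: less_imp_le)
    then have "1 / r n \<le> C'" using C by (simp add: C'_def)
    then have "1 \<le> C' * r n" using r[OF n] by (simp add: field_simps)
    then show ?thesis using u[of n] by linarith
  qed
  moreover have "0 < C'" using C s0 by (simp add: C'_def)
  ultimately show ?thesis by blast
qed

context induced_system begin

text \<open>Passes from integer to real thresholds; for \<open>s \<ge> 1\<close> the integer part of \<open>s\<close> is at least \<open>s / 2\<close>.\<close>

lemma tail_floor:
  fixes g :: "real \<Rightarrow> real"
  assumes nat_tail: "\<And>n::nat. 1 \<le> n \<Longrightarrow> measure m {x\<in>\<Delta>. n < R x} \<le> g (real n)"
    and anti: "\<And>s t. 0 < s \<Longrightarrow> s \<le> t \<Longrightarrow> g t \<le> g s" and s: "1 \<le> s"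
  shows "measure N {x\<in>space N. s < real (R x)} \<le> g (s / 2)"
proof -
  define n where "n = nat \<lfloor>s\<rfloor>"
  have fl: "1 \<le> \<lfloor>s\<rfloor>" using s by (simp add: le_floor_iff)
  have n: "real n \<le> s" "s < real n + 1" "1 \<le> n"
    unfolding n_def using s fl by (simp_all add: floor_correct nat_le_iff) linarith+
  have [measurable]: "{x\<in>space N. n < R x} \<in> sets N" by measurable
  have "measure N {x\<in>space N. s < real (R x)} \<le> measure N {x\<in>space N. n < R x}"
    using n(1) by (intro finite_measure_mono) auto
  also have "\<dots> = measure m {x\<in>\<Delta>. n < R x}"
  proof -
    have "{x\<in>space N. n < R x} = {x\<in>\<Delta>. n < R x}" by (simp add: space_N)
    then show ?thesis
      unfolding N_eq using Delta_sets sets.sets_into_space[OF Delta_sets]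
      by (subst measure_restrict_space) (auto simp: space_restrict_space Int_absorb2)
  qed
  also have "\<dots> \<le> g (real n)" by (rule nat_tail[OF n(3)])
  also have "\<dots> \<le> g (s / 2)"
  proof (rule anti)
    have "1 \<le> real n" using n(3) by simp
    then show "s / 2 \<le> real n" using n by linarith
    show "0 < s / 2" using s by simp
  qed
  finally show ?thesis .
qed

lemma polynomial_tail:
  assumes a: "0 < a" and C: "0 < (C'::real)"
    and nat_tail: "\<And>n::nat. 1 \<le> n \<Longrightarrow> measure m {x\<in>\<Delta>. n < R x} \<le> C' * real n powr (- a)"
    and s: "0 < s"
  shows "measure N {x\<in>space N. s < real (R x)} \<le> (C' * (1 / 2) powr (- a) + measure N (space N)) * s powr (- a)"
proof (cases "1 \<le> s")
  case True
  have "measure N {x\<in>space N. s < real (R x)} \<le> C' * (s / 2) powr (- a)"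
    using a C by (intro tail_floor[where g = "\<lambda>s. C' * s powr (- a)", OF nat_tail _ True] mult_left_mono powr_mono2') auto
  also have "(s / 2) powr (- a) = (1 / 2) powr (- a) * s powr (- a)" using s by (subst powr_mult[symmetric]) auto
  also have "C' * ((1 / 2) powr (- a) * s powr (- a)) \<le> (C' * (1 / 2) powr (- a) + measure N (space N)) * s powr (- a)"
    by (simp add: distrib_right)
  finally show ?thesis .
next
  case False
  have "measure N {x\<in>space N. s < real (R x)} \<le> measure N (space N) * 1" by (simp add: finite_measure_mono)
  also have "1 powr (- a) \<le> s powr (- a)" using False s a by (intro powr_mono2') auto
  then have "measure N (space N) * 1 \<le> measure N (space N) * s powr (- a)" by (intro mult_left_mono) auto
  also have "\<dots> \<le> (C' * (1 / 2) powr (- a) + measure N (space N)) * s powr (- a)"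
    using C by (intro mult_right_mono) auto
  finally show ?thesis .
qed

lemma stretched_tail:
  assumes a: "0 < a" and C: "0 < (C'::real)" and kap: "0 < (\<kappa>::real)"
    and nat_tail: "\<And>n::nat. 1 \<le> n \<Longrightarrow> measure m {x\<in>\<Delta>. n < R x} \<le> C' * exp (- \<kappa> * real n powr a)"
    and s: "0 < s"
  shows "measure N {x\<in>space N. s < real (R x)}
    \<le> (C' + measure N (space N) * exp \<kappa>) * exp (- (\<kappa> * (1 / 2) powr a) * s powr a)"
proof -
  have p: "(s / 2) powr a = (1 / 2) powr a * s powr a" using s by (subst powr_mult[symmetric]) auto
  have e: "exp (- (\<kappa> * (1 / 2) powr a) * s powr a) = exp (- \<kappa> * (s / 2) powr a)" by (simp add: p)
  show ?thesis
    unfolding e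
  proof (cases "1 \<le> s")
    case True
    have "measure N {x\<in>space N. s < real (R x)} \<le> C' * exp (- \<kappa> * (s / 2) powr a)"
      using a C kap by (intro tail_floor[where g = "\<lambda>s. C' * exp (- \<kappa> * s powr a)", OF nat_tail _ True]) (auto intro!: powr_mono2)
    also have "\<dots> \<le> (C' + measure N (space N) * exp \<kappa>) * exp (- \<kappa> * (s / 2) powr a)"
      by (intro mult_right_mono) auto
    finally show "measure N {x\<in>space N. s < real (R x)} \<le> (C' + measure N (space N) * exp \<kappa>) * exp (- \<kappa> * (s / 2) powr a)" .
  next
    case False
    have "(s / 2) powr a \<le> 1 powr a" using False s a by (intro powr_mono2) auto
    then have "\<kappa> * (s / 2) powr a \<le> \<kappa>" using kap by simp
    then have "1 \<le> exp \<kappa> * exp (- \<kappa> * (s / 2) powr a)" by (simp add: exp_add[symmetric])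
    then have "measure N (space N) * 1 \<le> measure N (space N) * (exp \<kappa> * exp (- \<kappa> * (s / 2) powr a))" by (intro mult_left_mono) auto
    moreover have "measure N {x\<in>space N. s < real (R x)} \<le> measure N (space N)" by (simp add: finite_measure_mono)
    moreover have "0 \<le> C' * exp (- \<kappa> * (s / 2) powr a)" using C by simp
    ultimately show "measure N {x\<in>space N. s < real (R x)} \<le> (C' + measure N (space N) * exp \<kappa>) * exp (- \<kappa> * (s / 2) powr a)"
      by (simp add: distrib_right mult.assoc)
  qed
qed

text \<open>Expansion gives \<open>d (f\<^sup>j x) (f\<^sup>j y) \<le> C\<^sup>2 b\<^sup>n\<close> along the excursion, and the exponent \<open>\<eta>\<close> turns the rate \<open>b\<close> into
  \<open>b\<^sup>\<eta>\<close>.\<close>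

lemma holder_variation_bound:
  fixes d :: "'a \<Rightarrow> 'a \<Rightarrow> real"
  assumes metric: "Metric_space (space m) d" and ex: "expanding d f F R P" and eta: "0 < \<eta>" and H: "0 \<le> H"
    and holder: "\<And>x y. x \<in> space m \<Longrightarrow> y \<in> space m \<Longrightarrow> \<bar>\<phi> x - \<phi> y\<bar> \<le> H * d x y powr \<eta>"
  obtains c \<theta> where "variation_bound c \<theta> \<phi>"
proof -
  interpret M: Metric_space "space m" d by (rule metric)
  from ex obtain C2 b where C2: "0 < C2" and b: "0 < b" "b < 1"
    and ex_all: "\<forall>\<omega>\<in>P. \<forall>x\<in>\<omega>. \<forall>y\<in>\<omega>. d (F x) (F y) \<le> C2 * epow b (separation_time F P x y) \<and>
       (\<forall>j\<le>R x. d ((f ^^ j) x) ((f ^^ j) y) \<le> C2 * d (F x) (F y))"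
    unfolding expanding_def by (elim exE conjE) (rule that)
  have ex: "d (F x) (F y) \<le> C2 * epow b (separation_time F P x y) \<and>
       (\<forall>j\<le>R x. d ((f ^^ j) x) ((f ^^ j) y) \<le> C2 * d (F x) (F y))"
    if "\<omega> \<in> P" "x \<in> \<omega>" "y \<in> \<omega>" for \<omega> x y
    using bspec[OF bspec[OF bspec[OF ex_all that(1)] that(2)] that(3)] .
  have "variation_bound (H * (C2 * C2) powr \<eta>) (b powr \<eta>) \<phi>"
    unfolding variation_bound_def
  proof (intro conjI ballI allI impI)
    show "0 \<le> H * (C2 * C2) powr \<eta>" using H by simp
    show "0 < b powr \<eta>" using b by simp
    show "b powr \<eta> < 1" using b eta powr_less_mono2[of \<eta> b 1] by simp
    fix \<omega> x y n j
    assume w: "\<omega> \<in> P" "x \<in> \<omega>" "y \<in> \<omega>" and j: "j < R x" and n: "enat n \<le> separation_time F P x y"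
    have "\<omega> \<subseteq> space m" using P_sub_space[OF w(1)] space_N sets.sets_into_space[OF Delta_sets] by simp
    then have xy: "(f ^^ j) x \<in> space m" "(f ^^ j) y \<in> space m"
      using w measurable_space[OF f_funpow_measurable] by blast+
    have d1: "d ((f ^^ j) x) ((f ^^ j) y) \<le> C2 * d (F x) (F y)" using conjunct2[OF ex[OF w]] j by simp
    have "d (F x) (F y) \<le> C2 * epow b (separation_time F P x y)" by (rule conjunct1[OF ex[OF w]])
    also have "\<dots> \<le> C2 * b ^ n" using C2 epow_le[OF b n] by (intro mult_left_mono) auto
    finally have "C2 * d (F x) (F y) \<le> C2 * (C2 * b ^ n)" using C2 by (intro mult_left_mono) auto
    with d1 have "d ((f ^^ j) x) ((f ^^ j) y) \<le> C2 * C2 * b ^ n" by simp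
    then have "d ((f ^^ j) x) ((f ^^ j) y) powr \<eta> \<le> (C2 * C2 * b ^ n) powr \<eta>"
      using eta by (intro powr_mono2) auto
    also have "\<dots> = (C2 * C2) powr \<eta> * (b powr \<eta>) ^ n"
    proof -
      have "(b ^ n) powr \<eta> = (b powr \<eta>) ^ n"
        using b by (simp add: powr_realpow[symmetric] powr_powr mult.commute)
      then show ?thesis using C2 b by (subst powr_mult) auto
    qed
    finally have "H * d ((f ^^ j) x) ((f ^^ j) y) powr \<eta> \<le> H * ((C2 * C2) powr \<eta> * (b powr \<eta>) ^ n)"
      using H by (intro mult_left_mono)
    with holder[OF xy] show "\<bar>\<phi> ((f ^^ j) x) - \<phi> ((f ^^ j) y)\<bar> \<le> H * (C2 * C2) powr \<eta> * (b powr \<eta>) ^ n"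
      by (simp add: mult.assoc)
  qed
  then show thesis by (rule that)
qed

lemma AE_mu_funpow:
  assumes "AE x in \<mu>. Q x" shows "AE x in \<mu>. Q ((f ^^ i) x)"
proof (induction i)
  case 0 then show ?case using assms by simp
next
  case (Suc i)
  have "AE x in distr \<mu> \<mu> f. Q ((f ^^ i) x)" unfolding mu_inv by (rule Suc)
  then show ?case by (auto dest!: AE_distrD[OF f_measurable_mu] simp: funpow_swap1)
qed

text \<open>Clamping \<open>\<phi>\<close> to its essential bound makes it bounded everywhere without enlarging its Hoelder
  constant, and changes it only on a null set, hence along almost no orbit by invariance of \<open>\<mu>\<close>.
  Subtracting the mean centres it.\<close>

lemma holder_reduction:
  fixes d :: "'a \<Rightarrow> 'a \<Rightarrow> real"
  assumes metric: "Metric_space (space m) d" and ex: "expanding d f F R P" and eta: "0 < \<eta>"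
    and phi: "\<phi> \<in> holder_Linf m d \<eta>"
  obtains c \<theta> \<psi> B where "variation_bound c \<theta> \<psi>" "\<psi> \<in> borel_measurable m" "\<And>x. \<bar>\<psi> x\<bar> \<le> B" "0 < B"
    "(\<integral>x. \<psi> x \<partial>\<mu>) = 0"
    "\<And>\<gamma> n. 1 \<le> n \<Longrightarrow> LD f \<mu> \<phi> (3 * \<gamma>) n = measure \<mu> {x\<in>space m. 3 * \<gamma> * real n < \<bar>birkhoff_sum f \<psi> n x\<bar>}"
proof -
  interpret M: Metric_space "space m" d by (rule metric)
  interpret mu: prob_space \<mu> by (rule mu_prob)
  from phi obtain H0 B0 where H0: "\<And>x y. x \<in> space m \<Longrightarrow> y \<in> space m \<Longrightarrow> x \<noteq> y \<Longrightarrow> \<bar>\<phi> x - \<phi> y\<bar> / d x y powr \<eta> \<le> H0"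
    and meas[measurable]: "\<phi> \<in> borel_measurable m" and B0: "AE x in m. \<bar>\<phi> x\<bar> \<le> B0"
    unfolding holder_Linf_def bdd_above_def by blast
  define H where "H = max H0 0"
  have holder: "\<bar>\<phi> x - \<phi> y\<bar> \<le> H * d x y powr \<eta>" if xy: "x \<in> space m" "y \<in> space m" for x y
  proof (cases "x = y")
    case False
    then have "0 < d x y powr \<eta>" using M.mdist_pos_eq[OF xy] by simp
    then have "\<bar>\<phi> x - \<phi> y\<bar> \<le> H0 * d x y powr \<eta>" using H0[OF xy False] by (simp add: divide_le_eq)
    also have "\<dots> \<le> H * d x y powr \<eta>" by (intro mult_right_mono) (auto simp: H_def)
    finally show ?thesis .
  qed (simp add: H_def)
  define b where "b = max B0 1"
  define \<phi>' where "\<phi>' x = max (- b) (min b (\<phi> x))" for x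
  define I where "I = (\<integral>x. \<phi> x \<partial>\<mu>)"
  define \<psi> where "\<psi> x = \<phi>' x - I" for x
  have [measurable]: "\<phi>' \<in> borel_measurable m" unfolding \<phi>'_def by measurable
  have [measurable]: "\<psi> \<in> borel_measurable m" unfolding \<psi>_def by measurable
  have mm: "g \<in> borel_measurable \<mu>" if "g \<in> borel_measurable m" for g :: "'a \<Rightarrow> real"
    using that measurable_cong_sets[OF sets_mu refl] by blast
  note mm[measurable]
  have b1: "1 \<le> b" "B0 \<le> b" by (auto simp: b_def)
  have chib: "\<bar>\<phi>' x\<bar> \<le> b" for x using b1 by (auto simp: \<phi>'_def)
  have "AE x in \<mu>. \<bar>\<phi> x\<bar> \<le> B0"
    using absolutely_continuous_AE[OF sets_mu ac B0] .
  then have eq: "AE x in \<mu>. \<phi> x = \<phi>' x"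
    by eventually_elim (use b1 in \<open>auto simp: \<phi>'_def\<close>)
  have Ichi: "I = (\<integral>x. \<phi>' x \<partial>\<mu>)" unfolding I_def using eq by (intro integral_cong_AE) auto
  have int: "integrable \<mu> \<phi>'" using chib by (intro mu.integrable_const_bound[where B = b]) auto
  have "\<bar>I\<bar> \<le> b"
  proof -
    have "\<bar>I\<bar> \<le> (\<integral>x. \<bar>\<phi>' x\<bar> \<partial>\<mu>)" unfolding Ichi by (rule integral_abs_bound)
    also have "\<dots> \<le> (\<integral>x. b \<partial>\<mu>)" using int chib by (intro integral_mono) auto
    finally show ?thesis by (simp add: mu.prob_space)
  qed
  then have psib: "\<bar>\<psi> x\<bar> \<le> 2 * b" for x using chib[of x] unfolding \<psi>_def by linarith
  have zero: "(\<integral>x. \<psi> x \<partial>\<mu>) = 0" unfolding \<psi>_def using int by (simp add: Ichi mu.prob_space)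
  have hpsi: "\<bar>\<psi> x - \<psi> y\<bar> \<le> H * d x y powr \<eta>" if xy: "x \<in> space m" "y \<in> space m" for x y
  proof -
    have "\<bar>\<psi> x - \<psi> y\<bar> \<le> \<bar>\<phi> x - \<phi> y\<bar>" unfolding \<psi>_def \<phi>'_def by (auto simp: max_def min_def abs_if)
    then show ?thesis using holder[OF xy] by linarith
  qed
  obtain c \<theta> where v: "variation_bound c \<theta> \<psi>"
    by (rule holder_variation_bound[OF metric ex eta _ hpsi]) (simp_all add: H_def)
  have LD: "LD f \<mu> \<phi> (3 * \<gamma>) n = measure \<mu> {x\<in>space m. 3 * \<gamma> * real n < \<bar>birkhoff_sum f \<psi> n x\<bar>}" if n: "1 \<le> n" for \<gamma> n
  proof -
    have fm[measurable]: "f ^^ i \<in> \<mu> \<rightarrow>\<^sub>M \<mu>" for i by (rule measurable_compose_n) measurable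
    have "AE x in \<mu>. \<forall>i. \<phi> ((f ^^ i) x) = \<phi>' ((f ^^ i) x)"
      by (intro AE_all_countable[THEN iffD2] allI AE_mu_funpow eq)
    then have ae: "AE x in \<mu>. (x \<in> {x\<in>space \<mu>. 3 * \<gamma> < \<bar>1 / real n * (\<Sum>i<n. \<phi> ((f ^^ i) x)) - I\<bar>})
      = (x \<in> {x\<in>space m. 3 * \<gamma> * real n < \<bar>birkhoff_sum f \<psi> n x\<bar>})"
    proof eventually_elim
      fix x assume x: "\<forall>i. \<phi> ((f ^^ i) x) = \<phi>' ((f ^^ i) x)"
      have "birkhoff_sum f \<psi> n x = (\<Sum>i<n. \<phi> ((f ^^ i) x)) - real n * I"
        using x by (simp add: birkhoff_sum_def \<psi>_def sum_subtractf)
      also have "\<dots> = real n * (1 / real n * (\<Sum>i<n. \<phi> ((f ^^ i) x)) - I)"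
        using n by (simp add: algebra_simps)
      finally have "\<bar>birkhoff_sum f \<psi> n x\<bar> = \<bar>1 / real n * (\<Sum>i<n. \<phi> ((f ^^ i) x)) - I\<bar> * real n"
        by (simp add: abs_mult)
      then show "(x \<in> {x\<in>space \<mu>. 3 * \<gamma> < \<bar>1 / real n * (\<Sum>i<n. \<phi> ((f ^^ i) x)) - I\<bar>})
        = (x \<in> {x\<in>space m. 3 * \<gamma> * real n < \<bar>birkhoff_sum f \<psi> n x\<bar>})"
        using n by (simp add: space_mu)
    qed
    have [measurable]: "birkhoff_sum f \<psi> n \<in> borel_measurable \<mu>" by (intro birkhoff_sum_measurable) measurable
    show ?thesis
      unfolding LD_def I_def[symmetric]
    proof (rule mu.finite_measure_eq_AE[OF ae])
      show "{x\<in>space \<mu>. 3 * \<gamma> < \<bar>1 / real n * (\<Sum>i<n. \<phi> ((f ^^ i) x)) - I\<bar>} \<in> sets \<mu>" by measurable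
      have "{x\<in>space \<mu>. 3 * \<gamma> * real n < \<bar>birkhoff_sum f \<psi> n x\<bar>} \<in> sets \<mu>" by measurable
      then show "{x\<in>space m. 3 * \<gamma> * real n < \<bar>birkhoff_sum f \<psi> n x\<bar>} \<in> sets \<mu>" by (simp add: space_mu)
    qed
  qed
  show thesis by (rule that[OF v _ psib _ zero LD]) (use b1 in auto)
qed

end

theorem corollary3:
  fixes m \<mu> :: "'a measure" and d :: "'a \<Rightarrow> 'a \<Rightarrow> real" and f F :: "'a \<Rightarrow> 'a"
    and \<Delta>\<^sub>0 :: "'a set" and R :: "'a \<Rightarrow> nat" and P\<^sub>0 :: "'a set set" and \<eta> :: real
  assumes "Metric_space (space m) d"
    and "f \<in> m \<rightarrow>\<^sub>M m" and "absolutely_continuous m (distr m m f)"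
    and "\<Delta>\<^sub>0 \<in> sets m" and "0 < emeasure m \<Delta>\<^sub>0" and "emeasure m \<Delta>\<^sub>0 < \<infinity>"
    and "induced_map (restrict_space m \<Delta>\<^sub>0) f F R P\<^sub>0"
    and "weak_gibbs_markov (restrict_space m \<Delta>\<^sub>0) F P\<^sub>0"
    and "aperiodic (restrict_space m \<Delta>\<^sub>0) F P\<^sub>0"
    and "expanding d f F R P\<^sub>0"
    and "coprime_block (restrict_space m \<Delta>\<^sub>0) F R P\<^sub>0"
    and "integrable (restrict_space m \<Delta>\<^sub>0) (\<lambda>x. real (R x))"
    and "ergodic_invariant_prob m f \<mu>" and "absolutely_continuous m \<mu>" and "0 < measure \<mu> \<Delta>\<^sub>0"
    and "0 < \<eta>"
  shows "(\<forall>C a :: real. C > 0 \<and> a > 1 \<and>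
            (\<forall>n\<ge>1. measure m {x \<in> \<Delta>\<^sub>0. R x > n} \<le> C * real n powr (- a)) \<longrightarrow>
            (\<forall>\<epsilon>>0. \<forall>\<phi>\<in>holder_Linf m d \<eta>. \<exists>C'>0. \<forall>n\<ge>1.
               LD f \<mu> \<phi> \<epsilon> n \<le> C' * real n powr (- a + 1))) \<and>
         (\<forall>C c a :: real. C > 0 \<and> c > 0 \<and> 0 < a \<and> a \<le> 1 \<and>
            (\<forall>n\<ge>1. measure m {x \<in> \<Delta>\<^sub>0. R x > n} \<le> C * exp (- c * real n powr a)) \<longrightarrow>
            (\<forall>\<epsilon>>0. \<forall>\<phi>\<in>holder_Linf m d \<eta>. \<exists>C'>0. \<exists>c'>0. \<forall>n\<ge>1.
               LD f \<mu> \<phi> \<epsilon> n \<le> C' * exp (- c' * real n powr (a / (a + 2)))))"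
proof -
  define N where "N = restrict_space m \<Delta>\<^sub>0"
  note wgm = assms(8)[folded N_def, unfolded weak_gibbs_markov_def]
  obtain J where J: "jacobian N F P\<^sub>0 J" "gibbs F P\<^sub>0 J" using wgm by blast
  obtain CF \<beta> where gb: "0 < CF" "0 < \<beta>" "\<beta> < 1"
    and gibbs_all: "\<forall>\<omega>\<in>P\<^sub>0. \<forall>x\<in>\<omega>. \<forall>y\<in>\<omega>.
      ln (J x / J y) \<le> CF * epow \<beta> (separation_time F P\<^sub>0 (F x) (F y))"
    using J(2) unfolding gibbs_def by (elim exE conjE) (rule that)
  have gibbs: "ln (J x / J y) \<le> CF * epow \<beta> (separation_time F P\<^sub>0 (F x) (F y))"
    if "\<omega> \<in> P\<^sub>0" "x \<in> \<omega>" "y \<in> \<omega>" for \<omega> x y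
    by (rule bspec[OF bspec[OF bspec[OF gibbs_all that(1)] that(2)] that(3)])
  have "long_branches N F P\<^sub>0" using wgm by blast
  then obtain \<delta> where dl: "0 < \<delta>" "\<And>\<omega>. \<omega> \<in> P\<^sub>0 \<Longrightarrow> \<delta> \<le> measure N (F ` \<omega>)"
    unfolding long_branches_def by blast
  have fin: "emeasure N (space N) < \<infinity>" and pos: "0 < emeasure N (space N)" using wgm by blast+
  interpret N: finite_measure N by (rule finite_measureI) (use fin in auto)
  note ind = assms(7)[folded N_def, unfolded induced_map_def]
  interpret induced_system N F P\<^sub>0 J CF \<beta> \<delta> m \<mu> \<Delta>\<^sub>0 f R
  proof unfold_locales
    show "F \<in> N \<rightarrow>\<^sub>M N" "partition_mod0 N P\<^sub>0" "markov N F P\<^sub>0" "separability N F P\<^sub>0" using wgm by blast+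
    show "F ` \<omega> \<in> sets N" if "\<omega> \<in> P\<^sub>0" for \<omega> using wgm that unfolding invertibility_domain_def by blast
    show "0 < measure N (space N)" using pos by (simp add: N.emeasure_eq_measure)
    show "R \<in> N \<rightarrow>\<^sub>M count_space UNIV" using ind by blast
    show "1 \<le> R x" if "x \<in> space N" for x using ind that by blast
    show "R x = R y" if "\<omega> \<in> P\<^sub>0" "x \<in> \<omega>" "y \<in> \<omega>" for \<omega> x y
      using ind that unfolding constant_on_def by metis
    show "F x = (f ^^ R x) x" if "\<omega> \<in> P\<^sub>0" "x \<in> \<omega>" for \<omega> x using ind that by blast
    show "integrable N (\<lambda>x. real (R x))" "aperiodic N F P\<^sub>0" using assms(9,12) by (simp_all add: N_def)
  qed (fact J gb gibbs dl N_def assms)+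
  interpret mu: prob_space \<mu> by (rule mu_prob)
  show ?thesis
  proof (intro conjI allI impI ballI; elim conjE)
    fix C a \<epsilon> :: real and \<phi>
    assume C: "C > 0" and a: "a > 1" and tail: "\<forall>n\<ge>1. measure m {x \<in> \<Delta>\<^sub>0. R x > n} \<le> C * real n powr (- a)"
      and eps: "\<epsilon> > 0" and phi: "\<phi> \<in> holder_Linf m d \<eta>"
    obtain c \<theta> \<psi> B where psi: "variation_bound c \<theta> \<psi>" "\<psi> \<in> borel_measurable m" "\<And>x. \<bar>\<psi> x\<bar> \<le> B" "0 < B"
      "(\<integral>x. \<psi> x \<partial>\<mu>) = 0"
      and LD: "\<And>\<gamma> n. 1 \<le> n \<Longrightarrow> LD f \<mu> \<phi> (3 * \<gamma>) n = measure \<mu> {x\<in>space m. 3 * \<gamma> * real n < \<bar>birkhoff_sum f \<psi> n x\<bar>}"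
      using holder_reduction[OF assms(1,10,16) phi] by blast
    have g: "0 < \<epsilon> / 3" using eps by simp
    have A: "0 \<le> C * (1 / 2) powr (- a) + measure N (space N)" using C by simp
    have rt: "measure N {x\<in>space N. s < real (R x)} \<le> (C * (1 / 2) powr (- a) + measure N (space N)) * s powr (- a)"
      if "0 < s" for s
      using a tail that by (intro polynomial_tail[OF _ C]) auto
    from polynomial_deviations[OF psi g a A rt] obtain C1 where C1: "0 \<le> C1"
      "\<forall>\<^sub>F n in sequentially. measure \<mu> {x\<in>space m. 3 * (\<epsilon> / 3) * real n < \<bar>birkhoff_sum f \<psi> n x\<bar>} \<le> C1 * real n powr (1 - a)"
      by blast
    have "\<exists>C'>0. \<forall>n\<ge>1. measure \<mu> {x\<in>space m. 3 * (\<epsilon> / 3) * real n < \<bar>birkhoff_sum f \<psi> n x\<bar>} \<le> C' * real n powr (1 - a)"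
      by (rule eventually_le_imp_all[OF C1(2,1)]) auto
    then show "\<exists>C'>0. \<forall>n\<ge>1. LD f \<mu> \<phi> \<epsilon> n \<le> C' * real n powr (- a + 1)"
      using LD[of _ "\<epsilon> / 3"] by (simp add: add.commute)
  next
    fix C c a \<epsilon> :: real and \<phi>
    assume C: "C > 0" and c: "c > 0" and a: "0 < a" "a \<le> 1"
      and tail: "\<forall>n\<ge>1. measure m {x \<in> \<Delta>\<^sub>0. R x > n} \<le> C * exp (- c * real n powr a)"
      and eps: "\<epsilon> > 0" and phi: "\<phi> \<in> holder_Linf m d \<eta>"
    obtain c0 \<theta> \<psi> B where psi: "variation_bound c0 \<theta> \<psi>" "\<psi> \<in> borel_measurable m" "\<And>x. \<bar>\<psi> x\<bar> \<le> B" "0 < B"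
      "(\<integral>x. \<psi> x \<partial>\<mu>) = 0"
      and LD: "\<And>\<gamma> n. 1 \<le> n \<Longrightarrow> LD f \<mu> \<phi> (3 * \<gamma>) n = measure \<mu> {x\<in>space m. 3 * \<gamma> * real n < \<bar>birkhoff_sum f \<psi> n x\<bar>}"
      using holder_reduction[OF assms(1,10,16) phi] by blast
    have g: "0 < \<epsilon> / 3" using eps by simp
    have A: "0 \<le> C + measure N (space N) * exp c" using C by simp
    have kap: "0 < c * (1 / 2) powr a" using c by simp
    have rt: "measure N {x\<in>space N. s < real (R x)} \<le> (C + measure N (space N) * exp c) * exp (- (c * (1 / 2) powr a) * s powr a)"
      if "0 < s" for s
      using tail that by (intro stretched_tail[OF a(1) C c]) auto
    from stretched_deviations[OF psi g a(1) A kap rt] obtain C1 c' where C1: "0 \<le> C1" "0 < c'"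
      "\<forall>\<^sub>F n in sequentially. measure \<mu> {x\<in>space m. 3 * (\<epsilon> / 3) * real n < \<bar>birkhoff_sum f \<psi> n x\<bar>} \<le> C1 * exp (- c' * real n powr (a / (a + 2)))"
      by blast
    have "\<exists>C'>0. \<forall>n\<ge>1. measure \<mu> {x\<in>space m. 3 * (\<epsilon> / 3) * real n < \<bar>birkhoff_sum f \<psi> n x\<bar>} \<le> C' * exp (- c' * real n powr (a / (a + 2)))"
      by (rule eventually_le_imp_all[OF C1(3,1)]) auto
    then show "\<exists>C'>0. \<exists>c'>0. \<forall>n\<ge>1. LD f \<mu> \<phi> \<epsilon> n \<le> C' * exp (- c' * real n powr (a / (a + 2)))"
      using LD[of _ "\<epsilon> / 3"] C1(2) by auto
  qed
qed

end
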